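(* For every fixed $\varepsilon>0$ there is a constant $C_\varepsilon$, depending only on $\varepsilon$, such that the following holds. Let $N_1,N_2$ be positive integers, $N=N_1N_2$, let $k\ge2$ be an integer, and let $\chi_1,\chi_2$ be quadratic Dirichlet characters modulo $N_1,N_2$ respectively. Let $p_0$ be the first positive integer coprime to $N$ at which the first sign change of $\sigma_{\chi_1,\chi_2}^{k-1}$ occurs, i.e. the least positive integer $n$ with $(n,N)=1$ and $\sigma_{\chi_1,\chi_2}^{k-1}(n)<0$. Then $$p_0\le C_\varepsilon\, N^{\frac{1}{4\sqrt e}+\varepsilon}.$$
   Context: For Dirichlet characters $\chi_1,\chi_2$ modulo $N_1,N_2$ and an integer $k\ge 2$, define for positive integers $n$ $$\sigma_{\chi_1,\chi_2}^{k-1}(n)=\sum_{d\mid n}\chi_1(n/d)\chi_2(d)d^{k-1}.$$ Note $\sigma_{\chi_1,\chi_2}^{k-1}(1)=1>0$. A Dirichlet character is quadratic if it is real-valued and non-principal. *)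

theory Defs
  imports Complex_Main "HOL-Library.Complex_Order"
begin

definition dirichlet_character :: "nat \<Rightarrow> (nat \<Rightarrow> complex) \<Rightarrow> bool" where
  "dirichlet_character N \<chi> \<longleftrightarrow>
     N > 0 \<and>
     (\<forall>n. \<chi> (n + N) = \<chi> n) \<and>
     (\<forall>m n. \<chi> (m * n) = \<chi> m * \<chi> n) \<and>
     (\<forall>n. \<chi> n \<noteq> 0 \<longleftrightarrow> coprime n N)"

definition principal_character :: "nat \<Rightarrow> nat \<Rightarrow> complex" where
  "principal_character N n = (if coprime n N then 1 else 0)"

definition quadratic_character :: "nat \<Rightarrow> (nat \<Rightarrow> complex) \<Rightarrow> bool" where
  "quadratic_character N \<chi> \<longleftrightarrow>
     dirichlet_character N \<chi> \<and> range \<chi> \<subseteq> \<real> \<and> \<chi> \<noteq> principal_character N"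

text \<open>The parameter \<open>w\<close> is the exponent of \<open>d\<close>, i.e. \<open>k - 1\<close> in terms of the weight \<open>k\<close>.\<close>

definition sigma_chi :: "(nat \<Rightarrow> complex) \<Rightarrow> (nat \<Rightarrow> complex) \<Rightarrow> nat \<Rightarrow> nat \<Rightarrow> complex" where
  "sigma_chi \<chi>1 \<chi>2 w n = (\<Sum>d | d dvd n. \<chi>1 (n div d) * \<chi>2 d * of_nat d ^ w)"

text \<open>
  The order on \<^typ>\<open>complex\<close> is that of \<^theory>\<open>HOL-Library.Complex_Order\<close>: \<open>z < 0\<close> means that
  \<open>z\<close> is real and negative. For quadratic characters all values of \<^const>\<open>sigma_chi\<close> are real.
\<close>

definition is_negative_at ::
  "nat \<Rightarrow> nat \<Rightarrow> nat \<Rightarrow> (nat \<Rightarrow> complex) \<Rightarrow> (nat \<Rightarrow> complex) \<Rightarrow> nat \<Rightarrow> bool" where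
  "is_negative_at N1 N2 k \<chi>1 \<chi>2 n \<longleftrightarrow>
     n > 0 \<and> coprime n (N1 * N2) \<and> sigma_chi \<chi>1 \<chi>2 (k - 1) n < 0"

text \<open>
  As \<^const>\<open>sigma_chi\<close> takes the value \<open>1\<close> at \<open>1\<close>, the first sign change is the first negative value.
  The term is meaningful only if some \<open>n\<close> satisfies \<^const>\<open>is_negative_at\<close>.
\<close>

definition first_sign_change ::
  "nat \<Rightarrow> nat \<Rightarrow> nat \<Rightarrow> (nat \<Rightarrow> complex) \<Rightarrow> (nat \<Rightarrow> complex) \<Rightarrow> nat" where
  "first_sign_change N1 N2 k \<chi>1 \<chi>2 = (LEAST n. is_negative_at N1 N2 k \<chi>1 \<chi>2 n)"

lemma dirichlet_character_1:
  assumes "dirichlet_character N \<chi>"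
  shows "\<chi> 1 = 1"
proof -
  have "\<chi> (1 * 1) = \<chi> 1 * \<chi> 1"
    using assms unfolding dirichlet_character_def by blast
  moreover have "\<chi> 1 \<noteq> 0"
    using assms unfolding dirichlet_character_def by simp
  ultimately show ?thesis by simp
qed

lemma sigma_chi_1:
  assumes "dirichlet_character N1 \<chi>1" "dirichlet_character N2 \<chi>2"
  shows "sigma_chi \<chi>1 \<chi>2 w 1 = 1"
  using assms[THEN dirichlet_character_1] by (simp add: sigma_chi_def)

lemma sigma_chi_real:
  assumes "quadratic_character N1 \<chi>1" "quadratic_character N2 \<chi>2"
  shows "sigma_chi \<chi>1 \<chi>2 w n \<in> \<real>"
proof -
  have "\<chi>1 m \<in> \<real>" "\<chi>2 m \<in> \<real>" for m
    using assms unfolding quadratic_character_def by blast+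
  then show ?thesis
    unfolding sigma_chi_def by (intro sum_in_Reals Reals_mult Reals_power Reals_of_nat)
qed

end

theory Submission
  imports Defs "HOL-Number_Theory.Number_Theory" "HOL-Computational_Algebra.Computational_Algebra"
    "HOL-Analysis.Convex"
begin

text \<open>
  At a prime \<open>p\<close> not dividing \<open>N\<close> the divisor sum is \<open>\<chi>1 p + \<chi>2 p * p ^ (k - 1)\<close>, so it is negative as
  soon as \<open>\<chi>2 p = -1\<close>, and it suffices to find a small prime of this kind. This is Vinogradov's
  argument fed with Burgess' bound. Let \<open>f\<close> be completely multiplicative with \<open>f p = \<chi>2 p\<close> for \<open>p\<close>
  prime to \<open>N\<close> and \<open>f p = 1\<close> for \<open>p\<close> dividing \<open>N\<close>. If \<open>f\<close> is \<open>1\<close> at all primes up to \<open>y\<close>, then by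
  Mertens' theorem the mean value of \<open>f\<close> up to \<open>x = y powr u\<close> is at least \<open>1 - 2 * ln u - o(1)\<close>, which
  is positive for \<open>u < sqrt (exp 1)\<close>, whereas Burgess' bound makes it tend to \<open>0\<close> for \<open>x\<close> slightly
  larger than \<open>N powr (1/4)\<close>.

  Burgess' bound comes from shifting by products \<open>a * b\<close> with \<open>a\<close> prime, from Hoelder's inequality, and
  from the high moments of short character sums. The moments reduce to complete sums of Legendre
  symbols of split polynomials; square-root cancellation in these is proved by Stepanov's method.
\<close>

section \<open>Stepanov's method\<close>

text \<open>The conclusion concerns integers prime to \<open>N1 * N2\<close>, so
  \<open>\<chi>2\<close> is viewed modulo \<open>M = 8 * (N1 * N2)\<close>, where it is in general
  imprimitive. Complete sums reduce to prime moduli only if the modulus is essentially squarefree. A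
  real character depends only on residues modulo 8 times the odd radical of its modulus, so at
  arguments prime to \<open>M\<close> it can be replaced by a product of Legendre symbols and a
  symbol modulo 8. At other arguments the two need not agree. Vinogradov's lower bound needs the
  value 1 at every small prime, also at those dividing \<open>M\<close>. Resetting the value at
  \<open>p\<close> involves partial sums of length \<open>z div p\<close>, and iterating over many
  primes reaches every length. Hence Burgess' bound is put in the form \<open>C * q powr ((1/4 +
  \<delta>) * \<theta>) * z powr (1 - \<theta>)\<close>, valid for all \<open>z\<close>. Each reset
  prime costs a constant factor, and all of them together cost an arbitrarily small power of
  \<open>M\<close>. Everything asymptotic holds for large \<open>M\<close> only. For bounded
  \<open>M\<close>, a prime factor of an integer \<open>n0 \<le> M\<close> with value -1 serves, and
  the constant absorbs its size.\<close>

lemma const_dvd_poly_value: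
  fixes p :: int
  assumes "[:p:] dvd R"
  shows "p dvd poly R x"
  using assms by (auto elim!: dvdE)

text \<open>Synthetic division leaves the constant remainder \<open>poly R s\<close>, which vanishes
  modulo \<open>p\<close>. The exact degree of the quotient drives the root count and the descent
  below.\<close>

lemma root_factor_mod:
  fixes R :: "int poly"
  assumes "p dvd poly R s"
  obtains Q where "[:p:] dvd R - [:-s, 1:] * Q" "degree Q = degree R - 1"
proof
  have "R - [:-s, 1:] * synthetic_div R s = [:poly R s:]"
    using synthetic_div_correct'[of s R] by (metis add_diff_cancel_left')
  then show "[:p:] dvd R - [:-s, 1:] * synthetic_div R s"
    using assms by (simp add: const_poly_dvd_iff coeff_pCons split: nat.split)
  show "degree (synthetic_div R s) = degree R - 1"
    by (rule degree_synthetic_div)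
qed

lemma const_dvd_higher_pderiv:
  fixes p :: int
  assumes "[:p:] dvd R"
  shows "[:p:] dvd (pderiv ^^ k) R"
proof -
  obtain X where "R = smult p X" using assms by (auto elim: dvdE)
  then have "(pderiv ^^ k) R = smult p ((pderiv ^^ k) X)"
    by (induction k arbitrary: R) (auto simp: pderiv_smult)
  then show ?thesis by (auto simp: const_poly_dvd_iff)
qed

lemma higher_pderiv_diff_int:
  "(pderiv ^^ k) (A - B :: int poly) = (pderiv ^^ k) A - (pderiv ^^ k) B"
  by (induction k) (auto simp: pderiv_diff)

lemma higher_pderiv_linear_mult:
  fixes Q :: "int poly"
  shows "(pderiv ^^ Suc k) ([:-s, 1:] * Q)
    = [:-s, 1:] * (pderiv ^^ Suc k) Q + smult (int (Suc k)) ((pderiv ^^ k) Q)"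
proof (induction k)
  case 0
  show ?case by (simp add: pderiv_mult pderiv_pCons pderiv_diff pderiv_smult pderiv_add algebra_simps)
next
  case (Suc k)
  define E where "E = (pderiv ^^ k) Q"
  have lin: "pderiv ([:-s, 1:] * Y) = [:-s, 1:] * pderiv Y + Y" for Y :: "int poly"
    by (simp add: pderiv_mult pderiv_pCons pderiv_diff pderiv_smult pderiv_add algebra_simps)
  have "(pderiv ^^ Suc (Suc k)) ([:-s, 1:] * Q) = pderiv ((pderiv ^^ Suc k) ([:-s, 1:] * Q))"
    by simp
  also have "\<dots> = pderiv ([:-s, 1:] * pderiv E + smult (int (Suc k)) E)"
    unfolding Suc.IH by (simp add: E_def)
  also have "\<dots> = [:-s, 1:] * pderiv (pderiv E) + (pderiv E + smult (int (Suc k)) (pderiv E))"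
    unfolding pderiv_add lin pderiv_smult by (rule add.assoc)
  also have "pderiv E + smult (int (Suc k)) (pderiv E) = smult (int (Suc (Suc k))) (pderiv E)"
    using smult_add_left[of 1 "int (Suc k)" "pderiv E"] by simp
  finally show ?case by (simp add: E_def)
qed

text \<open>Induction on the total multiplicity, dividing out one factor \<open>X - s\<close> modulo
  \<open>p\<close> at a time. At \<open>s\<close> the derivative of order \<open>k + 1\<close> of
  \<open>[:-s, 1:] * Q\<close> is \<open>k + 1\<close> times the derivative of order
  \<open>k\<close> of \<open>Q\<close>, and \<open>k + 1 < l s \<le> p\<close> is invertible; this
  is why multiplicities are capped at \<open>p\<close>. At another point \<open>t\<close> the factor
  \<open>t - s\<close> is a unit, so no vanishing is lost.\<close>

lemma sum_multiplicities_le_degree: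
  fixes p :: int and R :: "int poly"
  assumes p: "prime p" and fin: "finite S"
    and inc: "\<And>s t. s \<in> S \<Longrightarrow> t \<in> S \<Longrightarrow> p dvd s - t \<Longrightarrow> s = t"
    and "\<not> [:p:] dvd R"
    and "\<And>s. s \<in> S \<Longrightarrow> int (l s) \<le> p"
    and "\<And>s k. s \<in> S \<Longrightarrow> k < l s \<Longrightarrow> p dvd poly ((pderiv ^^ k) R) s"
  shows "sum l S \<le> degree R"
  using assms(4-)
proof (induction "sum l S" arbitrary: l R)
  case (Suc n)
  obtain s where s: "s \<in> S" "l s > 0"
    using Suc.hyps(2) by (metis not_gr_zero sum.neutral nat.distinct(1))
  have root: "p dvd poly R s" using Suc.prems(3)[OF s] by simp
  have deg: "degree R > 0"
  proof (rule ccontr)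
    assume "\<not> degree R > 0"
    then obtain c where "R = [:c:]" by (auto elim: degree_eq_zeroE)
    then show False using root Suc.prems(1) by simp
  qed
  obtain Q where Q: "[:p:] dvd R - [:-s, 1:] * Q" "degree Q = degree R - 1"
    using root_factor_mod[OF root] .
  have nQ: "\<not> [:p:] dvd Q"
  proof
    assume "[:p:] dvd Q"
    then have "[:p:] dvd (R - [:-s, 1:] * Q) + [:-s, 1:] * Q" using Q(1) by (intro dvd_add dvd_mult)
    then show False using Suc.prems(1) by simp
  qed
  have D: "p dvd poly ((pderiv ^^ k) R) t - poly ((pderiv ^^ k) ([:-s, 1:] * Q)) t" for k t
  proof -
    have "p dvd poly ((pderiv ^^ k) (R - [:-s, 1:] * Q)) t"
      by (intro const_dvd_poly_value const_dvd_higher_pderiv Q)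
    then show ?thesis by (simp only: higher_pderiv_diff_int poly_diff)
  qed
  define l' where "l' = l(s := l s - 1)"
  have sum: "sum l S = Suc (sum l' S)"
    using s fin by (simp add: l'_def sum.remove[of S s])
  have "sum l' S \<le> degree Q"
  proof (rule Suc.hyps(1)[OF _ nQ])
    show "n = sum l' S" using sum Suc.hyps(2) by simp
    show "int (l' t) \<le> p" if "t \<in> S" for t
      using Suc.prems(2)[OF that] by (auto simp: l'_def)
    show "p dvd poly ((pderiv ^^ k) Q) t" if t: "t \<in> S" "k < l' t" for t k
    proof (cases "t = s")
      case True
      have k: "Suc k < l s" using t True by (simp add: l'_def)
      have "p dvd poly ((pderiv ^^ Suc k) ([:-s, 1:] * Q)) s"
        using D[of "Suc k" s] Suc.prems(3)[OF s(1) k] dvd_diff_right_iff by blast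
      then have "p dvd int (Suc k) * poly ((pderiv ^^ k) Q) s"
        unfolding higher_pderiv_linear_mult by simp
      moreover have "\<not> p dvd int (Suc k)"
        using k Suc.prems(2)[OF s(1)] zdvd_not_zless[of "int (Suc k)" p] by linarith
      ultimately show ?thesis using p True by (simp add: prime_dvd_mult_iff)
    next
      case False
      have nd: "\<not> p dvd t - s" using inc[OF t(1) s(1)] False by blast
      have Rt: "p dvd poly ((pderiv ^^ j) R) t" if "j < l t" for j
        using Suc.prems(3)[OF t(1) that] .
      have "k < l t \<Longrightarrow> p dvd poly ((pderiv ^^ k) Q) t"
      proof (induction k)
        case 0
        have "p dvd poly ([:-s, 1:] * Q) t"
          using D[of 0 t] Rt[OF 0] dvd_diff_right_iff unfolding funpow_0 by blast
        then have "p dvd (t - s) * poly Q t" by (simp add: algebra_simps)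
        then show ?case using nd p by (simp add: prime_dvd_mult_iff)
      next
        case (Suc k)
        have "p dvd poly ((pderiv ^^ Suc k) ([:-s, 1:] * Q)) t"
          using D[of "Suc k" t] Rt[OF Suc.prems] dvd_diff_right_iff by blast
        then have "p dvd (t - s) * poly ((pderiv ^^ Suc k) Q) t + int (Suc k) * poly ((pderiv ^^ k) Q) t"
          unfolding higher_pderiv_linear_mult by (simp add: algebra_simps)
        moreover have "p dvd int (Suc k) * poly ((pderiv ^^ k) Q) t" using Suc by simp
        ultimately have "p dvd (t - s) * poly ((pderiv ^^ Suc k) Q) t" using dvd_add_left_iff by blast
        then show ?case using nd p by (simp add: prime_dvd_mult_iff)
      qed
      then show ?thesis using t False by (simp add: l'_def)
    qed
  qed
  then show ?case using sum Q(2) deg by simp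
qed simp

text \<open>Counting residues of coefficient vectors replaces linear algebra over the field of \<open>p\<close>
  elements, so that all polynomials can stay over the integers.\<close>

lemma mod_linear_system:
  fixes \<Phi> :: "('i \<Rightarrow> int) \<Rightarrow> 'k \<Rightarrow> int" and p :: nat
  assumes p: "p > 1" and fin: "finite I" "finite K" and card: "card K < card I"
    and lin: "\<And>v w k. \<Phi> (\<lambda>i. v i - w i) k = \<Phi> v k - \<Phi> w k"
  obtains w where "\<exists>i\<in>I. \<not> int p dvd w i" "\<And>k. k \<in> K \<Longrightarrow> int p dvd \<Phi> w k"
proof -
  define D where "D = I \<rightarrow>\<^sub>E {0..<int p}"
  define E where "E = K \<rightarrow>\<^sub>E {0..<int p}"
  define F where "F = (\<lambda>w. \<lambda>k\<in>K. \<Phi> w k mod int p)"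
  have "card E < card D"
    using p card fin by (simp add: D_def E_def card_PiE power_strict_increasing)
  moreover have "F ` D \<subseteq> E" using p by (auto simp: F_def E_def)
  moreover have "finite E" using fin by (auto simp: E_def intro!: finite_PiE)
  ultimately have "\<not> inj_on F D" using card_inj_on_le by (metis leD)
  then obtain v w where vw: "v \<in> D" "w \<in> D" "v \<noteq> w" "F v = F w" by (auto simp: inj_on_def)
  show ?thesis
  proof (rule that[of "\<lambda>i. v i - w i"])
    obtain i where i: "i \<in> I" "v i \<noteq> w i"
      using vw(1-3) by (metis D_def PiE_ext)
    then have "v i \<in> {0..<int p}" "w i \<in> {0..<int p}" using vw by (auto simp: D_def)
    then have "\<bar>v i - w i\<bar> < int p" by auto
    then have "\<not> int p dvd v i - w i" using i zdvd_imp_le[of "int p" "\<bar>v i - w i\<bar>"] by auto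
    then show "\<exists>i\<in>I. \<not> int p dvd v i - w i" using i by blast
    show "int p dvd \<Phi> (\<lambda>i. v i - w i) k" if "k \<in> K" for k
      using fun_cong[OF vw(4), of k] that by (simp add: F_def lin mod_eq_dvd_iff)
  qed
qed

section \<open>Nonvanishing of the auxiliary polynomial\<close>

lemma const_mult_smult: "[:c:] * q = smult c (q :: 'a :: comm_semiring_1 poly)"
  by simp

text \<open>At the simple root \<alpha> of \<open>[:-\<alpha>, 1:] * h\<close> a nonzero term with
  \<open>r\<^sup>2\<close> vanishes to odd order and a nonzero term with \<open>s\<^sup>2\<close> to
  even order, so they can agree only if both are zero modulo \<open>p\<close>. The proof is a
  descent that divides \<open>r\<close> and \<open>s\<close> by \<open>X - \<alpha>\<close> and
  lowers the degree of \<open>r\<close>.\<close>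

lemma no_square_ratio_mod:
  fixes p :: int and h r s :: "int poly"
  assumes p: "prime p" and h: "\<not> p dvd poly h \<alpha>" and c: "\<not> p dvd c"
    and "[:p:] dvd [:-\<alpha>, 1:] * h * r\<^sup>2 - smult c (s\<^sup>2)"
  shows "[:p:] dvd r \<and> [:p:] dvd s"
  using assms(4)
proof (induction "degree r" arbitrary: r s rule: less_induct)
  case less
  \<comment> \<open>\<open>L\<close> stands for \<open>X - \<alpha>\<close> and \<open>C\<close> for
    the constant \<open>c\<close>. The first identity trades \<open>s\<close> for
    \<open>L * s1\<close>, the second \<open>r\<close> for \<open>L * r1\<close>; each exposes a
    factor \<open>L\<close> to cancel, and together they return to the original shape.\<close>
  have ring1: "L * h * r\<^sup>2 - C * s\<^sup>2 + C * ((s - L * s1) * (s + L * s1))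
      = L * (h * r\<^sup>2 - C * L * s1\<^sup>2)"
    and ring2: "h * r\<^sup>2 - C * L * s1\<^sup>2 - h * ((r - L * r1) * (r + L * r1))
      = L * (L * h * r1\<^sup>2 - C * s1\<^sup>2)"
    for L h r C s r1 s1 :: "int poly"
    by (simp_all add: power2_eq_square algebra_simps)
  have pp: "prime_elem [:p:]" using p by (intro lift_prime_elem_poly) auto
  have nlin: "\<not> [:p:] dvd [:-\<alpha>, 1:]"
  proof
    assume "[:p:] dvd [:-\<alpha>, 1:]"
    then have "p dvd coeff [:-\<alpha>, 1:] 1" unfolding const_poly_dvd_iff by blast
    then show False using p by (simp add: not_prime_unit)
  qed
  have "p dvd poly ([:-\<alpha>, 1:] * h * r\<^sup>2 - smult c (s\<^sup>2)) \<alpha>"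
    by (rule const_dvd_poly_value[OF less.prems])
  then have "p dvd poly s \<alpha>"
    using c p by (auto simp: prime_dvd_mult_iff prime_dvd_power_iff)
  then obtain s1 where s1: "[:p:] dvd s - [:-\<alpha>, 1:] * s1" by (rule root_factor_mod)
  have "[:p:] dvd ([:-\<alpha>, 1:] * h * r\<^sup>2 - smult c (s\<^sup>2)) + [:c:] * ((s - [:-\<alpha>, 1:] * s1) * (s + [:-\<alpha>, 1:] * s1))"
    by (intro dvd_add less.prems dvd_mult dvd_mult2 s1)
  also have "\<dots> = [:-\<alpha>, 1:] * (h * r\<^sup>2 - [:c:] * [:-\<alpha>, 1:] * s1\<^sup>2)"
  proof -
    have "smult c (s\<^sup>2) = [:c:] * s\<^sup>2" by simp
    then show ?thesis using ring1[of "[:-\<alpha>, 1:]" h r "[:c:]" s s1] by argo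
  qed
  finally have hr: "[:p:] dvd h * r\<^sup>2 - [:c:] * [:-\<alpha>, 1:] * s1\<^sup>2"
    using pp nlin prime_elem_dvd_mult_iff by blast
  then have "p dvd poly (h * r\<^sup>2 - [:c:] * [:-\<alpha>, 1:] * s1\<^sup>2) \<alpha>"
    by (rule const_dvd_poly_value)
  then have rootr: "p dvd poly r \<alpha>"
    using h p by (auto simp: prime_dvd_mult_iff prime_dvd_power_iff)
  have conc: "[:p:] dvd r \<and> [:p:] dvd s" if "[:p:] dvd r" "[:p:] dvd s1"
  proof -
    have "[:p:] dvd (s - [:-\<alpha>, 1:] * s1) + [:-\<alpha>, 1:] * s1"
      using s1 that by (intro dvd_add dvd_mult)
    then show ?thesis using that by simp
  qed
  show ?case
  proof (cases "degree r = 0")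
    case True
    then obtain d where "r = [:d:]" by (auto elim: degree_eq_zeroE)
    then have r: "[:p:] dvd r" using rootr by simp
    then have "[:p:] dvd h * r\<^sup>2" by (simp add: power2_eq_square)
    then have "[:p:] dvd [:c:] * [:-\<alpha>, 1:] * s1\<^sup>2" using hr dvd_diff_right_iff by blast
    moreover have "\<not> [:p:] dvd [:c:]" using c by simp
    ultimately have "[:p:] dvd s1"
      using pp nlin by (metis prime_elem_dvd_mult_iff prime_elem_dvd_power)
    then show ?thesis using r conc by blast
  next
    case False
    obtain r1 where r1: "[:p:] dvd r - [:-\<alpha>, 1:] * r1" "degree r1 = degree r - 1"
      using root_factor_mod[OF rootr] .
    have "[:p:] dvd (h * r\<^sup>2 - [:c:] * [:-\<alpha>, 1:] * s1\<^sup>2)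
        - h * ((r - [:-\<alpha>, 1:] * r1) * (r + [:-\<alpha>, 1:] * r1))"
      by (intro dvd_diff hr dvd_mult dvd_mult2 r1)
    also have "\<dots> = [:-\<alpha>, 1:] * ([:-\<alpha>, 1:] * h * r1\<^sup>2 - [:c:] * s1\<^sup>2)"
      by (rule ring2)
    finally have "[:p:] dvd [:-\<alpha>, 1:] * h * r1\<^sup>2 - [:c:] * s1\<^sup>2"
      using pp nlin prime_elem_dvd_mult_iff by blast
    then have "[:p:] dvd [:-\<alpha>, 1:] * h * r1\<^sup>2 - smult c (s1\<^sup>2)"
      by (simp only: const_mult_smult)
    then have "[:p:] dvd r1 \<and> [:p:] dvd s1"
      using False r1(2) by (intro less.hyps) auto
    moreover from this have "[:p:] dvd (r - [:-\<alpha>, 1:] * r1) + [:-\<alpha>, 1:] * r1"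
      using r1 by (intro dvd_add dvd_mult) auto
    ultimately show ?thesis using conc by simp
  qed
qed

text \<open>The derivative of \<open>f ^ p\<close> is divisible by \<open>p\<close>, and the factor
  \<open>i\<close> that differentiation puts before the coefficient is invertible for
  \<open>0 < i < p\<close>. This is the part of \<open>f ^ p = f (X ^ p)\<close> modulo
  \<open>p\<close> that is visible modulo \<open>X ^ p\<close>.\<close>

lemma prime_dvd_coeff_power:
  fixes f :: "int poly" and p :: nat
  assumes p: "prime p" and i: "0 < i" "i < p"
  shows "int p dvd coeff (f ^ p) i"
proof -
  obtain i' where i': "i = Suc i'" using i by (cases i) auto
  have "pderiv (f ^ p) = smult (int p) (f ^ (p - 1) * pderiv f)"
    by (simp add: pderiv_power)
  then have "int p dvd coeff (pderiv (f ^ p)) i'" by simp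
  then have "int p dvd int i * coeff (f ^ p) i" by (simp add: coeff_pderiv i')
  moreover have "\<not> int p dvd int i"
    using i nat_dvd_not_less int_dvd_int_iff by blast
  moreover have "prime (int p)" using p by simp
  ultimately show ?thesis using prime_dvd_multD by blast
qed

lemma coeff_power_0: "coeff (f ^ n) 0 = (coeff f 0 :: 'a :: comm_semiring_1) ^ n"
  by (simp flip: poly_0_coeff_0)

text \<open>The blocks \<open>monom 1 (j * p) * u j\<close> overlap, because
  \<open>f ^ ((p - 1) div 2)\<close> has large degree. Only the least block that is nonzero modulo
  \<open>p\<close> is examined, and only its lowest \<open>p\<close> coefficients, which later
  blocks cannot reach. There \<open>r + g * s\<close> vanishes, with \<open>g\<close> the power of
  \<open>f\<close>. Multiplying by \<open>f * (r - g * s)\<close> and using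
  \<open>f * g * g = f ^ p\<close> gives \<open>f * r\<^sup>2 = c * s\<^sup>2\<close> modulo
  \<open>X ^ p\<close>; the degree hypothesis keeps both sides below degree \<open>p\<close>, so
  this is a full identity, excluded by the simple root of \<open>f\<close>.\<close>

lemma stepanov_nonzero:
  fixes p m d :: nat and f h :: "int poly" and r s :: "nat \<Rightarrow> int poly"
  assumes p: "prime p" "odd p" and f: "f = [:-\<alpha>, 1:] * h" and h: "\<not> int p dvd poly h \<alpha>"
    and f0: "\<not> int p dvd coeff f 0" and deg: "degree f + 2 * d < p + 2" "d > 0"
    and rs: "\<And>j. degree (r j) < d" "\<And>j. degree (s j) < d"
    and ex: "\<exists>j<J. \<not> [:int p:] dvd r j \<or> \<not> [:int p:] dvd s j"
  shows "\<not> [:int p:] dvd (\<Sum>j<J. monom 1 (j * p) * (r j + f ^ ((p - 1) div 2) * s j))"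
proof
  define g where "g = f ^ ((p - 1) div 2)"
  define u where "u = (\<lambda>j. r j + g * s j)"
  assume "[:int p:] dvd (\<Sum>j<J. monom 1 (j * p) * (r j + f ^ ((p - 1) div 2) * s j))"
  then have Z: "[:int p:] dvd (\<Sum>j<J. monom 1 (j * p) * u j)" by (simp add: u_def g_def)
  have pp: "prime (int p)" using p by simp
  define j0 where "j0 = (LEAST j. j < J \<and> (\<not> [:int p:] dvd r j \<or> \<not> [:int p:] dvd s j))"
  have j0: "j0 < J" "\<not> [:int p:] dvd r j0 \<or> \<not> [:int p:] dvd s j0"
    using LeastI_ex[OF ex[unfolded Bex_def]] by (auto simp: j0_def)
  have small: "[:int p:] dvd u j" if "j < j0" for j
  proof -
    have "\<not> (j < J \<and> (\<not> [:int p:] dvd r j \<or> \<not> [:int p:] dvd s j))"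
      using not_less_Least that unfolding j0_def by blast
    then have "[:int p:] dvd r j" "[:int p:] dvd s j" using that j0 by auto
    then show ?thesis by (simp add: u_def)
  qed
  have cu: "int p dvd coeff (u j0) i" if i: "i < p" for i
  proof -
    have "int p dvd coeff (\<Sum>j<J. monom 1 (j * p) * u j) (j0 * p + i)"
      using Z by (simp add: const_poly_dvd_iff)
    also have "coeff (\<Sum>j<J. monom 1 (j * p) * u j) (j0 * p + i)
      = (\<Sum>j<J. coeff (monom 1 (j * p) * u j) (j0 * p + i))"
      by (simp add: coeff_sum)
    also have "\<dots> = coeff (monom 1 (j0 * p) * u j0) (j0 * p + i)
        + (\<Sum>j\<in>{..<J}-{j0}. coeff (monom 1 (j * p) * u j) (j0 * p + i))"
      using j0 by (subst sum.remove[of _ j0]) auto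
    also have "coeff (monom 1 (j0 * p) * u j0) (j0 * p + i) = coeff (u j0) i"
      by (simp add: coeff_monom_mult)
    finally have "int p dvd coeff (u j0) i + (\<Sum>j\<in>{..<J}-{j0}. coeff (monom 1 (j * p) * u j) (j0 * p + i))" .
    moreover have "int p dvd (\<Sum>j\<in>{..<J}-{j0}. coeff (monom 1 (j * p) * u j) (j0 * p + i))"
    proof (rule dvd_sum)
      fix j assume "j \<in> {..<J}-{j0}"
      show "int p dvd coeff (monom 1 (j * p) * u j) (j0 * p + i)"
      proof (cases "j < j0")
        case True
        then show ?thesis using small[OF True] by (simp add: coeff_monom_mult const_poly_dvd_iff)
      next
        case False
        then have "Suc j0 \<le> j" using \<open>j \<in> _\<close> by auto
        then have "Suc j0 * p \<le> j * p" by (rule mult_le_mono1)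
        then have "\<not> j * p \<le> j0 * p + i" using i by simp
        then show ?thesis by (simp add: coeff_monom_mult)
      qed
    qed
    ultimately show ?thesis using dvd_add_left_iff by blast
  qed
  \<comment> \<open>The constant term of \<open>f ^ p\<close>, which is all that survives of
    \<open>f ^ p\<close> modulo \<open>p\<close> and \<open>X ^ p\<close>. It is a unit because
    \<open>f\<close> has no root at 0 modulo \<open>p\<close>.\<close>
  define c where "c = coeff f 0 ^ p"
  define R S where "R = r j0" and "S = s j0"
  have fp: "f * g * g = f ^ p"
  proof -
    have "p = Suc ((p - 1) div 2 + (p - 1) div 2)" using p by (auto elim!: oddE)
    then have "f ^ p = f * (f ^ ((p - 1) div 2) * f ^ ((p - 1) div 2))"
      by (metis power_Suc power_add)
    then show ?thesis by (simp add: g_def mult.assoc)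
  qed
  have eq: "f * (R - g * S) * u j0 = f * R\<^sup>2 - f ^ p * S\<^sup>2"
    unfolding fp[symmetric] u_def R_def[symmetric] S_def[symmetric]
    by (simp add: power2_eq_square algebra_simps)
  have c1: "int p dvd coeff (f * R\<^sup>2 - f ^ p * S\<^sup>2) i" if i: "i < p" for i
    unfolding eq[symmetric] coeff_mult[of "f * (R - g * S)"]
    using i by (intro dvd_sum dvd_mult cu) auto
  have c2: "int p dvd coeff (f ^ p * S\<^sup>2) i - coeff (smult c (S\<^sup>2)) i" if i: "i < p" for i
  proof -
    have "coeff (f ^ p * S\<^sup>2) i = coeff (f ^ p) 0 * coeff (S\<^sup>2) i
        + (\<Sum>k\<in>{..i}-{0}. coeff (f ^ p) k * coeff (S\<^sup>2) (i - k))"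
      unfolding coeff_mult by (subst sum.remove[of _ 0]) auto
    moreover have "int p dvd (\<Sum>k\<in>{..i}-{0}. coeff (f ^ p) k * coeff (S\<^sup>2) (i - k))"
      using i p by (intro dvd_sum dvd_mult2 prime_dvd_coeff_power) auto
    ultimately show ?thesis by (simp add: c_def coeff_power_0)
  qed
  have "[:int p:] dvd f * R\<^sup>2 - smult c (S\<^sup>2)"
    unfolding const_poly_dvd_iff
  proof
    fix i
    show "int p dvd coeff (f * R\<^sup>2 - smult c (S\<^sup>2)) i"
    proof (cases "i < p")
      case True
      have "int p dvd coeff (f * R\<^sup>2 - f ^ p * S\<^sup>2) i
          + (coeff (f ^ p * S\<^sup>2) i - coeff (smult c (S\<^sup>2)) i)"
        by (intro dvd_add c1 c2 True)
      then show ?thesis by simp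
    next
      case False
      have dR: "degree R < d" "degree S < d" using rs by (auto simp: R_def S_def)
      have "degree (f * R\<^sup>2) \<le> degree f + 2 * degree R"
        using degree_mult_le[of f "R\<^sup>2"] degree_power_le[of R 2] by linarith
      then have "degree (f * R\<^sup>2) < i" using dR False deg by linarith
      moreover have "degree (smult c (S\<^sup>2)) \<le> 2 * degree S"
        using degree_smult_le[of c "S\<^sup>2"] degree_power_le[of S 2] by linarith
      then have "degree (smult c (S\<^sup>2)) < i" using dR False deg by linarith
      ultimately have "coeff (f * R\<^sup>2) i = 0" "coeff (smult c (S\<^sup>2)) i = 0"
        by (blast intro: coeff_eq_0)+
      then show ?thesis unfolding coeff_diff by (simp only: diff_self dvd_0_right)
    qed
  qed
  then have "[:int p:] dvd [:-\<alpha>, 1:] * h * R\<^sup>2 - smult c (S\<^sup>2)" by (simp only: f)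
  moreover have "\<not> int p dvd c" using f0 pp prime_dvd_power unfolding c_def by blast
  ultimately have "[:int p:] dvd R \<and> [:int p:] dvd S"
    using no_square_ratio_mod[OF pp h] by blast
  then show False using j0 by (simp add: R_def S_def)
qed

section \<open>Counting points with the auxiliary polynomial\<close>

lemma eq_if_dvd_diff:
  fixes s t n :: int
  assumes "s \<in> {0..<n}" "t \<in> {0..<n}" "n dvd s - t"
  shows "s = t"
  using assms by (metis atLeastLessThan_iff mod_eq_dvd_iff mod_pos_pos_trivial)

text \<open>The cofactor left when \<open>f ^ (c - k)\<close> is taken out of the derivative of
  order \<open>k\<close> of \<open>f ^ c * u\<close>. Its degree grows with \<open>k\<close> but not
  with \<open>c\<close>, so the huge exponent \<open>l + (p - 1) div 2\<close> does not increase the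
  number of linear conditions.\<close>

primrec leibniz_op :: "int poly \<Rightarrow> nat \<Rightarrow> nat \<Rightarrow> int poly \<Rightarrow> int poly" where
  "leibniz_op f c 0 u = u"
| "leibniz_op f c (Suc k) u
    = smult (int (c - k)) (pderiv f * leibniz_op f c k u) + f * pderiv (leibniz_op f c k u)"

lemma higher_pderiv_power_mult:
  "k \<le> c \<Longrightarrow> (pderiv ^^ k) (f ^ c * u) = f ^ (c - k) * leibniz_op f c k u"
proof (induction k)
  case (Suc k)
  define e W where "e = c - Suc k" and "W = leibniz_op f c k u"
  have e: "c - k = Suc e" using Suc.prems by (simp add: e_def)
  have "(pderiv ^^ Suc k) (f ^ c * u) = pderiv (f ^ Suc e * W)"
    using Suc by (simp add: e W_def)
  also have "\<dots> = smult (int (Suc e)) (f ^ e) * pderiv f * W + f ^ Suc e * pderiv W"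
    unfolding pderiv_mult pderiv_power_Suc of_nat_Suc by (simp add: algebra_simps)
  also have "\<dots> = f ^ e * (smult (int (Suc e)) (pderiv f * W) + f * pderiv W)"
    by (simp add: algebra_simps)
  finally show ?case by (simp add: e W_def flip: e_def)
qed simp

lemma degree_leibniz_op: "degree (leibniz_op f c k u) \<le> degree u + k * degree f"
proof (induction k)
  case (Suc k)
  define W where "W = leibniz_op f c k u"
  have "degree (smult (int (c - k)) (pderiv f * W)) \<le> degree f + degree W"
    using degree_smult_le[of "int (c - k)" "pderiv f * W"] degree_mult_le[of "pderiv f" W]
      degree_pderiv[of f] by linarith
  moreover have "degree (f * pderiv W) \<le> degree f + degree W"
    using degree_mult_le[of f "pderiv W"] degree_pderiv[of W] by linarith
  ultimately have "degree (leibniz_op f c (Suc k) u) \<le> degree f + degree W"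
    by (simp add: degree_add_le W_def)
  then show ?case using Suc by (simp add: W_def)
qed simp

lemma leibniz_op_diff: "leibniz_op f c k (u - v) = leibniz_op f c k u - leibniz_op f c k v"
proof (induction k)
  case (Suc k)
  show ?case unfolding leibniz_op.simps Suc pderiv_diff right_diff_distrib smult_diff_right by simp
qed simp

text \<open>Modulo \<open>p\<close> the derivative of \<open>X ^ (j * p)\<close> is zero, so this
  factor behaves like a constant under differentiation.\<close>

lemma higher_pderiv_monom_mult_mod:
  fixes p :: nat and Y :: "int poly"
  shows "[:int p:] dvd (pderiv ^^ k) (monom 1 (j * p) * Y) - monom 1 (j * p) * (pderiv ^^ k) Y"
proof (induction k)
  case (Suc k)
  define M A where "M = (monom 1 (j * p) :: int poly)" and "A = (pderiv ^^ k) Y"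
  have "(pderiv ^^ Suc k) (M * Y) - M * (pderiv ^^ Suc k) Y
    = pderiv ((pderiv ^^ k) (M * Y) - M * A) + A * pderiv M"
    by (simp add: pderiv_diff pderiv_mult A_def)
  moreover have "[:int p:] dvd pderiv ((pderiv ^^ k) (M * Y) - M * A)"
    using const_dvd_higher_pderiv[OF Suc, of 1] by (simp add: M_def A_def)
  moreover have "[:int p:] dvd pderiv M"
    by (simp add: M_def pderiv_monom const_poly_dvd_iff)
  ultimately show ?case by (simp add: M_def)
qed simp

lemma higher_pderiv_sum_int: "(pderiv ^^ k) (\<Sum>j\<in>A. F j :: int poly) = (\<Sum>j\<in>A. (pderiv ^^ k) (F j))"
proof (induction k)
  case (Suc k)
  have "pderiv (\<Sum>j\<in>A. G j) = (\<Sum>j\<in>A. pderiv (G j))" for G :: "_ \<Rightarrow> int poly"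
    by (induction A rule: infinite_finite_induct) (auto simp: pderiv_add)
  then show ?case using Suc by simp
qed simp

lemma higher_pderiv_add_int: "(pderiv ^^ k) (A + B :: int poly) = (pderiv ^^ k) A + (pderiv ^^ k) B"
  by (induction k) (auto simp: pderiv_add)

lemma cong_power_prime_int:
  assumes "prime p" "x \<in> {0..<int p}"
  shows "[x ^ (j * p) = x ^ j] (mod int p)"
proof -
  obtain y where y: "x = int y" using assms by (metis atLeastLessThan_iff nonneg_int_cases)
  have "[y ^ p = y] (mod p)"
  proof (cases "p dvd y")
    case True
    then show ?thesis using assms(1)
      by (metis cong_0_iff cong_sym cong_trans dvd_power prime_gt_0_nat dvd_trans)
  next
    case False
    then have "[y * y ^ (p - 1) = y * 1] (mod p)"
      by (intro cong_mult cong_refl fermat_theorem assms(1))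
    then show ?thesis using prime_gt_0_nat[OF assms(1)] by (cases p) auto
  qed
  then have "[(y ^ p) ^ j = y ^ j] (mod p)" by (rule cong_pow)
  then have "[int ((y ^ p) ^ j) = int (y ^ j)] (mod int p)" by (simp only: cong_int_iff)
  then show ?thesis by (simp add: y power_mult mult.commute[of j])
qed

text \<open>The auxiliary polynomial is \<open>R = f ^ l * (\<Sum>j<J. X ^ (j * p) * (r j + f ^ ((p - 1) div 2) * s j))\<close>. It
  vanishes to order \<open>l\<close> at every counted point because there \<open>x ^ p\<close> can be replaced by \<open>x\<close> and
  \<open>f x ^ ((p - 1) div 2)\<close> by \<open>a\<close> in each derivative.\<close>

lemma stepanov_count:
  fixes p d l J :: nat and f h :: "int poly" and a :: int
  assumes p: "prime p" "odd p" and f: "f = [:-\<alpha>, 1:] * h" and h: "\<not> int p dvd poly h \<alpha>"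
    and f0: "\<not> int p dvd coeff f 0" and deg: "degree f + 2 * d < p + 2" "d > 0"
    and l: "l \<le> p" and count: "l * (d + l * degree f + J) < 2 * J * d"
  shows "l * card {x \<in> {0..<int p}. [poly f x ^ ((p - 1) div 2) = a] (mod int p)}
    \<le> l * degree f + (J * p + d + (p - 1) div 2 * degree f)"
proof -
  define n m where "n = (p - 1) div 2" and "m = degree f"
  define S where "S = {x \<in> {0..<int p}. [poly f x ^ n = a] (mod int p)}"
  define E where "E = d + l * m + J"
  \<comment> \<open>The unknown \<open>w (e, j, i)\<close> is a coefficient of \<open>r j\<close>
    for \<open>e = 0\<close> and of \<open>s j\<close> for \<open>e = 1\<close>; there are
    \<open>2 * J * d\<close> unknowns.\<close>
  define rs where "rs = (\<lambda>(w :: nat \<times> nat \<times> nat \<Rightarrow> int) e j. \<Sum>i<d. monom (w (e, j, i)) i)"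
  \<comment> \<open>What the derivative of order \<open>k\<close> becomes at a counted point once
    \<open>f ^ (l - k)\<close> is removed and \<open>x ^ p\<close>, \<open>f x ^ n\<close> are
    replaced by \<open>x\<close>, \<open>a\<close>. Its degree is below \<open>E\<close>, so making
    it zero modulo \<open>p\<close> for all \<open>k < l\<close> takes \<open>l * E\<close> linear
    conditions, fewer than the unknowns by \<open>count\<close>.\<close>
  define T where "T = (\<lambda>w k. \<Sum>j<J. (leibniz_op f l k (rs w 0 j)
      + smult a (leibniz_op f (l + n) k (rs w 1 j))) * monom 1 j)"
  define \<Phi> where "\<Phi> = (\<lambda>w (k, i). coeff (T w k) i)"
  define I where "I = {..<2::nat} \<times> {..<J} \<times> {..<d}"
  define K where "K = {..<l} \<times> {..<E}"
  have rs_diff: "rs (\<lambda>i. v i - w i) e j = rs v e j - rs w e j" for v w e j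
    by (simp add: rs_def sum_subtractf flip: diff_monom)
  have T_diff: "T (\<lambda>i. v i - w i) k = T v k - T w k" for v w k
    by (simp add: T_def rs_diff leibniz_op_diff smult_diff_right algebra_simps sum_subtractf sum.distrib)
  have p1: "p > 1" using p prime_gt_1_nat by blast
  have KI: "card K < card I"
    using count by (simp add: K_def I_def E_def m_def mult.assoc)
  obtain w where w: "\<exists>i\<in>I. \<not> int p dvd w i" "\<And>k. k \<in> K \<Longrightarrow> int p dvd \<Phi> w k"
    by (rule mod_linear_system[OF p1 _ _ KI, of \<Phi>]) (auto simp: I_def K_def \<Phi>_def T_diff)
  define r s where "r = rs w 0" and "s = rs w 1"
  have coeff_rs: "coeff (rs w e j) i = w (e, j, i)" if "i < d" for e j i
    using that by (simp add: rs_def coeff_sum if_distrib[of "\<lambda>c. c = _"] sum.delta)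
  have deg_rs: "degree (rs w e j) < d" for e j
  proof -
    have "degree (rs w e j) \<le> d - 1"
      unfolding rs_def
      by (rule degree_sum_le) (auto intro: order.trans[OF degree_monom_le])
    then show ?thesis using deg by linarith
  qed
  obtain e j i where eji: "e < 2" "j < J" "i < d" "\<not> int p dvd w (e, j, i)"
    using w(1) by (auto simp: I_def)
  then have "\<not> [:int p:] dvd rs w e j" unfolding const_poly_dvd_iff using coeff_rs by metis
  moreover have "e = 0 \<or> e = 1" using eji by auto
  ultimately have ex: "\<exists>j<J. \<not> [:int p:] dvd r j \<or> \<not> [:int p:] dvd s j"
    using eji by (auto simp: r_def s_def)
  define V where "V = (\<Sum>j<J. monom 1 (j * p) * (r j + f ^ n * s j))"
  define R where "R = f ^ l * V"
  have nV: "\<not> [:int p:] dvd V"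
    unfolding V_def n_def
    by (rule stepanov_nonzero[OF p f h f0 deg _ _ ex]) (simp_all add: r_def s_def deg_rs)
  have pp: "prime_elem [:int p:]" using p by (intro lift_prime_elem_poly) auto
  have "\<not> [:int p:] dvd f" using f0 by (auto simp: const_poly_dvd_iff)
  then have nR: "\<not> [:int p:] dvd R"
    using nV pp by (auto simp: R_def prime_elem_dvd_mult_iff dest: prime_elem_dvd_power)
  have TW: "[:int p:] dvd T w k" if "k < l" for k
    unfolding const_poly_dvd_iff
  proof
    fix i
    show "int p dvd coeff (T w k) i"
    proof (cases "i < E")
      case True
      then show ?thesis using w(2)[of "(k, i)"] that by (simp add: K_def \<Phi>_def)
    next
      case False
      have "degree (T w k) \<le> E - 1"
        unfolding T_def
      proof (rule degree_sum_le)
        fix j assume j: "j \<in> {..<J}"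
        have A: "degree (leibniz_op f c k (rs w e j)) \<le> d - 1 + l * m" for c e
        proof -
          have "degree (leibniz_op f c k (rs w e j)) \<le> degree (rs w e j) + k * m"
            unfolding m_def by (rule degree_leibniz_op)
          moreover have "k * m \<le> l * m" using that by (intro mult_le_mono1) simp
          ultimately show ?thesis using deg_rs[of e j] by linarith
        qed
        have "degree (leibniz_op f l k (rs w 0 j) + smult a (leibniz_op f (l + n) k (rs w 1 j)))
            \<le> d - 1 + l * m"
          by (intro degree_add_le A order.trans[OF degree_smult_le])
        then have "degree ((leibniz_op f l k (rs w 0 j)
            + smult a (leibniz_op f (l + n) k (rs w 1 j))) * monom 1 j) \<le> d - 1 + l * m + j"
          by (intro order.trans[OF degree_mult_le] add_mono degree_monom_le)
        then show "degree ((leibniz_op f l k (rs w 0 j)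
            + smult a (leibniz_op f (l + n) k (rs w 1 j))) * monom 1 j) \<le> E - 1"
          using j deg by (simp add: E_def)
      qed simp
      moreover have "E > 0" using deg by (simp add: E_def)
      ultimately have "degree (T w k) < i" using False by linarith
      then have "coeff (T w k) i = 0" by (rule coeff_eq_0)
      then show ?thesis by simp
    qed
  qed
  have vanish: "int p dvd poly ((pderiv ^^ k) R) x" if x: "x \<in> S" and k: "k < l" for x k
  proof -
    define A B where "A = (\<lambda>j. leibniz_op f l k (r j))" and "B = (\<lambda>j. leibniz_op f (l + n) k (s j))"
    define Y where "Y = (\<lambda>j. f ^ l * r j + f ^ (l + n) * s j)"
    have RY: "R = (\<Sum>j<J. monom 1 (j * p) * Y j)"
      by (simp add: R_def V_def Y_def sum_distrib_left power_add algebra_simps)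
    have DY: "(pderiv ^^ k) (Y j) = f ^ (l - k) * (A j + f ^ n * B j)" for j
    proof -
      have "l + n - k = (l - k) + n" using k by simp
      then have "(pderiv ^^ k) (Y j) = f ^ (l - k) * A j + f ^ ((l - k) + n) * B j"
        using higher_pderiv_power_mult[of k l f "r j"] higher_pderiv_power_mult[of k "l + n" f "s j"] k
        by (simp add: Y_def higher_pderiv_add_int A_def B_def)
      then show ?thesis by (simp add: power_add algebra_simps)
    qed
    have "[:int p:] dvd (\<Sum>j<J. (pderiv ^^ k) (monom 1 (j * p) * Y j) - monom 1 (j * p) * (pderiv ^^ k) (Y j))"
      by (intro dvd_sum higher_pderiv_monom_mult_mod)
    then have "int p dvd poly (\<Sum>j<J. (pderiv ^^ k) (monom 1 (j * p) * Y j) - monom 1 (j * p) * (pderiv ^^ k) (Y j)) x"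
      by (rule const_dvd_poly_value)
    also have "poly (\<Sum>j<J. (pderiv ^^ k) (monom 1 (j * p) * Y j) - monom 1 (j * p) * (pderiv ^^ k) (Y j)) x
      = poly ((pderiv ^^ k) R) x - (\<Sum>j<J. x ^ (j * p) * (poly f x ^ (l - k) * (poly (A j) x + poly f x ^ n * poly (B j) x)))"
      unfolding RY higher_pderiv_sum_int DY sum_subtractf by (simp add: poly_sum poly_monom)
    finally have c1: "[poly ((pderiv ^^ k) R) x = (\<Sum>j<J. x ^ (j * p) * (poly f x ^ (l - k) * (poly (A j) x + poly f x ^ n * poly (B j) x)))] (mod int p)"
      by (simp only: cong_iff_dvd_diff)
    have c2: "[(\<Sum>j<J. x ^ (j * p) * (poly f x ^ (l - k) * (poly (A j) x + poly f x ^ n * poly (B j) x)))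
        = (\<Sum>j<J. x ^ j * (poly f x ^ (l - k) * (poly (A j) x + a * poly (B j) x)))] (mod int p)"
      using x p(1)
      by (intro cong_sum cong_mult cong_add cong_refl cong_power_prime_int) (auto simp: S_def)
    have "(\<Sum>j<J. x ^ j * (poly f x ^ (l - k) * (poly (A j) x + a * poly (B j) x)))
        = poly f x ^ (l - k) * poly (T w k) x"
      by (simp add: T_def poly_sum poly_monom sum_distrib_left A_def B_def r_def s_def algebra_simps)
    moreover have "int p dvd poly (T w k) x" using TW[OF k] by (rule const_dvd_poly_value)
    ultimately have "[(\<Sum>j<J. x ^ j * (poly f x ^ (l - k) * (poly (A j) x + a * poly (B j) x))) = 0] (mod int p)"
      by (simp add: cong_0_iff)
    then show ?thesis using c1 c2 by (meson cong_0_iff cong_trans)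
  qed
  have "sum (\<lambda>_. l) S \<le> degree R"
  proof (rule sum_multiplicities_le_degree[of "int p"])
    show "finite S" by (rule finite_subset[of _ "{0..<int p}"]) (auto simp: S_def)
    show "s = t" if "s \<in> S" "t \<in> S" "int p dvd s - t" for s t
      using that by (intro eq_if_dvd_diff[of s "int p"]) (auto simp: S_def)
  qed (use p l nR vanish in auto)
  also have "degree R \<le> l * m + degree V"
    unfolding R_def m_def
    using degree_mult_le[of "f ^ l" V] degree_power_le[of f l] by (simp add: mult.commute)
  also have "degree V \<le> J * p + d + n * m"
    unfolding V_def
  proof (rule degree_sum_le)
    fix j assume j: "j \<in> {..<J}"
    have "degree (r j + f ^ n * s j) \<le> d + n * m"
      using deg_rs[of 0 j] deg_rs[of 1 j] degree_power_le[of f n] degree_mult_le[of "f ^ n" "s j"]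
      by (intro degree_add_le) (auto simp: r_def s_def m_def mult.commute)
    moreover have "degree (monom 1 (j * p) :: int poly) \<le> J * p"
      using j by (intro order.trans[OF degree_monom_le]) auto
    ultimately show "degree (monom 1 (j * p) * (r j + f ^ n * s j)) \<le> J * p + d + n * m"
      using degree_mult_le[of "monom 1 (j * p)" "r j + f ^ n * s j"] by linarith
  qed simp
  finally show ?thesis
    by (simp add: S_def n_def m_def mult.commute)
qed

section \<open>Legendre symbols and complete sums of split polynomials\<close>

lemma Legendre_cong: "[a = b] (mod p) \<Longrightarrow> Legendre a p = Legendre b p"
proof -
  assume c: "[a = b] (mod p)"
  have "[a = 0] (mod p) \<longleftrightarrow> [b = 0] (mod p)" "[y\<^sup>2 = a] (mod p) \<longleftrightarrow> [y\<^sup>2 = b] (mod p)" for y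
    using c by (meson cong_sym cong_trans)+
  then show ?thesis by (simp only: Legendre_def QuadRes_def)
qed

lemma Legendre_values: "Legendre a p \<in> {-1, 0, 1}"
  by (auto simp: Legendre_def)

text \<open>Euler's criterion gives the equation modulo \<open>p\<close>; both sides lie in {-1, 0,
  1}, so their difference is at most 2 in absolute value, below the odd prime
  \<open>p\<close>.\<close>

lemma Legendre_mult:
  assumes p: "prime p" "odd p"
  shows "Legendre (a * b) (int p) = Legendre a (int p) * Legendre b (int p)"
proof -
  have p2: "2 < p" using p prime_gt_1_nat[of p] by (cases "p = 2") auto
  have "[Legendre (a * b) (int p) = (a * b) ^ ((p - 1) div 2)] (mod int p)"
    by (rule euler_criterion[OF p(1) p2])
  moreover have "[Legendre a (int p) * Legendre b (int p) = a ^ ((p - 1) div 2) * b ^ ((p - 1) div 2)] (mod int p)"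
    by (intro cong_mult euler_criterion[OF p(1) p2])
  ultimately have "[Legendre (a * b) (int p) = Legendre a (int p) * Legendre b (int p)] (mod int p)"
    by (metis cong_sym cong_trans power_mult_distrib)
  then have "int p dvd Legendre (a * b) (int p) - Legendre a (int p) * Legendre b (int p)"
    by (simp add: cong_iff_dvd_diff)
  moreover have "\<bar>Legendre (a * b) (int p) - Legendre a (int p) * Legendre b (int p)\<bar> \<le> 2"
    using Legendre_values[of "a * b" "int p"] Legendre_values[of a "int p"] Legendre_values[of b "int p"]
    by auto
  ultimately show ?thesis
    using p2 zdvd_imp_le[of "int p" "\<bar>Legendre (a * b) (int p) - Legendre a (int p) * Legendre b (int p)\<bar>"]
    by auto
qed

lemma sum_periodic_shift:
  fixes F :: "nat \<Rightarrow> 'a :: ab_group_add"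
  assumes "\<And>x. F (x + q) = F x"
  shows "(\<Sum>x<q. F (x + c)) = (\<Sum>x<q. F x)"
proof (induction c)
  case (Suc c)
  have "(\<Sum>x<q. F (x + Suc c)) + F c = (\<Sum>x<Suc q. F (x + c))"
    by (subst sum.lessThan_Suc_shift) (simp add: add.commute)
  also have "\<dots> = (\<Sum>x<q. F (x + c)) + F c"
    using assms[of c] by (simp add: add.commute)
  finally show ?case using Suc by simp
qed simp

text \<open>Stepanov's method yields only upper bounds. Since the counts of the values 1, -1 and 0
  add up to \<open>card X\<close>, an upper bound for one sign is a lower bound for the
  other.\<close>

lemma abs_sum_le_of_counts:
  fixes L :: "'a \<Rightarrow> int"
  assumes fin: "finite X" and L: "\<And>x. x \<in> X \<Longrightarrow> L x \<in> {-1, 0, 1}"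
    and "real (card {x\<in>X. L x = 0}) \<le> z"
    and "\<And>a. a \<in> {1, -1} \<Longrightarrow> 2 * real (card {x\<in>X. L x = a}) \<le> real (card X) + B"
  shows "\<bar>real_of_int (\<Sum>x\<in>X. L x)\<bar> \<le> B + z"
proof -
  define P M Z where "P = {x\<in>X. L x = 1}" and "M = {x\<in>X. L x = -1}" and "Z = {x\<in>X. L x = 0}"
  have X: "X = P \<union> M \<union> Z" using L by (auto simp: P_def M_def Z_def)
  have fin': "finite P" "finite M" "finite Z" using fin by (auto simp: P_def M_def Z_def)
  have card: "card X = card P + card M + card Z"
    unfolding X using fin'
    by (subst card_Un_disjoint, auto simp: P_def M_def Z_def)+
  have "(\<Sum>x\<in>X. L x) = (\<Sum>x\<in>P. L x) + (\<Sum>x\<in>M. L x) + (\<Sum>x\<in>Z. L x)"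
    unfolding X using fin'
    by (subst sum.union_disjoint, auto simp: P_def M_def Z_def)+
  also have "\<dots> = int (card P) - int (card M)" by (simp add: P_def M_def Z_def)
  finally have "real_of_int (\<Sum>x\<in>X. L x) = real (card P) - real (card M)" by simp
  moreover have "2 * real (card P) \<le> real (card X) + B" "2 * real (card M) \<le> real (card X) + B"
    using assms(4)[of 1] assms(4)[of "-1"] by (auto simp: P_def M_def)
  moreover have "real (card Z) \<le> z" using assms(3) by (simp add: Z_def)
  ultimately show ?thesis using card by linarith
qed

text \<open>The order of vanishing \<open>l\<close> is about \<open>sqrt p\<close>, \<open>d\<close>
  is as large as the degree condition permits, and \<open>J\<close> is about
  \<open>l / 2 + 2 * m\<close>. The count then gives
  \<open>l * card S \<le> l * p / 2 + O(m * p)\<close>, and division by \<open>l\<close> leaves an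
  error of order \<open>m * sqrt p\<close>. Only the root \<open>- b i\<close> has to be simple; the
  other roots may coincide with each other. The condition \<open>nz\<close> supplies the nonzero
  constant term.\<close>

lemma weil_bound_shifted:
  fixes p m :: nat and b :: "nat \<Rightarrow> int"
  assumes p: "prime p" "odd p" and i: "i < m"
    and simple: "\<And>j. j < m \<Longrightarrow> j \<noteq> i \<Longrightarrow> \<not> int p dvd b i - b j"
    and nz: "\<not> int p dvd (\<Prod>j<m. b j)" and large: "(m + 4)\<^sup>2 \<le> p"
  shows "\<bar>real_of_int (\<Sum>x\<in>{0..<int p}. Legendre (\<Prod>j<m. x + b j) (int p))\<bar> \<le> (13 * real m + 10) * sqrt (real p)"
proof -
  define f h where "f = (\<Prod>j<m. [:b j, 1:])" and "h = (\<Prod>j\<in>{..<m}-{i}. [:b j, 1:])"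
  have pp: "prime (int p)" using p by simp
  have f: "f = [:- (- b i), 1:] * h"
    unfolding f_def h_def using i by (subst prod.remove[of _ i]) auto
  have polyf: "poly f x = (\<Prod>j<m. x + b j)" for x by (simp add: f_def poly_prod add.commute)
  have degf: "degree f = m"
    unfolding f_def by (subst degree_prod_eq_sum_degree) auto
  have hnz: "\<not> int p dvd poly h (- b i)"
  proof
    assume "int p dvd poly h (- b i)"
    then have "int p dvd (\<Prod>j\<in>{..<m}-{i}. b j - b i)" by (simp add: h_def poly_prod)
    then obtain j where "j \<in> {..<m}-{i}" "int p dvd b j - b i"
      using pp by (subst (asm) prime_dvd_prod_iff) auto
    then show False using simple[of j] by (auto simp: dvd_diff_commute)
  qed
  have f0: "\<not> int p dvd coeff f 0" using nz by (simp add: polyf flip: poly_0_coeff_0)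
  define l where "l = nat \<lfloor>sqrt (real p)\<rfloor>"
  have lreal: "real l \<le> sqrt (real p)" "sqrt (real p) < real l + 1"
    by (auto simp: l_def)
  have "real (m + 4) \<le> sqrt (real p)"
    by (intro real_le_rsqrt) (metis large of_nat_le_iff of_nat_power)
  then have lm: "m + 4 \<le> l" using lreal by linarith
  have "(real l)\<^sup>2 \<le> real p" using lreal(1) by (metis of_nat_0_le_iff power_mono real_sqrt_pow2)
  then have l2: "l * l \<le> p" by (simp add: power2_eq_square flip: of_nat_mult)
  have lp: "l \<le> p" using l2 lm by (metis le_square le_trans)
  have mp: "m + 2 \<le> p" using lm lp by linarith
  define d J where "d = (p - m) div 2" and "J = l div 2 + 2 * m + 2"
  have d: "2 * d + m \<le> p" "p \<le> 2 * d + m + 1" "d > 0" using mp by (auto simp: d_def)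
  have J: "2 * J \<le> l + 4 * m + 4" "l + 4 * m + 3 \<le> 2 * J" by (auto simp: J_def)
  have count: "l * (d + l * degree f + J) < 2 * J * d"
  proof -
    \<comment> \<open>The surplus \<open>4 * m + 3\<close> of \<open>2 * J\<close> over
      \<open>l\<close> pays for the remaining terms: times \<open>d\<close>, about
      \<open>p / 2\<close>, it is about \<open>(2 * m + 3/2) * p\<close>, against
      \<open>l * l * m + l * J\<close> of about \<open>(m + 1/2) * p\<close>.\<close>
    have "2 * (l * (l * m) + l * J) < 2 * ((4 * m + 3) * d)"
    proof -
      have "2 * (l * (l * m)) \<le> 2 * (p * m)" using mult_le_mono1[OF l2, of m] by (simp add: mult.assoc)
      moreover have "l * (2 * J) \<le> l * (l + 4 * m + 4)" using J by (intro mult_le_mono2)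
      then have "2 * (l * J) \<le> p + l * (4 * m + 4)" using l2 by (simp add: algebra_simps)
      moreover have "(4 * m + 3) * p \<le> (4 * m + 3) * (2 * d + m + 1)" using d by (intro mult_le_mono2) simp
      moreover have "l * (4 * m + 4) + (4 * m + 3) * (m + 1) < (2 * m + 2) * p"
      proof -
        have "4 * l + 4 * m + 3 < 2 * (l * l)"
        proof -
          have "l * (m + 4) \<le> l * l" using lm by (intro mult_le_mono2)
          moreover have "4 * m \<le> l * m" using lm by (intro mult_le_mono1) simp
          ultimately show ?thesis using lm by (simp add: algebra_simps)
        qed
        then have "4 * l + 4 * m + 3 < 2 * p" using l2 by linarith
        then have "(m + 1) * (4 * l + 4 * m + 3) < (m + 1) * (2 * p)" by (intro mult_strict_left_mono) auto
        then show ?thesis by (simp add: algebra_simps)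
      qed
      ultimately show ?thesis by (simp only: algebra_simps)
    qed
    then have "l * d + l * (l * m) + l * J < (l + 4 * m + 3) * d" by (simp add: algebra_simps)
    also have "\<dots> \<le> 2 * J * d" using J by (intro mult_le_mono1)
    finally show ?thesis by (simp add: degf algebra_simps)
  qed
  have N: "2 * real (card {x \<in> {0..<int p}. Legendre (\<Prod>j<m. x + b j) (int p) = a})
      \<le> real (card {0..<int p}) + (2 * real m + (10 * real m + 10) * sqrt (real p))" for a
  proof -
    define S where "S = {x \<in> {0..<int p}. [poly f x ^ ((p - 1) div 2) = a] (mod int p)}"
    have p2: "2 < p" using p prime_gt_1_nat[of p] by (cases "p = 2") auto
    have "card {x \<in> {0..<int p}. Legendre (\<Prod>j<m. x + b j) (int p) = a} \<le> card S"
    proof (rule card_mono)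
      show "finite S" unfolding S_def by (rule finite_subset[of _ "{0..<int p}"]) auto
      show "{x \<in> {0..<int p}. Legendre (\<Prod>j<m. x + b j) (int p) = a} \<subseteq> S"
        using euler_criterion[OF p(1) p2] by (auto simp: S_def polyf cong_sym)
    qed
    moreover have "l * card S \<le> l * m + (J * p + d + (p - 1) div 2 * m)"
      using stepanov_count[OF p f hnz f0 _ d(3) lp count] d by (simp add: S_def degf)
    then have "2 * (l * card S) \<le> 2 * (l * m) + (2 * J * p + 2 * d + 2 * ((p - 1) div 2) * m)"
      by (simp add: algebra_simps)
    then have "2 * (l * card S) \<le> 2 * (l * m) + ((l + 4 * m + 4) * p + p + p * m)"
    proof (rule order.trans)
      show "2 * (l * m) + (2 * J * p + 2 * d + 2 * ((p - 1) div 2) * m)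
          \<le> 2 * (l * m) + ((l + 4 * m + 4) * p + p + p * m)"
        using d J by (intro add_mono mult_le_mono1 order.refl) auto
    qed
    then have "real (2 * (l * card S)) \<le> real (2 * (l * m) + ((l + 4 * m + 4) * p + p + p * m))"
      by (rule of_nat_mono)
    then have A: "real l * (2 * real (card S)) \<le> real l * (real p + 2 * real m) + (5 * real m + 5) * real p"
      by (simp add: algebra_simps)
    have "real p \<le> real l * (2 * sqrt (real p))"
    proof -
      have "sqrt (real p) \<le> 2 * real l" using lreal lm by linarith
      then have "sqrt (real p) * sqrt (real p) \<le> 2 * real l * sqrt (real p)" by (intro mult_right_mono) auto
      then show ?thesis by simp
    qed
    then have "(5 * real m + 5) * real p \<le> (5 * real m + 5) * (real l * (2 * sqrt (real p)))"
      by (intro mult_left_mono) auto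
    then have "real l * (2 * real (card S)) \<le> real l * (real p + 2 * real m + (10 * real m + 10) * sqrt (real p))"
      using A by (simp add: algebra_simps)
    then have "2 * real (card S) \<le> real p + 2 * real m + (10 * real m + 10) * sqrt (real p)"
      using lm by (subst (asm) mult_le_cancel_left_pos) auto
    ultimately show ?thesis by (simp add: algebra_simps)
  qed
  have Z: "real (card {x \<in> {0..<int p}. Legendre (\<Prod>j<m. x + b j) (int p) = 0}) \<le> real m"
  proof -
    have "\<not> [:int p:] dvd f" using f0 by (auto simp: const_poly_dvd_iff)
    then have "sum (\<lambda>_. 1) {x \<in> {0..<int p}. Legendre (\<Prod>j<m. x + b j) (int p) = 0} \<le> degree f"
    proof (rule sum_multiplicities_le_degree[OF pp, rotated 2])
      show "s = t" if "s \<in> {x \<in> {0..<int p}. Legendre (\<Prod>j<m. x + b j) (int p) = 0}"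
        "t \<in> {x \<in> {0..<int p}. Legendre (\<Prod>j<m. x + b j) (int p) = 0}" "int p dvd s - t" for s t
        using that by (intro eq_if_dvd_diff[of s "int p"]) auto
      show "int 1 \<le> int p" using mp by simp
      show "int p dvd poly ((pderiv ^^ k) f) s"
        if "s \<in> {x \<in> {0..<int p}. Legendre (\<Prod>j<m. x + b j) (int p) = 0}" "k < 1" for s k
        using that by (auto simp: polyf Legendre_def cong_0_iff split: if_splits)
    qed (auto intro: finite_subset[of _ "{0..<int p}"])
    then show ?thesis by (simp add: degf)
  qed
  have "\<bar>real_of_int (\<Sum>x\<in>{0..<int p}. Legendre (\<Prod>j<m. x + b j) (int p))\<bar>
      \<le> (2 * real m + (10 * real m + 10) * sqrt (real p)) + real m"
    by (rule abs_sum_le_of_counts) (use Legendre_values N Z in auto)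
  also have "\<dots> \<le> (13 * real m + 10) * sqrt (real p)"
  proof -
    have "1 \<le> sqrt (real p)" using mp by simp
    then have "3 * real m * 1 \<le> 3 * real m * sqrt (real p)" by (intro mult_left_mono) auto
    then show ?thesis by (simp add: algebra_simps)
  qed
  finally show ?thesis .
qed

text \<open>For \<open>p < (m + 4)\<^sup>2\<close> the trivial bound \<open>p\<close> is good
  enough. Otherwise a translation by some \<open>c\<close> removes the root at 0: the monic
  polynomial of degree \<open>m < p\<close> cannot vanish at all residues, and the complete sum is
  invariant under shifts.\<close>

lemma weil_bound:
  fixes p m :: nat and b :: "nat \<Rightarrow> nat"
  assumes p: "prime p" "odd p" and i: "i < m"
    and simple: "\<And>j. j < m \<Longrightarrow> j \<noteq> i \<Longrightarrow> \<not> int p dvd int (b i) - int (b j)"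
  shows "\<bar>real_of_int (\<Sum>x<p. Legendre (int (\<Prod>j<m. x + b j)) (int p))\<bar> \<le> (13 * real m + 10) * sqrt (real p)"
proof (cases "(m + 4)\<^sup>2 \<le> p")
  case False
  have "\<bar>real_of_int (\<Sum>x<p. Legendre (int (\<Prod>j<m. x + b j)) (int p))\<bar> \<le> (\<Sum>x<p. 1)"
    unfolding of_int_sum by (intro order.trans[OF sum_abs] sum_mono) (auto simp: Legendre_def)
  also have "\<dots> = sqrt (real p) * sqrt (real p)" by simp
  also have "\<dots> \<le> (13 * real m + 10) * sqrt (real p)"
  proof (rule mult_right_mono)
    have "real p \<le> (real (m + 4))\<^sup>2" by (metis False nat_le_linear of_nat_le_iff of_nat_power)
    then have "sqrt (real p) \<le> real (m + 4)" by (intro real_le_lsqrt) auto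
    then show "sqrt (real p) \<le> 13 * real m + 10" by simp
  qed simp
  finally show ?thesis .
next
  case True
  define F where "F = (\<lambda>x. Legendre (int (\<Prod>j<m. x + b j)) (int p))"
  have per: "F (x + p) = F x" for x
    unfolding F_def
    unfolding of_nat_prod by (intro Legendre_cong cong_prod) (simp add: cong_iff_dvd_diff)
  define f where "f = (\<Prod>j<m. [:int (b j), 1:])"
  have polyf: "poly f x = (\<Prod>j<m. x + int (b j))" for x by (simp add: f_def poly_prod add.commute)
  have degf: "degree f = m"
    unfolding f_def by (subst degree_prod_eq_sum_degree) auto
  have mp: "m < p" using True by (simp add: power2_eq_square algebra_simps)
  have "lead_coeff f = 1" unfolding f_def lead_coeff_prod by simp
  have nf: "\<not> [:int p:] dvd f"
  proof
    assume "[:int p:] dvd f"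
    then have "int p dvd lead_coeff f" unfolding const_poly_dvd_iff by blast
    then show False using p(1) \<open>lead_coeff f = 1\<close> by simp
  qed
  have "\<exists>c<p. \<not> int p dvd (\<Prod>j<m. int c + int (b j))"
  proof (rule ccontr)
    assume "\<not> ?thesis"
    then have all: "int p dvd poly f (int c)" if "c < p" for c using that by (auto simp: polyf)
    have "sum (\<lambda>_. 1) {0..<int p} \<le> degree f"
    proof (rule sum_multiplicities_le_degree[of "int p"])
      show "s = t" if "s \<in> {0..<int p}" "t \<in> {0..<int p}" "int p dvd s - t" for s t
        using that by (intro eq_if_dvd_diff[of s "int p"]) auto
      show "int p dvd poly ((pderiv ^^ k) f) s" if "s \<in> {0..<int p}" "k < 1" for s k
        using that all[of "nat s"] by auto
    qed (use p nf mp in auto)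
    then show False using mp degf by simp
  qed
  then obtain c where c: "\<not> int p dvd (\<Prod>j<m. int c + int (b j))" by blast
  have "(\<Sum>x<p. F x) = (\<Sum>x<p. F (x + c))" using sum_periodic_shift[of F, OF per] by simp
  also have "\<dots> = (\<Sum>x\<in>{0..<int p}. Legendre (\<Prod>j<m. x + int (c + b j)) (int p))"
    by (rule sum.reindex_bij_witness[of _ nat int]) (auto simp: F_def add.assoc)
  finally have eq: "(\<Sum>x<p. F x) = (\<Sum>x\<in>{0..<int p}. Legendre (\<Prod>j<m. x + int (c + b j)) (int p))" .
  show ?thesis
    unfolding F_def[symmetric] eq
    by (rule weil_bound_shifted[OF p i _ _ True]) (use simple c in auto)
qed

section \<open>Mertens' theorems\<close>

lemma prod_primes_dvd_if_all_dvd: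
  fixes n :: nat
  assumes "finite P" "\<And>p. p \<in> P \<Longrightarrow> prime p" "\<And>p. p \<in> P \<Longrightarrow> p dvd n"
  shows "\<Prod>P dvd n"
  using assms
proof (induction P)
  case (insert p P)
  have "coprime p (\<Prod>P)"
    using insert by (intro prod_coprime_right) (metis insertCI primes_coprime)
  then show ?case using insert by (auto intro: divides_mult)
qed simp

text \<open>For odd \<open>n = 2 * m + 1\<close> the primes in \<open>(m + 1, n]\<close> all divide
  the binomial coefficient \<open>n choose m\<close>, which is at most \<open>4 ^ m\<close> because
  it occurs twice in a row with sum \<open>2 * 4 ^ m\<close>. Even \<open>n > 2\<close> are not
  prime and reduce to \<open>n - 1\<close>.\<close>

lemma prod_primes_le_4_power: "(\<Prod>p | prime p \<and> p \<le> n. p) \<le> (4 :: nat) ^ n"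
proof (induction n rule: less_induct)
  case (less n)
  show ?case
  proof (cases "n \<le> 2")
    case True
    have "{p :: nat. prime p \<and> p \<le> n} \<subseteq> {2}" using True by (auto dest: prime_ge_2_nat)
    then have "{p. prime p \<and> p \<le> n} = {} \<or> {p. prime p \<and> p \<le> n} = {2}" by (rule subset_singletonD)
    moreover have h2: "2 \<le> (4 :: nat) ^ n" if "{p :: nat. prime p \<and> p \<le> n} = {2}"
    proof -
      have "2 \<in> {p :: nat. prime p \<and> p \<le> n}" unfolding that by simp
      then have "2 \<le> n" by simp
      then have "(4::nat) ^ 1 \<le> 4 ^ n" by (intro power_increasing) auto
      then show ?thesis by simp
    qed
    ultimately show ?thesis
    proof (elim disjE)
      assume "{p. prime p \<and> p \<le> n} = {}"
      then show ?thesis by (simp only: prod.empty) simp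
    next
      assume P: "{p. prime p \<and> p \<le> n} = {2}"
      show ?thesis using h2[OF P] unfolding P by simp
    qed
  next
    case False
    show ?thesis
    proof (cases "even n")
      case True
      have np: "\<not> prime n"
      proof
        assume "prime n"
        then have "2 = n" using True by (intro primes_dvd_imp_eq) auto
        then show False using False by simp
      qed
      have "p \<le> n \<longleftrightarrow> p \<le> n - 1" if "prime p" for p
        using that np False by (cases "p = n") auto
      then have "{p. prime p \<and> p \<le> n} = {p. prime p \<and> p \<le> n - 1}" by blast
      then have "(\<Prod>p | prime p \<and> p \<le> n. p) \<le> 4 ^ (n - 1)"
        using less.IH[of "n - 1"] False by simp
      also have "\<dots> \<le> 4 ^ n" by (intro power_increasing) auto
      finally show ?thesis .
    next
      case odd: False
      then obtain m where m: "n = 2 * m + 1" by (elim oddE)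
      then have m1: "m \<ge> 1" using False by simp
      define Q where "Q = {p. prime p \<and> m + 1 < p \<and> p \<le> n}"
      have fin: "finite Q" unfolding Q_def by (rule finite_subset[of _ "{..n}"]) auto
      have split: "{p. prime p \<and> p \<le> n} = {p. prime p \<and> p \<le> m + 1} \<union> Q"
        by (auto simp: Q_def m)
      have "\<Prod>Q dvd (n choose m)"
      proof (rule prod_primes_dvd_if_all_dvd[OF fin])
        fix p assume p: "p \<in> Q"
        show "prime p" using p by (simp add: Q_def)
        have "fact m * fact (n - m) * (n choose m) = (fact n :: nat)"
          by (rule binomial_fact_lemma) (simp add: m)
        moreover have "p dvd fact n" using p by (simp add: Q_def prime_dvd_fact_iff)
        moreover have "\<not> p dvd fact m" "\<not> p dvd fact (n - m)"
          using p prime_dvd_fact_iff[of p "n - m"] prime_dvd_fact_iff[of p m]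
          by (auto simp: Q_def m simp del: fact_Suc)
        ultimately show "p dvd (n choose m)"
          using p by (metis (mono_tags) Q_def mem_Collect_eq prime_dvd_mult_iff)
      qed
      then have "\<Prod>Q \<le> n choose m" by (rule dvd_imp_le) (simp add: m)
      also have "n choose m \<le> 4 ^ m"
      proof -
        have "2 * (n choose m) = (n choose m) + (n choose (m + 1))"
          using binomial_symmetric[of m n] by (simp add: m)
        also have "\<dots> = (\<Sum>k\<in>{m, m + 1}. n choose k)" by simp
        also have "\<dots> \<le> (\<Sum>k\<le>n. n choose k)" by (intro sum_mono2) (auto simp: m)
        also have "\<dots> = 2 ^ n" by (rule choose_row_sum)
        also have "\<dots> = 2 * 4 ^ m" by (simp add: m power_mult)
        finally show ?thesis by simp
      qed
      finally have "\<Prod>Q \<le> 4 ^ m" .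
      moreover have "(\<Prod>p | prime p \<and> p \<le> m + 1. p) \<le> 4 ^ (m + 1)"
        using m1 by (intro less.IH) (simp add: m)
      moreover have "(\<Prod>p | prime p \<and> p \<le> n. p) = (\<Prod>p | prime p \<and> p \<le> m + 1. p) * \<Prod>Q"
        unfolding split by (rule prod.union_disjoint) (auto simp: Q_def fin)
      ultimately have "(\<Prod>p | prime p \<and> p \<le> n. p) \<le> 4 ^ (m + 1) * 4 ^ m"
        by (simp add: mult_mono)
      also have "\<dots> = 4 ^ n" by (simp add: m flip: power_add)
      finally show ?thesis .
    qed
  qed
qed

lemma finite_primes_le [simp]: "finite {p :: nat. prime p \<and> p \<le> n}"
  by (rule finite_subset[of _ "{..n}"]) auto

lemma sum_ln_primes_le: "(\<Sum>p | prime p \<and> p \<le> n. ln (real p)) \<le> real n * ln 4"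
proof -
  have "(\<Sum>p | prime p \<and> p \<le> n. ln (real p)) = ln (\<Prod>p | prime p \<and> p \<le> n. real p)"
    by (subst ln_prod) (auto dest: prime_gt_0_nat)
  also have "\<dots> \<le> ln (4 ^ n)"
  proof -
    have "(\<Prod>p | prime p \<and> p \<le> n. real p) = real (\<Prod>p | prime p \<and> p \<le> n. p)" by simp
    also have "\<dots> \<le> real (4 ^ n)" using prod_primes_le_4_power by (rule of_nat_mono)
    finally have "(\<Prod>p | prime p \<and> p \<le> n. real p) \<le> 4 ^ n" by simp
    moreover have "(\<Prod>p | prime p \<and> p \<le> n. real p) > 0" by (intro prod_pos) (auto dest: prime_gt_0_nat)
    ultimately show ?thesis by simp
  qed
  also have "\<dots> = real n * ln 4" by (simp add: ln_realpow)
  finally show ?thesis .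
qed

section \<open>Legendre's formula and Mertens' first theorem\<close>

lemma sum_if_eq_card: "finite A \<Longrightarrow> (\<Sum>x\<in>A. if P x then 1 else 0) = card {x \<in> A. P x}"
  by (subst sum.inter_filter[symmetric]) auto

lemma card_multiples:
  fixes d n :: nat
  assumes "d > 0"
  shows "card {m \<in> {1..n}. d dvd m} = n div d"
proof -
  have "{m \<in> {1..n}. d dvd m} = (\<lambda>j. d * j) ` {1..n div d}"
  proof (intro equalityI subsetI)
    fix m assume m: "m \<in> {m \<in> {1..n}. d dvd m}"
    then obtain j where j: "m = d * j" by (auto elim: dvdE)
    then have "j \<le> n div d" using m assms by (simp add: less_eq_div_iff_mult_less_eq mult.commute)
    then show "m \<in> (\<lambda>j. d * j) ` {1..n div d}" using j m by (intro image_eqI[of _ _ j]) auto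
  next
    fix m assume "m \<in> (\<lambda>j. d * j) ` {1..n div d}"
    then show "m \<in> {m \<in> {1..n}. d dvd m}"
      using assms by (auto simp: less_eq_div_iff_mult_less_eq mult.commute)
  qed
  moreover have "inj_on (\<lambda>j. d * j) {1..n div d}" using assms by (auto simp: inj_on_def)
  ultimately show ?thesis by (simp add: card_image)
qed

text \<open>Both sides count the pairs \<open>(m, k)\<close> with \<open>p ^ k dvd m\<close> and
  \<open>1 \<le> m \<le> n\<close>; \<open>k \<le> n\<close> is no restriction since
  \<open>k < p ^ k \<le> m\<close>.\<close>

lemma multiplicity_fact:
  fixes p :: nat
  assumes p: "prime p"
  shows "multiplicity p (fact n :: nat) = (\<Sum>k=1..n. n div p ^ k)"
proof -
  have A: "multiplicity p m = (\<Sum>k=1..n. if p ^ k dvd m then 1 else 0)" if m: "m \<in> {1..n}" for m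
  proof -
    have "multiplicity p m \<le> n"
    proof -
      have "p ^ multiplicity p m \<le> m" using m by (intro dvd_imp_le multiplicity_dvd) auto
      moreover have "multiplicity p m < p ^ multiplicity p m"
        using prime_gt_1_nat[OF p] by (intro power_gt_expt) simp
      ultimately show ?thesis using m by simp
    qed
    have iff: "p ^ k dvd m \<longleftrightarrow> k \<le> multiplicity p m" for k
      using m p by (intro power_dvd_iff_le_multiplicity) (auto simp: not_prime_unit)
    have "{k \<in> {1..n}. p ^ k dvd m} = {1..multiplicity p m}"
      unfolding iff using \<open>multiplicity p m \<le> n\<close> by auto
    moreover have "(\<Sum>k=1..n. if p ^ k dvd m then 1 else 0) = card {k \<in> {1..n}. p ^ k dvd m}"
      by (rule sum_if_eq_card) simp
    ultimately show ?thesis by simp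
  qed
  have "multiplicity p (fact n :: nat) = (\<Sum>m=1..n. multiplicity p m)"
  proof -
    have "(fact n :: nat) = (\<Prod>m=1..n. m)" by (simp add: fact_prod)
    then show ?thesis using p by (simp add: prime_elem_multiplicity_prod_distrib)
  qed
  also have "\<dots> = (\<Sum>m=1..n. \<Sum>k=1..n. if p ^ k dvd m then 1 else 0)" by (simp add: A)
  also have "\<dots> = (\<Sum>k=1..n. \<Sum>m=1..n. if p ^ k dvd m then 1 else 0)" by (rule sum.swap)
  also have "\<dots> = (\<Sum>k=1..n. n div p ^ k)"
  proof (rule sum.cong)
    fix k assume "k \<in> {1..n}"
    have pk: "p ^ k > 0" using p prime_gt_0_nat by simp
    from pk have "card {m \<in> {1..n}. p ^ k dvd m} = n div p ^ k" by (rule card_multiples)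
    then show "(\<Sum>m=1..n. if p ^ k dvd m then 1 else 0) = n div p ^ k"
      by (simp only: sum_if_eq_card finite_atLeastAtMost)
  qed simp
  finally show ?thesis .
qed

lemma ln_fact_eq: "ln (fact n :: real) = (\<Sum>p | prime p \<and> p \<le> n. real (multiplicity p (fact n :: nat)) * ln (real p))"
proof -
  have "prime_factors (fact n :: nat) = {p. prime p \<and> p \<le> n}"
    by (auto simp: prime_factors_dvd prime_dvd_fact_iff)
  then have "(fact n :: nat) = (\<Prod>p | prime p \<and> p \<le> n. p ^ multiplicity p (fact n))"
    using prime_factorization_nat[of "fact n"] by simp
  then have "real (fact n) = real (\<Prod>p | prime p \<and> p \<le> n. p ^ multiplicity p (fact n))" by (rule arg_cong)
  then have "(fact n :: real) = (\<Prod>p | prime p \<and> p \<le> n. real p ^ multiplicity p (fact n :: nat))" by simp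
  then have "ln (fact n :: real) = ln (\<Prod>p | prime p \<and> p \<le> n. real p ^ multiplicity p (fact n :: nat))"
    by simp
  also have "\<dots> = (\<Sum>p | prime p \<and> p \<le> n. ln (real p ^ multiplicity p (fact n :: nat)))"
    by (rule ln_prod) (auto dest: prime_gt_0_nat)
  also have "\<dots> = (\<Sum>p | prime p \<and> p \<le> n. real (multiplicity p (fact n :: nat)) * ln (real p))"
    by (intro sum.cong) (auto simp: ln_realpow dest: prime_gt_0_nat)
  finally show ?thesis .
qed

lemma ln_Suc_diff_le:
  assumes "n > 0"
  shows "ln (real (Suc n)) - ln (real n) \<le> 1 / real n"
proof -
  have "ln (real (Suc n)) - ln (real n) = ln (real (Suc n) / real n)"
    using assms by (subst ln_div) auto
  also have "real (Suc n) / real n = 1 + 1 / real n" using assms by (simp add: field_simps)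
  also have "ln (1 + 1 / real n) \<le> 1 / real n" by (rule ln_add_one_self_le_self) simp
  finally show ?thesis .
qed

lemma real_div_bounds:
  "real n / real p - 1 \<le> real (n div p)" "real (n div p) \<le> real n / real p"
proof -
  have "real (n div p) = real_of_int \<lfloor>real n / real p\<rfloor>" by (simp add: floor_divide_of_nat_eq)
  then show "real n / real p - 1 \<le> real (n div p)" "real (n div p) \<le> real n / real p" by linarith+
qed

lemma ln_fact_ge: "real n * ln (real n) - real n \<le> ln (fact n)"
proof (induction n)
  case (Suc n)
  show ?case
  proof (cases "n = 0")
    case False
    have "real n * (ln (real (Suc n)) - ln (real n)) \<le> real n * (1 / real n)"
      using False by (intro mult_left_mono ln_Suc_diff_le) auto
    then have "real n * ln (real (Suc n)) - real n * ln (real n) \<le> 1" using False by (simp add: algebra_simps)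
    moreover have "ln (fact (Suc n) :: real) = ln (real (Suc n)) + ln (fact n)"
      using False by (simp add: ln_mult)
    ultimately show ?thesis using Suc by (simp add: algebra_simps)
  qed simp
qed simp

lemma ln_fact_le: "ln (fact n) \<le> real n * ln (real n)"
proof (cases "n = 0")
  case False
  have "(fact n :: real) \<le> real (n ^ n)" by (rule fact_le_power)
  then have "ln (fact n) \<le> ln (real n ^ n)" using False by (intro ln_mono) auto
  then show ?thesis using False by (simp add: ln_realpow)
qed simp

text \<open>A telescoping comparison: the induction proves the stronger bound
  \<open>3 - (ln n + 2) / n\<close>, whose increments dominate the summands because
  \<open>(n + 1) * (ln (n + 1) - ln n) \<le> 2\<close>.\<close>

lemma sum_ln_over_pronic_le: "(\<Sum>k=2..n. ln (real k) / (real k * (real k - 1))) \<le> 3"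
proof -
  have "(\<Sum>k=2..n. ln (real k) / (real k * (real k - 1))) \<le> 3 - (ln (real n) + 2) / real n" if "n \<ge> 1"
    using that
  proof (induction n rule: nat_induct_at_least)
    case (Suc n)
    define a b where "a = ln (real n)" and "b = ln (real (Suc n))"
    have n: "real n \<ge> 1" using Suc by simp
    have ab: "b - a \<le> 1 / real n" using ln_Suc_diff_le[of n] Suc by (simp add: a_def b_def)
    have "real (Suc n) * (b - a) \<le> real (Suc n) * (1 / real n)"
      by (intro mult_left_mono ab) auto
    also have "\<dots> \<le> 2" using n by (simp add: field_simps)
    finally have h: "real (Suc n) * (b - a) \<le> 2" .
    have "b / (real (Suc n) * real n) \<le> (a + 2) / real n - (b + 2) / real (Suc n)"
    proof -
      have "(a + 2) / real n - (b + 2) / real (Suc n) - b / (real (Suc n) * real n)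
        = (2 - real (Suc n) * (b - a)) / (real (Suc n) * real n)"
        using n by (simp add: divide_simps) (simp add: algebra_simps)
      also have "\<dots> \<ge> 0" using h n by (intro divide_nonneg_nonneg) auto
      finally show ?thesis by simp
    qed
    moreover have "(\<Sum>k=2..Suc n. ln (real k) / (real k * (real k - 1)))
        = (\<Sum>k=2..n. ln (real k) / (real k * (real k - 1))) + b / (real (Suc n) * real n)"
      using Suc by (simp add: b_def)
    ultimately show ?case using Suc by (simp add: a_def b_def)
  qed simp
  note A = this
  show ?thesis
  proof (cases "n \<ge> 1")
    case True
    then have "(ln (real n) + 2) / real n \<ge> 0" by simp
    then show ?thesis using A[OF True] by linarith
  qed simp
qed

text \<open>Keep only the term \<open>n div p\<close> of Legendre's formula for
  \<open>ln (fact n)\<close>. Rounding it loses at most \<open>ln p\<close> per prime, in all at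
  most \<open>n * ln 4\<close> by Chebyshev's bound.\<close>

lemma mertens_first_upper:
  assumes "n \<ge> 1"
  shows "(\<Sum>p | prime p \<and> p \<le> n. ln (real p) / real p) \<le> ln (real n) + ln 4"
proof -
  have "real n * (\<Sum>p | prime p \<and> p \<le> n. ln (real p) / real p) - real n * ln 4
    \<le> (\<Sum>p | prime p \<and> p \<le> n. (real n / real p - 1) * ln (real p))"
    using sum_ln_primes_le[of n]
    by (simp add: sum_distrib_left algebra_simps sum_subtractf sum_divide_distrib)
  also have "\<dots> \<le> (\<Sum>p | prime p \<and> p \<le> n. real (multiplicity p (fact n :: nat)) * ln (real p))"
  proof (rule sum_mono)
    fix p assume "p \<in> {p. prime p \<and> p \<le> n}"
    then have p: "prime p" "p \<le> n" "p \<ge> 1" using prime_gt_0_nat[of p] by auto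
    have "n div p ^ 1 \<le> (\<Sum>k=1..n. n div p ^ k)" using assms by (intro member_le_sum) auto
    then have "n div p \<le> multiplicity p (fact n :: nat)" using p by (simp add: multiplicity_fact)
    moreover have "real n / real p - 1 \<le> real (n div p)" by (rule real_div_bounds)
    ultimately show "(real n / real p - 1) * ln (real p) \<le> real (multiplicity p (fact n :: nat)) * ln (real p)"
      using p by (intro mult_right_mono) auto
  qed
  also have "\<dots> = ln (fact n)" by (rule ln_fact_eq[symmetric])
  also have "\<dots> \<le> real n * ln (real n)" by (rule ln_fact_le)
  finally have "real n * (\<Sum>p | prime p \<and> p \<le> n. ln (real p) / real p) \<le> real n * (ln (real n) + ln 4)"
    by (simp add: algebra_simps)
  then show ?thesis using assms by simp
qed

text \<open>The geometric series bounds the multiplicity of \<open>p\<close> in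
  \<open>fact n\<close> by \<open>n / (p - 1) = n / p + n / (p * (p - 1))\<close>. The second parts
  contribute at most \<open>3 * n\<close>, and the crude Stirling bound loses another
  \<open>n\<close>; hence the 4.\<close>

lemma mertens_first_lower:
  assumes "n \<ge> 1"
  shows "ln (real n) - 4 \<le> (\<Sum>p | prime p \<and> p \<le> n. ln (real p) / real p)"
proof -
  have "real n * ln (real n) - real n \<le> ln (fact n)" by (rule ln_fact_ge)
  also have "\<dots> = (\<Sum>p | prime p \<and> p \<le> n. real (multiplicity p (fact n :: nat)) * ln (real p))"
    by (rule ln_fact_eq)
  also have "\<dots> \<le> (\<Sum>p | prime p \<and> p \<le> n. (real n / real p + real n / (real p * (real p - 1))) * ln (real p))"
  proof (rule sum_mono)
    fix p assume "p \<in> {p. prime p \<and> p \<le> n}"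
    then have p: "prime p" "p \<le> n" "p > 1" using prime_gt_1_nat[of p] by auto
    have "real (multiplicity p (fact n :: nat)) = (\<Sum>k=1..n. real (n div p ^ k))"
      using p by (simp add: multiplicity_fact)
    also have "\<dots> \<le> (\<Sum>k=1..n. real n * (1 / real p) ^ k)"
      by (intro sum_mono order.trans[OF real_div_bounds(2)]) (simp add: power_one_over field_simps)
    also have "\<dots> = real n * (\<Sum>k=1..n. (1 / real p) ^ k)" by (simp add: sum_distrib_left)
    also have "\<dots> \<le> real n * (1 / (real p - 1))"
    proof (rule mult_left_mono)
      define q where "q = 1 / real p"
      have q: "0 < q" "q < 1" using p by (auto simp: q_def)
      have "(\<Sum>k=1..n. q ^ k) * (1 - q) = q - q ^ Suc n"
      proof (induction n)
        case (Suc n)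
        have "(\<Sum>k=1..Suc n. q ^ k) * (1 - q) = (q - q ^ Suc n) + q ^ Suc n * (1 - q)"
          unfolding Suc[symmetric] by (simp add: distrib_right)
        also have "\<dots> = q - q ^ Suc (Suc n)" by (simp add: algebra_simps)
        finally show ?case .
      qed simp
      also have "\<dots> \<le> q" using q by simp
      finally have "(\<Sum>k=1..n. q ^ k) \<le> q / (1 - q)" using q by (simp add: pos_le_divide_eq)
      also have "q / (1 - q) = 1 / (real p - 1)" using p by (simp add: q_def field_simps)
      finally show "(\<Sum>k=1..n. (1 / real p) ^ k) \<le> 1 / (real p - 1)" by (simp only: q_def)
    qed simp
    also have "real n * (1 / (real p - 1)) = real n / real p + real n / (real p * (real p - 1))"
      using p by (simp add: field_simps)
    finally have "real (multiplicity p (fact n :: nat)) \<le> real n / real p + real n / (real p * (real p - 1))"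
      by simp
    then show "real (multiplicity p (fact n :: nat)) * ln (real p)
        \<le> (real n / real p + real n / (real p * (real p - 1))) * ln (real p)"
      using p by (intro mult_right_mono) auto
  qed
  also have "\<dots> = real n * (\<Sum>p | prime p \<and> p \<le> n. ln (real p) / real p)
      + real n * (\<Sum>p | prime p \<and> p \<le> n. ln (real p) / (real p * (real p - 1)))"
    by (simp add: sum_distrib_left sum.distrib algebra_simps)
  also have "real n * (\<Sum>p | prime p \<and> p \<le> n. ln (real p) / (real p * (real p - 1))) \<le> real n * 3"
  proof (rule mult_left_mono)
    have "(\<Sum>p | prime p \<and> p \<le> n. ln (real p) / (real p * (real p - 1)))
        \<le> (\<Sum>k=2..n. ln (real k) / (real k * (real k - 1)))"
      by (rule sum_mono2) (auto dest: prime_ge_2_nat)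
    also have "\<dots> \<le> 3" by (rule sum_ln_over_pronic_le)
    finally show "(\<Sum>p | prime p \<and> p \<le> n. ln (real p) / (real p * (real p - 1))) \<le> 3" .
  qed simp
  finally have "real n * (ln (real n) - 4) \<le> real n * (\<Sum>p | prime p \<and> p \<le> n. ln (real p) / real p)"
    using assms by (simp add: algebra_simps)
  then show ?thesis using assms by simp
qed

section \<open>Primes in an interval and Mertens' second theorem\<close>

definition primes_between :: "real \<Rightarrow> real \<Rightarrow> nat set" where
  "primes_between y x = {p. prime p \<and> y < real p \<and> real p \<le> x}"

lemma finite_primes_between [simp]: "finite (primes_between y x)"
  unfolding primes_between_def by (rule finite_subset[of _ "{..nat \<lfloor>x\<rfloor>}"]) (auto simp: le_nat_floor)

lemma mertens_first_between:
  assumes "1 \<le> y" "y \<le> x"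
  shows "\<bar>(\<Sum>p\<in>primes_between y x. ln (real p) / real p) - (ln x - ln y)\<bar> \<le> 7"
proof -
  define M where "M = (\<lambda>n::nat. \<Sum>p | prime p \<and> p \<le> n. ln (real p) / real p)"
  define F where "F = (\<lambda>t::real. nat \<lfloor>t\<rfloor>)"
  have ln4: "ln (4::real) \<le> 2"
  proof -
    have "ln (2 * 2 :: real) = ln 2 + ln 2" by (rule ln_mult_pos) auto
    then show ?thesis using ln_2_less_1 by simp
  qed
  \<comment> \<open>Rounding \<open>t\<close> down costs at most \<open>ln 2 \<le> 1\<close>, so the
    error lies between \<open>-5\<close> and \<open>2\<close>. The asymmetry makes the difference of
    two such errors at most 7.\<close>
  have bound: "\<bar>M (F t) - ln t\<bar> \<le> 5 \<and> M (F t) - ln t \<le> 2" if "t \<ge> 1" for t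
  proof -
    have F: "F t \<ge> 1" "real (F t) \<le> t" "t < real (F t) + 1"
      using that by (auto simp: F_def le_nat_floor)
    have "t \<le> 2 * real (F t)"
    proof -
      have "real (F t) \<ge> 1" using F(1) by simp
      then show ?thesis using F(3) by linarith
    qed
    then have "ln t \<le> ln (2 * real (F t))" using that by (intro ln_mono) linarith+
    also have "\<dots> \<le> 1 + ln (real (F t))" using F ln_2_less_1 by (simp add: ln_mult)
    finally have "ln t - 1 \<le> ln (real (F t))" by simp
    moreover have "ln (real (F t)) \<le> ln t" using F that by (intro ln_mono) auto
    ultimately show ?thesis
      using mertens_first_upper[OF F(1)] mertens_first_lower[OF F(1)] ln4 unfolding M_def by linarith
  qed
  have "{p. prime p \<and> p \<le> F x} = {p. prime p \<and> p \<le> F y} \<union> primes_between y x"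
  proof -
    have "p \<le> F t \<longleftrightarrow> real p \<le> t" if "t \<ge> 1" for t p
      using that unfolding F_def by (simp add: le_nat_iff le_floor_iff)
    then show ?thesis using assms by (auto simp: primes_between_def)
  qed
  moreover have "{p. prime p \<and> p \<le> F y} \<inter> primes_between y x = {}"
    using assms by (auto simp: primes_between_def F_def le_nat_iff le_floor_iff)
  ultimately have "M (F x) = M (F y) + (\<Sum>p\<in>primes_between y x. ln (real p) / real p)"
    unfolding M_def by (simp add: sum.union_disjoint)
  moreover have "x \<ge> 1" using assms by simp
  ultimately show ?thesis using bound[of x] bound[of y] assms by linarith
qed

text \<open>On this interval \<open>ln p\<close> exceeds \<open>ln y\<close>, so the first theorem
  can simply be divided by \<open>ln y\<close>. The result \<open>w - 1\<close> replaces the true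
  \<open>ln w\<close>, which is harmless for \<open>w\<close> close to 1.\<close>

lemma sum_inverse_primes_between_le:
  assumes "1 < y" "1 \<le> w"
  shows "(\<Sum>p\<in>primes_between y (y powr w). 1 / real p) \<le> (w - 1) + 7 / ln y"
proof -
  have "y powr 1 \<le> y powr w" using assms by (intro powr_mono) auto
  then have le: "y \<le> y powr w" using assms by simp
  have "ln y * (\<Sum>p\<in>primes_between y (y powr w). 1 / real p)
      \<le> (\<Sum>p\<in>primes_between y (y powr w). ln (real p) / real p)"
    unfolding sum_distrib_left
  proof (rule sum_mono)
    fix p assume "p \<in> primes_between y (y powr w)"
    then have "y < real p" by (simp add: primes_between_def)
    then show "ln y * (1 / real p) \<le> ln (real p) / real p"
      using assms by (simp add: divide_right_mono)
  qed
  also have "\<dots> \<le> ln (y powr w) - ln y + 7"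
    using mertens_first_between[of y "y powr w"] le assms by auto
  also have "\<dots> = ln y * ((w - 1) + 7 / ln y)" using assms by (simp add: ln_powr field_simps)
  finally show ?thesis using assms by simp
qed

lemma sum_inverse_primes_iterate:
  assumes "1 < y" "1 \<le> w"
  shows "(\<Sum>p\<in>primes_between y (y powr (w ^ K)). 1 / real p) \<le> real K * ((w - 1) + 7 / ln y)"
proof (induction K)
  case 0
  then show ?case using assms by (auto simp: primes_between_def intro!: sum_nonpos)
next
  case (Suc K)
  define s where "s = y powr (w ^ K)"
  have w1: "1 \<le> w ^ K" using assms by simp
  have "y powr 1 \<le> s" unfolding s_def using assms w1 by (intro powr_mono) auto
  then have s: "y \<le> s" using assms by simp
  have t: "y powr (w ^ Suc K) = s powr w" by (simp add: s_def powr_powr mult.commute)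
  have "primes_between y (s powr w) \<subseteq> primes_between y s \<union> primes_between s (s powr w)"
    by (auto simp: primes_between_def)
  then have "(\<Sum>p\<in>primes_between y (s powr w). 1 / real p)
      \<le> (\<Sum>p\<in>primes_between y s \<union> primes_between s (s powr w). 1 / real p)"
    by (intro sum_mono2) auto
  also have "\<dots> = (\<Sum>p\<in>primes_between y s. 1 / real p) + (\<Sum>p\<in>primes_between s (s powr w). 1 / real p)"
    by (rule sum.union_disjoint[OF finite_primes_between finite_primes_between]) (auto simp: primes_between_def)
  also have "(\<Sum>p\<in>primes_between s (s powr w). 1 / real p) \<le> (w - 1) + 7 / ln s"
    using s assms by (intro sum_inverse_primes_between_le) auto
  also have "7 / ln s \<le> 7 / ln y" using s assms by (intro divide_left_mono) auto
  finally have "(\<Sum>p\<in>primes_between y (s powr w). 1 / real p)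
      \<le> (\<Sum>p\<in>primes_between y s. 1 / real p) + ((w - 1) + 7 / ln y)" by simp
  also have "\<dots> \<le> real K * ((w - 1) + 7 / ln y) + ((w - 1) + 7 / ln y)"
    using Suc unfolding s_def by (rule add_right_mono)
  also have "\<dots> = real (Suc K) * ((w - 1) + 7 / ln y)" by (simp only: of_nat_Suc distrib_right) simp
  finally show ?case unfolding t .
qed

text \<open>In place of partial summation, the interval is cut at \<open>y powr (w ^ j)\<close> with
  \<open>w = u powr (1 / K)\<close>; the crude bounds add up to \<open>K * (w - 1)\<close>, which
  tends to \<open>ln u\<close>. \<open>K\<close> is large enough that \<open>exp (a / K)\<close> is
  within its quadratic bound and the excess \<open>a\<^sup>2 / K\<close> is at most
  \<open>\<rho> / 2\<close>; then \<open>Y\<close> makes the \<open>K\<close> errors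
  \<open>7 / ln y\<close> together at most \<open>\<rho> / 2\<close>.\<close>

lemma mertens_second_upper:
  assumes "u \<ge> 1" "\<rho> > 0"
  obtains Y where "Y > 1" "\<And>y. y \<ge> Y \<Longrightarrow> (\<Sum>p\<in>primes_between y (y powr u). 1 / real p) \<le> ln u + \<rho>"
proof -
  define a where "a = ln u"
  have a: "a \<ge> 0" using assms by (simp add: a_def)
  obtain K where K: "K > 0" "real K \<ge> a" "real K \<ge> 2 * a\<^sup>2 / \<rho>"
  proof -
    obtain K :: nat where "real K > max 0 (max a (2 * a\<^sup>2 / \<rho>))" using reals_Archimedean2 by blast
    then show ?thesis by (intro that[of K]) auto
  qed
  define w where "w = exp (a / real K)"
  have w1: "w \<ge> 1" using a by (simp add: w_def)
  have wK: "w ^ K = u" using K assms by (simp add: w_def a_def flip: exp_of_nat_mult)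
  have "w \<le> 1 + a / real K + (a / real K)\<^sup>2" unfolding w_def using a K by (intro exp_bound) auto
  then have "real K * (w - 1) \<le> real K * (a / real K + (a / real K)\<^sup>2)" by (intro mult_left_mono) auto
  also have "\<dots> = a + a\<^sup>2 / real K" using K by (simp add: field_simps power2_eq_square)
  also have "a\<^sup>2 / real K \<le> \<rho> / 2" using K assms by (simp add: field_simps)
  finally have Kw: "real K * (w - 1) \<le> a + \<rho> / 2" by simp
  define Y where "Y = exp (14 * real K / \<rho>)"
  show ?thesis
  proof
    show "Y > 1" using K assms by (simp add: Y_def)
    fix y assume y: "y \<ge> Y"
    have "0 < Y" by (simp add: Y_def)
    then have "ln Y \<le> ln y" using y by (intro ln_mono) auto
    then have ly: "14 * real K / \<rho> \<le> ln y" by (simp add: Y_def)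
    then have "real K * (7 / ln y) \<le> \<rho> / 2"
    proof -
      have "0 < ln y" using ly K assms by (smt (verit) divide_pos_pos mult_pos_pos of_nat_0_less_iff)
      then show ?thesis using ly assms by (simp add: field_simps)
    qed
    moreover have "(\<Sum>p\<in>primes_between y (y powr u). 1 / real p) \<le> real K * ((w - 1) + 7 / ln y)"
      using sum_inverse_primes_iterate[of y w K] w1 wK y \<open>Y > 1\<close> by simp
    ultimately show "(\<Sum>p\<in>primes_between y (y powr u). 1 / real p) \<le> ln u + \<rho>"
      using Kw unfolding distrib_left a_def by linarith
  qed
qed

text \<open>The sum of \<open>ln p / p\<close> over the interval is at least
  \<open>\<eta> * ln x - 7\<close>, and no term exceeds \<open>ln x\<close> divided by the left end.
  The loss of \<open>x powr \<eta>\<close> is affordable where these primes serve as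
  multipliers.\<close>

lemma card_primes_between_ge:
  assumes \<eta>: "0 < \<eta>" "\<eta> < 1" and x: "ln x \<ge> 14 / \<eta>" "x > 1"
  shows "\<eta> / 2 * x powr (1 - \<eta>) \<le> real (card (primes_between (x powr (1 - \<eta>)) x))"
proof -
  define s where "s = x powr (1 - \<eta>)"
  have s: "1 \<le> s" "s \<le> x"
    using \<eta> x powr_mono[of "1 - \<eta>" 1 x] by (auto simp: s_def ge_one_powr_ge_zero)
  have lnx: "ln x > 0" using x by simp
  have "\<eta> * ln x - 7 = ln x - ln s - 7" using x by (simp add: s_def ln_powr algebra_simps)
  also have "\<dots> \<le> (\<Sum>p\<in>primes_between s x. ln (real p) / real p)"
    using mertens_first_between[OF s] by linarith
  also have "\<dots> \<le> (\<Sum>p\<in>primes_between s x. ln x / s)"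
    using s by (intro sum_mono frac_le) (auto simp: primes_between_def)
  also have "\<dots> = real (card (primes_between s x)) * (ln x / s)" by simp
  finally have "\<eta> * ln x - 7 \<le> real (card (primes_between s x)) * (ln x / s)" .
  moreover have "\<eta> / 2 * ln x \<le> \<eta> * ln x - 7" using x \<eta> by (simp add: field_simps)
  ultimately have "\<eta> / 2 * ln x \<le> real (card (primes_between s x)) * (ln x / s)" by linarith
  then have "\<eta> / 2 * s * ln x \<le> real (card (primes_between s x)) * ln x"
    using s by (simp add: field_simps)
  then show ?thesis using lnx by (simp add: s_def)
qed

section \<open>Moments of short character sums\<close>

lemma periodic_mod:
  fixes f :: "nat \<Rightarrow> 'a"
  assumes "\<And>x. f (x + q) = f x"
  shows "f (x mod q) = f x"
proof -
  have "f (y + k * q) = f y" for y k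
  proof (induction k)
    case (Suc k)
    have "y + Suc k * q = (y + k * q) + q" by simp
    then show ?case using assms Suc by presburger
  qed simp
  from this[of "x mod q" "x div q"] show ?thesis by simp
qed

lemma periodic_cong:
  fixes f :: "nat \<Rightarrow> 'a"
  assumes "\<And>x. f (x + q) = f x" "[x = y] (mod q)"
  shows "f x = f y"
  using assms(2) periodic_mod[of f q, OF assms(1)] unfolding cong_def by metis

lemma sum_crt:
  fixes f g :: "nat \<Rightarrow> real"
  assumes cop: "coprime a b" and pos: "a > 0" "b > 0"
    and f: "\<And>x. f (x + a) = f x" and g: "\<And>x. g (x + b) = g x"
  shows "(\<Sum>x<a*b. f x * g x) = (\<Sum>x<a. f x) * (\<Sum>x<b. g x)"
proof -
  define h where "h = (\<lambda>x::nat. (x mod a, x mod b))"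
  have inj: "inj_on h {..<a*b}"
  proof (rule inj_onI)
    fix x y assume xy: "x \<in> {..<a*b}" "y \<in> {..<a*b}" "h x = h y"
    then have "[x = y] (mod a)" "[x = y] (mod b)" by (auto simp: h_def cong_def)
    then have "[x = y] (mod a * b)" using cop coprime_cong_mult_nat by blast
    then show "x = y" using xy by (simp add: cong_def)
  qed
  have "h ` {..<a*b} = {..<a} \<times> {..<b}"
  proof (rule card_subset_eq)
    show "h ` {..<a*b} \<subseteq> {..<a} \<times> {..<b}" using pos by (auto simp: h_def)
    show "card (h ` {..<a*b}) = card ({..<a} \<times> {..<b})" using inj by (simp add: card_image)
  qed simp
  then have bij: "bij_betw h {..<a*b} ({..<a} \<times> {..<b})" using inj by (simp add: bij_betw_def)
  have "(\<Sum>x<a*b. f x * g x) = (\<Sum>x<a*b. case h x of (u, v) \<Rightarrow> f u * g v)"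
    using periodic_mod[of f a, OF f] periodic_mod[of g b, OF g] by (simp add: h_def)
  also have "\<dots> = (\<Sum>(u, v)\<in>{..<a} \<times> {..<b}. f u * g v)"
    by (rule sum.reindex_bij_betw[OF bij])
  also have "\<dots> = (\<Sum>x<a. f x) * (\<Sum>x<b. g x)"
    by (simp add: sum_product sum.cartesian_product)
  finally show ?thesis .
qed

lemma sum_crt_prod:
  fixes h :: "nat \<Rightarrow> real" and f :: "nat \<Rightarrow> nat \<Rightarrow> real"
  assumes "finite P" "t > 0" "\<And>p. p \<in> P \<Longrightarrow> prime p" "\<And>p. p \<in> P \<Longrightarrow> coprime t p"
    and h: "\<And>x. h (x + t) = h x" and f: "\<And>p x. p \<in> P \<Longrightarrow> f p (x + p) = f p x"
  shows "(\<Sum>x<t * \<Prod>P. h x * (\<Prod>p\<in>P. f p x)) = (\<Sum>x<t. h x) * (\<Prod>p\<in>P. \<Sum>x<p. f p x)"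
  using assms(1,3,4,6)
proof (induction P)
  case (insert p P)
  have cop: "coprime (t * \<Prod>P) p"
  proof -
    have "coprime (\<Prod>P) p"
      using insert by (intro prod_coprime_left) (metis insertCI primes_coprime)
    then show ?thesis using insert.prems(2)[of p] by simp
  qed
  have pos: "t * \<Prod>P > 0" "p > 0"
    using assms(2) insert prime_gt_0_nat by (auto intro!: prod_pos)
  define H where "H = (\<lambda>x. h x * (\<Prod>p\<in>P. f p x))"
  have H: "H (x + t * \<Prod>P) = H x" for x
  proof -
    have "h (x + t * \<Prod>P) = h x" by (rule periodic_cong[of h t, OF h]) (simp add: cong_def)
    moreover have "f r (x + t * \<Prod>P) = f r x" if r: "r \<in> P" for r
    proof (rule periodic_cong[of "f r" r])
      have "r dvd t * \<Prod>P" using r insert.hyps by (intro dvd_mult dvd_prodI)  auto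
      then show "[x + t * \<Prod>P = x] (mod r)" by (auto simp: cong_def elim!: dvdE)
    qed (use insert.prems r in simp)
    ultimately show ?thesis by (simp add: H_def)
  qed
  have "(\<Sum>x<t * \<Prod>(insert p P). h x * (\<Prod>p\<in>insert p P. f p x)) = (\<Sum>x<(t * \<Prod>P) * p. H x * f p x)"
    using insert.hyps by (simp add: H_def algebra_simps)
  also have "\<dots> = (\<Sum>x<t * \<Prod>P. H x) * (\<Sum>x<p. f p x)"
    using insert.prems by (intro sum_crt cop pos H) auto
  also have "(\<Sum>x<t * \<Prod>P. H x) = (\<Sum>x<t. h x) * (\<Prod>p\<in>P. \<Sum>x<p. f p x)"
    unfolding H_def using insert.prems by (intro insert.IH) auto
  finally show ?case using insert.hyps by (simp add: algebra_simps)
qed simp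

text \<open>For a finite set of primes this is the gcd of \<open>k\<close> and
  \<open>\<Prod>P\<close>. It records the primes at which square-root cancellation may fail.\<close>

definition gcd_weight :: "nat set \<Rightarrow> nat \<Rightarrow> real" where
  "gcd_weight P k = (\<Prod>p\<in>P. if p dvd k then real p else 1)"

lemma gcd_weight_nonneg: "gcd_weight P k \<ge> 0"
  by (auto simp: gcd_weight_def intro!: prod_nonneg)

text \<open>The weight is one of the terms of the sum of \<open>\<Prod>D\<close> over all
  \<open>D \<subseteq> P\<close> with \<open>\<Prod>D dvd k\<close>. After exchanging the sums, each
  of the \<open>2 ^ card P\<close> subsets contributes at most \<open>B\<close>, since
  \<open>k\<close> meets \<open>B div \<Prod>D\<close> multiples.\<close>

lemma sum_gcd_weight_le:
  assumes fin: "finite P" and P: "\<And>p. p \<in> P \<Longrightarrow> prime p"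
  shows "(\<Sum>k=1..B. gcd_weight P k) \<le> 2 ^ card P * real B"
proof -
  have dpos: "\<Prod>D > 0" if "D \<subseteq> P" for D
    using that P prime_gt_0_nat by (auto intro!: prod_pos)
  have "gcd_weight P k \<le> (\<Sum>D\<in>Pow P. if \<Prod>D dvd k then real (\<Prod>D) else 0)" for k
  proof -
    define D where "D = {p \<in> P. p dvd k}"
    have "finite D" using fin by (simp add: D_def)
    then have "\<Prod>D dvd k" using P by (intro prod_primes_dvd_if_all_dvd) (auto simp: D_def)
    have "gcd_weight P k = real (\<Prod>D)"
      unfolding gcd_weight_def D_def using fin by (simp add: prod.inter_filter) (auto intro!: prod.cong)
    also have "\<dots> = (if \<Prod>D dvd k then real (\<Prod>D) else 0)" using \<open>\<Prod>D dvd k\<close> by simp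
    also have "\<dots> \<le> (\<Sum>D\<in>Pow P. if \<Prod>D dvd k then real (\<Prod>D) else 0)"
    proof (rule member_le_sum[where f = "\<lambda>D. if \<Prod>D dvd k then real (\<Prod>D) else 0"])
      show "D \<in> Pow P" by (auto simp: D_def)
    qed (use fin in \<open>auto simp del: of_nat_prod\<close>)
    finally show ?thesis .
  qed
  then have "(\<Sum>k=1..B. gcd_weight P k) \<le> (\<Sum>k=1..B. \<Sum>D\<in>Pow P. if \<Prod>D dvd k then real (\<Prod>D) else 0)"
    by (rule sum_mono)
  also have "\<dots> = (\<Sum>D\<in>Pow P. \<Sum>k=1..B. if \<Prod>D dvd k then real (\<Prod>D) else 0)"
    by (rule sum.swap)
  also have "\<dots> \<le> (\<Sum>D\<in>Pow P. real B)"
  proof (rule sum_mono)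
    fix D assume D: "D \<in> Pow P"
    define d where "d = \<Prod>D"
    have d: "d > 0" using dpos[of D] D by (simp add: d_def)
    have "(\<Sum>k=1..B. if d dvd k then real d else 0) = (\<Sum>k\<in>{k\<in>{1..B}. d dvd k}. real d)"
      by (rule sum.inter_filter[symmetric]) simp
    also have "\<dots> = real (card {k\<in>{1..B}. d dvd k}) * real d" by simp
    also have "\<dots> = real (B div d * d)" by (simp only: card_multiples[OF d] of_nat_mult)
    also have "\<dots> \<le> real B" by (intro of_nat_mono div_times_less_eq_dividend)
    finally show "(\<Sum>k=1..B. if \<Prod>D dvd k then real (\<Prod>D) else 0) \<le> real B"
      by (simp only: d_def)
  qed
  also have "\<dots> = 2 ^ card P * real B" using fin by (simp add: card_Pow)
  finally show ?thesis .
qed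

lemma sum_gcd_weight_diff_le:
  assumes fin: "finite P" and P: "\<And>p. p \<in> P \<Longrightarrow> prime p" and c: "c \<in> {1..B}"
  shows "(\<Sum>b\<in>{1..B}-{c}. gcd_weight P (nat \<bar>int c - int b\<bar>)) \<le> 2 * 2 ^ card P * real B"
proof -
  have abs1: "nat \<bar>int c - int b\<bar> = c - b" if "b < c" for b using that by linarith
  have abs2: "nat \<bar>int c - int b\<bar> = b - c" if "c < b" for b using that by linarith
  have "(\<Sum>b\<in>{1..B}-{c}. gcd_weight P (nat \<bar>int c - int b\<bar>))
    = (\<Sum>b\<in>{1..<c}. gcd_weight P (nat \<bar>int c - int b\<bar>)) + (\<Sum>b\<in>{c<..B}. gcd_weight P (nat \<bar>int c - int b\<bar>))"
  proof -
    have "{1..B}-{c} = {1..<c} \<union> {c<..B}" using c by auto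
    then have "(\<Sum>b\<in>{1..B}-{c}. gcd_weight P (nat \<bar>int c - int b\<bar>))
      = (\<Sum>b\<in>{1..<c} \<union> {c<..B}. gcd_weight P (nat \<bar>int c - int b\<bar>))" by (rule arg_cong)
    also have "\<dots> = (\<Sum>b\<in>{1..<c}. gcd_weight P (nat \<bar>int c - int b\<bar>)) + (\<Sum>b\<in>{c<..B}. gcd_weight P (nat \<bar>int c - int b\<bar>))"
      by (rule sum.union_disjoint) auto
    finally show ?thesis .
  qed
  also have "(\<Sum>b\<in>{1..<c}. gcd_weight P (nat \<bar>int c - int b\<bar>)) = (\<Sum>k\<in>{1..<c}. gcd_weight P k)"
    by (rule sum.reindex_bij_witness[of _ "\<lambda>k. c - k" "\<lambda>b. c - b"]) (auto simp: abs1 simp flip: of_nat_diff)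
  also have "\<dots> \<le> (\<Sum>k=1..B. gcd_weight P k)"
    using c by (intro sum_mono2) (auto simp: gcd_weight_nonneg)
  also have "(\<Sum>b\<in>{c<..B}. gcd_weight P (nat \<bar>int c - int b\<bar>)) = (\<Sum>k\<in>{1..B-c}. gcd_weight P k)"
    by (rule sum.reindex_bij_witness[of _ "\<lambda>k. c + k" "\<lambda>b. b - c"]) (auto simp: abs2 simp flip: of_nat_diff)
  also have "\<dots> \<le> (\<Sum>k=1..B. gcd_weight P k)"
    using c by (intro sum_mono2) (auto simp: gcd_weight_nonneg)
  finally show ?thesis using sum_gcd_weight_le[OF fin P, of B] by (simp add: algebra_simps)
qed

text \<open>If no value occurs exactly once, at most \<open>r\<close> values occur. Such a tuple is
  a list of \<open>r\<close> values composed with a map from positions to list entries.\<close>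

lemma card_tuples_few_values:
  assumes r: "r > 0" and fin: "finite S"
  shows "card {f \<in> {..<2*r} \<rightarrow>\<^sub>E S. \<forall>i<2*r. \<exists>j<2*r. j \<noteq> i \<and> f j = f i} \<le> card S ^ r * r ^ (2*r)"
proof -
  define I where "I = {..<2*r}"
  define X where "X = {f \<in> I \<rightarrow>\<^sub>E S. \<forall>i<2*r. \<exists>j<2*r. j \<noteq> i \<and> f j = f i}"
  define Y where "Y = ({..<r} \<rightarrow>\<^sub>E S) \<times> (I \<rightarrow>\<^sub>E {..<r})"
  have "X \<subseteq> (\<lambda>(e, g). \<lambda>i\<in>I. e (g i)) ` Y"
  proof
    fix f assume f: "f \<in> X"
    define V where "V = f ` I"
    have finV: "finite V" by (simp add: V_def I_def)
    have VS: "V \<subseteq> S" using f by (auto simp: V_def X_def)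
    have "2 * card V = (\<Sum>v\<in>V. 2)" by simp
    also have "\<dots> \<le> (\<Sum>v\<in>V. card {i\<in>I. f i = v})"
    proof (rule sum_mono)
      fix v assume "v \<in> V"
      then obtain i where i: "i < 2*r" "v = f i" by (auto simp: V_def I_def)
      then obtain j where j: "j < 2*r" "j \<noteq> i" "f j = f i" using f by (auto simp: X_def)
      have "card {i, j} \<le> card {i\<in>I. f i = v}" using i j by (intro card_mono) (auto simp: I_def)
      then show "2 \<le> card {i\<in>I. f i = v}" using j by simp
    qed
    also have "\<dots> = (\<Sum>i\<in>I. 1)"
      unfolding V_def by (subst sum.image_gen[of I "\<lambda>_. 1" f]) (auto simp: I_def)
    finally have cV: "card V \<le> r" by (simp add: I_def)
    have "0 \<in> I" using r by (simp add: I_def)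
    then have f0: "f 0 \<in> S" using VS by (auto simp: V_def)
    obtain e0 where e0: "bij_betw e0 {0..<card V} V" using ex_bij_betw_nat_finite[OF finV] by blast
    \<comment> \<open>When fewer than \<open>r\<close> values occur, the list is padded with
      \<open>f 0\<close>, so that it always has length \<open>r\<close>.\<close>
    define e where "e = (\<lambda>k\<in>{..<r}. if k < card V then e0 k else f 0)"
    have e: "e \<in> {..<r} \<rightarrow>\<^sub>E S"
    proof -
      have "e0 k \<in> S" if "k < card V" for k using bij_betwE[OF e0] VS that by auto
      then show ?thesis using f0 by (auto simp: e_def)
    qed
    have "\<exists>k<r. e k = f i" if "i \<in> I" for i
    proof -
      have "f i \<in> e0 ` {0..<card V}" using e0 that by (auto simp: bij_betw_def V_def)
      then obtain k where "k < card V" "f i = e0 k" by auto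
      then show ?thesis using cV by (intro exI[of _ k]) (auto simp: e_def)
    qed
    then obtain g where g: "\<And>i. i \<in> I \<Longrightarrow> g i < r \<and> e (g i) = f i" by metis
    show "f \<in> (\<lambda>(e, g). \<lambda>i\<in>I. e (g i)) ` Y"
    proof (rule image_eqI[of _ _ "(e, \<lambda>i\<in>I. g i)"])
      show "f = (case (e, \<lambda>i\<in>I. g i) of (e, g) \<Rightarrow> \<lambda>i\<in>I. e (g i))"
        using f g by (auto simp: X_def fun_eq_iff PiE_def extensional_def)
      show "(e, \<lambda>i\<in>I. g i) \<in> Y" using e g by (auto simp: Y_def)
    qed
  qed
  moreover have "finite Y" using fin by (auto simp: Y_def I_def intro!: finite_PiE)
  ultimately have "card X \<le> card Y" by (rule surj_card_le[rotated])
  also have "card Y = card S ^ r * r ^ (2*r)"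
    by (simp add: Y_def I_def card_cartesian_product card_PiE)
  finally show ?thesis by (simp only: X_def I_def)
qed

lemma sum_UN_le:
  fixes f :: "'a \<Rightarrow> real"
  assumes "finite I" "\<And>i. i \<in> I \<Longrightarrow> finite (A i)" "\<And>x. f x \<ge> 0"
  shows "(\<Sum>x\<in>(\<Union>i\<in>I. A i). f x) \<le> (\<Sum>i\<in>I. \<Sum>x\<in>A i. f x)"
  using assms(1,2)
proof (induction I)
  case (insert i I)
  have "(\<Sum>x\<in>(\<Union>i\<in>insert i I. A i). f x)
      = sum f (A i) + sum f (\<Union>i\<in>I. A i) - sum f (A i \<inter> (\<Union>i\<in>I. A i))"
    using insert by (simp add: sum_Un)
  also have "\<dots> \<le> sum f (A i) + sum f (\<Union>i\<in>I. A i)"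
    using assms(3) by (simp add: sum_nonneg)
  also have "\<dots> \<le> sum f (A i) + (\<Sum>i\<in>I. \<Sum>x\<in>A i. f x)"
    using insert by simp
  finally show ?case using insert.hyps by simp
qed simp

text \<open>The shape of a real character after removing repeated prime factors:
  \<open>\<kappa>\<close> is the part at 2 and the primes in \<open>P\<close> contribute Legendre
  symbols. Distinct odd primes make complete sums factor into sums to prime moduli. The factor 8
  stays in the modulus even if \<open>\<kappa>\<close> has a smaller period.\<close>

locale quadratic_symbol =
  fixes \<kappa> :: "nat \<Rightarrow> real" and P :: "nat set"
  assumes finite_P: "finite P" and prime_P: "\<And>p. p \<in> P \<Longrightarrow> prime p" and odd_P: "\<And>p. p \<in> P \<Longrightarrow> odd p"
    and \<kappa>_periodic: "\<And>x. \<kappa> (x + 8) = \<kappa> x" and \<kappa>_mult: "\<And>x y. \<kappa> (x * y) = \<kappa> x * \<kappa> y"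
    and \<kappa>_values: "\<And>x. \<kappa> x \<in> {-1, 0, 1}"
begin

definition \<psi> :: "nat \<Rightarrow> real" where
  "\<psi> x = \<kappa> x * (\<Prod>p\<in>P. real_of_int (Legendre (int x) (int p)))"

definition modulus :: nat where
  "modulus = 8 * \<Prod>P"

lemma prod_P_pos: "\<Prod>P > 0"
  using prime_P prime_gt_0_nat by (auto intro!: prod_pos)

lemma \<psi>_mult: "\<psi> (x * y) = \<psi> x * \<psi> y"
proof -
  have "Legendre (int (x * y)) (int p) = Legendre (int x) (int p) * Legendre (int y) (int p)" if "p \<in> P" for p
    using Legendre_mult[OF prime_P odd_P, OF that that] by simp
  then have "(\<Prod>p\<in>P. real_of_int (Legendre (int (x * y)) (int p)))
      = (\<Prod>p\<in>P. real_of_int (Legendre (int x) (int p)) * real_of_int (Legendre (int y) (int p)))"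
    by (intro prod.cong) auto
  then show ?thesis by (simp add: \<psi>_def \<kappa>_mult prod.distrib)
qed

lemma abs_\<psi>_le_1: "\<bar>\<psi> x\<bar> \<le> 1"
proof -
  have "(\<Prod>p\<in>P. \<bar>real_of_int (Legendre (int x) (int p))\<bar>) \<le> (\<Prod>p\<in>P. 1)"
    by (intro prod_mono) (auto simp: Legendre_def)
  moreover have "\<bar>\<kappa> x\<bar> \<le> 1" using \<kappa>_values[of x] by auto
  ultimately show ?thesis by (simp add: \<psi>_def abs_mult abs_prod mult_le_one prod_nonneg)
qed

lemma Legendre_periodic: "Legendre (int (x + p)) (int p) = Legendre (int x) (int p)"
  by (rule Legendre_cong) (simp add: cong_iff_dvd_diff)

lemma \<psi>_periodic: "\<psi> (x + modulus) = \<psi> x"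
proof -
  have "\<kappa> (x + modulus) = \<kappa> x"
    by (rule periodic_cong[of \<kappa> 8, OF \<kappa>_periodic]) (simp add: cong_def modulus_def)
  moreover have "Legendre (int (x + modulus)) (int p) = Legendre (int x) (int p)" if p: "p \<in> P" for p
  proof (rule periodic_cong[of "\<lambda>x. Legendre (int x) (int p)" p, OF Legendre_periodic])
    have "p dvd modulus" unfolding modulus_def using p finite_P by (intro dvd_mult dvd_prodI) auto
    then show "[x + modulus = x] (mod p)" by (auto simp: cong_def elim!: dvdE)
  qed
  ultimately show ?thesis by (simp add: \<psi>_def)
qed

lemma \<psi>_prod:
  fixes m :: nat
  shows "(\<Prod>j<m. \<psi> (g j)) = (\<Prod>j<m. \<kappa> (g j)) * (\<Prod>p\<in>P. real_of_int (Legendre (int (\<Prod>j<m. g j)) (int p)))"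
proof (induction m)
  case 0
  have "Legendre 1 (int p) = 1" if "p \<in> P" for p
  proof -
    have "\<not> [1 = 0] (mod int p)" using prime_P[OF that] by (auto simp: cong_0_iff not_prime_unit)
    moreover have "QuadRes (int p) 1" unfolding QuadRes_def by (rule exI[of _ 1]) simp
    ultimately show ?thesis by (simp add: Legendre_def)
  qed
  then show ?case by simp
next
  case (Suc m)
  have "Legendre (int (\<Prod>j<Suc m. g j)) (int p) = Legendre (int (\<Prod>j<m. g j)) (int p) * Legendre (int (g m)) (int p)"
    if "p \<in> P" for p
    using Legendre_mult[OF prime_P odd_P, OF that that] by simp
  then have "(\<Prod>p\<in>P. real_of_int (Legendre (int (\<Prod>j<Suc m. g j)) (int p)))
      = (\<Prod>p\<in>P. real_of_int (Legendre (int (\<Prod>j<m. g j)) (int p)) * real_of_int (Legendre (int (g m)) (int p)))"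
    by (intro prod.cong) auto
  then show ?case unfolding prod.lessThan_Suc Suc.IH by (simp add: \<psi>_def prod.distrib)
qed

lemma complete_sum_le:
  fixes m :: nat and b :: "nat \<Rightarrow> nat"
  shows "\<bar>\<Sum>x<modulus. \<Prod>j<m. \<psi> (x + b j)\<bar>
    \<le> 8 * (\<Prod>p\<in>P. \<bar>real_of_int (\<Sum>x<p. Legendre (int (\<Prod>j<m. x + b j)) (int p))\<bar>)"
proof -
  have "(\<Sum>x<modulus. \<Prod>j<m. \<psi> (x + b j))
    = (\<Sum>x<8 * \<Prod>P. (\<Prod>j<m. \<kappa> (x + b j)) * (\<Prod>p\<in>P. real_of_int (Legendre (int (\<Prod>j<m. x + b j)) (int p))))"
    unfolding modulus_def by (intro sum.cong refl \<psi>_prod)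
  also have "\<dots> = (\<Sum>x<8. \<Prod>j<m. \<kappa> (x + b j)) * (\<Prod>p\<in>P. \<Sum>x<p. real_of_int (Legendre (int (\<Prod>j<m. x + b j)) (int p)))"
  proof (rule sum_crt_prod)
    show "coprime 8 p" if "p \<in> P" for p
    proof -
      have "coprime (2 ^ 3) p" using odd_P[OF that] by (simp only: coprime_power_left_iff) simp
      then show ?thesis by simp
    qed
    show "(\<Prod>j<m. \<kappa> (x + 8 + b j)) = (\<Prod>j<m. \<kappa> (x + b j))" for x
      using \<kappa>_periodic by (intro prod.cong refl) (metis add.assoc add.commute)
    show "real_of_int (Legendre (int (\<Prod>j<m. x + p + b j)) (int p)) = real_of_int (Legendre (int (\<Prod>j<m. x + b j)) (int p))" for p x
      unfolding of_int_eq_iff of_nat_prod by (intro Legendre_cong cong_prod) (simp add: cong_iff_dvd_diff)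
  qed (use finite_P prime_P in auto)
  finally have "\<bar>\<Sum>x<modulus. \<Prod>j<m. \<psi> (x + b j)\<bar> = \<bar>\<Sum>x<8. \<Prod>j<m. \<kappa> (x + b j)\<bar> *
      (\<Prod>p\<in>P. \<bar>real_of_int (\<Sum>x<p. Legendre (int (\<Prod>j<m. x + b j)) (int p))\<bar>)"
    by (simp add: abs_mult abs_prod)
  also have "\<dots> \<le> 8 * (\<Prod>p\<in>P. \<bar>real_of_int (\<Sum>x<p. Legendre (int (\<Prod>j<m. x + b j)) (int p))\<bar>)"
  proof (rule mult_right_mono)
    have "\<bar>\<Prod>j<m. \<kappa> (x + b j)\<bar> \<le> 1" for x
    proof -
      have "\<bar>\<kappa> y\<bar> \<le> 1" for y using \<kappa>_values[of y] by auto
      then have "(\<Prod>j<m. \<bar>\<kappa> (x + b j)\<bar>) \<le> (\<Prod>j<m. 1)" by (intro prod_mono) auto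
      then show ?thesis by (simp add: abs_prod)
    qed
    then have "(\<Sum>x<8. \<bar>\<Prod>j<m. \<kappa> (x + b j)\<bar>) \<le> (\<Sum>x<(8::nat). 1)" by (intro sum_mono)
    then show "\<bar>\<Sum>x<8. \<Prod>j<m. \<kappa> (x + b j)\<bar> \<le> 8"
      by (intro order.trans[OF sum_abs]) simp
  qed (auto intro: prod_nonneg)
  finally show ?thesis .
qed

text \<open>If \<open>p\<close> divides none of the differences \<open>b i - b j\<close>, the root
  \<open>- b i\<close> is simple modulo \<open>p\<close> and the local sum has square-root size.
  Otherwise the trivial bound \<open>p\<close> is used and absorbed by the weight of an offending
  \<open>j\<close>.\<close>

lemma complete_sum_unique_le:
  assumes i: "i < m"
  shows "\<bar>\<Sum>x<modulus. \<Prod>j<m. \<psi> (x + b j)\<bar>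
    \<le> 8 * (13 * real m + 10) ^ card P * sqrt (real (\<Prod>P)) * (\<Prod>j\<in>{..<m}-{i}. gcd_weight P (nat \<bar>int (b i) - int (b j)\<bar>))"
proof -
  define K where "K = 13 * real m + 10"
  define w where "w = (\<lambda>p j. if p dvd nat \<bar>int (b i) - int (b j)\<bar> then real p else 1)"
  have local_bound: "\<bar>real_of_int (\<Sum>x<p. Legendre (int (\<Prod>j<m. x + b j)) (int p))\<bar>
      \<le> K * sqrt (real p) * (\<Prod>j\<in>{..<m}-{i}. w p j)" if p: "p \<in> P" for p
  proof -
    have p1: "real p \<ge> 1" using prime_P[OF p] prime_gt_0_nat by (simp add: Suc_le_eq)
    have w1: "w p j \<ge> 1" for j using p1 by (simp add: w_def)
    have Ks: "K * sqrt (real p) \<ge> 1"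
      using mult_mono[of 1 K 1 "sqrt (real p)"] p1 by (simp add: K_def)
    show ?thesis
    proof (cases "\<exists>j\<in>{..<m}-{i}. int p dvd int (b i) - int (b j)")
      case True
      then obtain j where j: "j \<in> {..<m}-{i}" "int p dvd int (b i) - int (b j)" by blast
      have "p dvd nat \<bar>int (b i) - int (b j)\<bar>" using j(2) by (simp flip: int_dvd_int_iff)
      then have "w p j = real p" by (simp add: w_def)
      moreover have "w p j * 1 \<le> w p j * (\<Prod>j\<in>{..<m}-{i}-{j}. w p j)"
        using w1 p1 by (intro mult_left_mono prod_ge_1) (auto simp: w_def)
      ultimately have "real p \<le> (\<Prod>j\<in>{..<m}-{i}. w p j)"
        using j(1) by (subst prod.remove[of _ j]) auto
      moreover have "\<bar>real_of_int (\<Sum>x<p. Legendre (int (\<Prod>j<m. x + b j)) (int p))\<bar> \<le> (\<Sum>x<p. 1)"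
        unfolding of_int_sum by (intro order.trans[OF sum_abs] sum_mono) (auto simp: Legendre_def)
      ultimately have "\<bar>real_of_int (\<Sum>x<p. Legendre (int (\<Prod>j<m. x + b j)) (int p))\<bar> \<le> 1 * (\<Prod>j\<in>{..<m}-{i}. w p j)"
        by simp
      also have "\<dots> \<le> K * sqrt (real p) * (\<Prod>j\<in>{..<m}-{i}. w p j)"
        using Ks by (intro mult_right_mono prod_nonneg) (auto simp: w_def)
      finally show ?thesis .
    next
      case False
      then have "\<bar>real_of_int (\<Sum>x<p. Legendre (int (\<Prod>j<m. x + b j)) (int p))\<bar> \<le> K * sqrt (real p)"
        unfolding K_def using i by (intro weil_bound prime_P odd_P p) auto
      also have "\<dots> = K * sqrt (real p) * 1" by simp
      also have "\<dots> \<le> K * sqrt (real p) * (\<Prod>j\<in>{..<m}-{i}. w p j)"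
        using Ks w1 by (intro mult_left_mono prod_ge_1) auto
      finally show ?thesis .
    qed
  qed
  have "\<bar>\<Sum>x<modulus. \<Prod>j<m. \<psi> (x + b j)\<bar>
      \<le> 8 * (\<Prod>p\<in>P. \<bar>real_of_int (\<Sum>x<p. Legendre (int (\<Prod>j<m. x + b j)) (int p))\<bar>)"
    by (rule complete_sum_le)
  also have "\<dots> \<le> 8 * (\<Prod>p\<in>P. K * sqrt (real p) * (\<Prod>j\<in>{..<m}-{i}. w p j))"
    using local_bound by (intro mult_left_mono prod_mono) auto
  also have "(\<Prod>p\<in>P. K * sqrt (real p) * (\<Prod>j\<in>{..<m}-{i}. w p j))
      = K ^ card P * (\<Prod>p\<in>P. sqrt (real p)) * (\<Prod>p\<in>P. \<Prod>j\<in>{..<m}-{i}. w p j)"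
    by (simp add: prod.distrib)
  also have "(\<Prod>p\<in>P. sqrt (real p)) = sqrt (real (\<Prod>P))"
    using finite_P by (induction P rule: finite_induct) (auto simp: real_sqrt_mult)
  also have "(\<Prod>p\<in>P. \<Prod>j\<in>{..<m}-{i}. w p j) = (\<Prod>j\<in>{..<m}-{i}. \<Prod>p\<in>P. w p j)"
    by (rule prod.swap)
  also have "\<dots> = (\<Prod>j\<in>{..<m}-{i}. gcd_weight P (nat \<bar>int (b i) - int (b j)\<bar>))"
    by (simp add: gcd_weight_def w_def)
  finally show ?thesis by (simp only: K_def mult.assoc)
qed

text \<open>Once the value \<open>c\<close> at position \<open>i\<close> is fixed, the weights of
  the other positions are independent, so the sum over tuples becomes a product of one-variable
  sums, each bounded by the average of the gcd weights.\<close>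

lemma sum_unique_tuples_le:
  assumes i: "i < m"
  shows "(\<Sum>f\<in>{f \<in> {..<m} \<rightarrow>\<^sub>E {1..B}. \<forall>j<m. j \<noteq> i \<longrightarrow> f j \<noteq> f i}.
      \<Prod>j\<in>{..<m}-{i}. gcd_weight P (nat \<bar>int (f i) - int (f j)\<bar>))
    \<le> real B * (2 * 2 ^ card P * real B) ^ (m - 1)"
proof -
  define S where "S = {1..B}"
  define E where "E = ({..<m} \<rightarrow>\<^sub>E S)"
  define X where "X = {f \<in> E. \<forall>j<m. j \<noteq> i \<longrightarrow> f j \<noteq> f i}"
  define G where "G = (\<lambda>c b. if b = c then 0 else gcd_weight P (nat \<bar>int c - int b\<bar>))"
  \<comment> \<open>At position \<open>i\<close> this is the indicator of the value
    \<open>c\<close>, elsewhere the weight relative to \<open>c\<close>. The condition on the tuple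
    is thereby a product over positions, to which \<open>prod_sum_PiE\<close> applies.\<close>
  define h where "h = (\<lambda>c j b. if j = i then (if b = c then 1 else 0) else G c b)"
  have G0: "G c b \<ge> 0" for c b by (simp add: G_def gcd_weight_nonneg)
  then have h0: "h c j b \<ge> 0" for c j b by (simp add: h_def)
  have finE: "finite E" by (auto simp: E_def S_def intro!: finite_PiE)
  have "(\<Prod>j\<in>{..<m}-{i}. gcd_weight P (nat \<bar>int (f i) - int (f j)\<bar>)) \<le> (\<Sum>c\<in>S. \<Prod>j<m. h c j (f j))"
    if f: "f \<in> X" for f
  proof -
    have "(\<Prod>j\<in>{..<m}-{i}. gcd_weight P (nat \<bar>int (f i) - int (f j)\<bar>)) = (\<Prod>j\<in>{..<m}-{i}. h (f i) j (f j))"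
      using f by (intro prod.cong) (auto simp: X_def h_def G_def)
    also have "\<dots> = (\<Prod>j<m. h (f i) j (f j))"
      using i by (subst prod.remove[of "{..<m}" i]) (auto simp: h_def)
    also have "\<dots> \<le> (\<Sum>c\<in>S. \<Prod>j<m. h c j (f j))"
    proof (rule member_le_sum[where f = "\<lambda>c. \<Prod>j<m. h c j (f j)"])
      show "f i \<in> S" using f i by (auto simp: X_def E_def)
    qed (auto simp: S_def h0 intro!: prod_nonneg)
    finally show ?thesis .
  qed
  then have "(\<Sum>f\<in>X. \<Prod>j\<in>{..<m}-{i}. gcd_weight P (nat \<bar>int (f i) - int (f j)\<bar>))
      \<le> (\<Sum>f\<in>X. \<Sum>c\<in>S. \<Prod>j<m. h c j (f j))"
    by (rule sum_mono)
  also have "\<dots> \<le> (\<Sum>f\<in>E. \<Sum>c\<in>S. \<Prod>j<m. h c j (f j))"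
    using finE by (intro sum_mono2) (auto simp: X_def h0 intro!: sum_nonneg prod_nonneg)
  also have "\<dots> = (\<Sum>c\<in>S. \<Sum>f\<in>E. \<Prod>j<m. h c j (f j))" by (rule sum.swap)
  also have "\<dots> = (\<Sum>c\<in>S. \<Prod>j<m. \<Sum>b\<in>S. h c j b)"
    unfolding E_def by (subst prod_sum_PiE) (auto simp: S_def)
  also have "\<dots> \<le> (\<Sum>c\<in>S. (2 * 2 ^ card P * real B) ^ (m - 1))"
  proof (rule sum_mono)
    fix c assume c: "c \<in> S"
    have "(\<Sum>b\<in>S. G c b) = (\<Sum>b\<in>S-{c}. gcd_weight P (nat \<bar>int c - int b\<bar>))"
      using c by (subst sum.remove[of _ c]) (auto simp: S_def G_def intro!: sum.cong)
    also have "\<dots> \<le> 2 * 2 ^ card P * real B"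
      unfolding S_def using c by (intro sum_gcd_weight_diff_le finite_P prime_P) (auto simp: S_def)
    finally have g: "(\<Sum>b\<in>S. G c b) \<le> 2 * 2 ^ card P * real B" .
    have "(\<Prod>j<m. \<Sum>b\<in>S. h c j b) = (\<Sum>b\<in>S. h c i b) * (\<Prod>j\<in>{..<m}-{i}. \<Sum>b\<in>S. h c j b)"
      using i by (intro prod.remove) auto
    also have "(\<Sum>b\<in>S. h c i b) = 1" using c by (simp add: h_def S_def)
    also have "(\<Prod>j\<in>{..<m}-{i}. \<Sum>b\<in>S. h c j b) = (\<Prod>j\<in>{..<m}-{i}. \<Sum>b\<in>S. G c b)"
      by (intro prod.cong) (auto simp: h_def)
    also have "\<dots> = (\<Sum>b\<in>S. G c b) ^ (m - 1)" using i by simp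
    also have "1 * \<dots> \<le> (2 * 2 ^ card P * real B) ^ (m - 1)"
      using g by (simp add: power_mono sum_nonneg G0)
    finally show "(\<Prod>j<m. \<Sum>b\<in>S. h c j b) \<le> (2 * 2 ^ card P * real B) ^ (m - 1)" .
  qed
  also have "\<dots> = real B * (2 * 2 ^ card P * real B) ^ (m - 1)" by (simp add: S_def)
  finally show ?thesis by (simp only: X_def E_def S_def)
qed

text \<open>The power is expanded over tuples of length \<open>2 * r\<close>. Tuples in which every
  value repeats are few, about \<open>B ^ r\<close>, and get the trivial bound; any other tuple has
  a value that occurs once, which provides the simple root. The sets \<open>U i\<close> may overlap,
  which is harmless for an upper bound. The factor \<open>26 * r + 10\<close> is the constant of the
  complete sums for \<open>m = 2 * r\<close>.\<close>

lemma moment_bound: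
  assumes r: "r > 0"
  shows "(\<Sum>x<modulus. (\<Sum>b=1..B. \<psi> (x + b)) ^ (2*r))
    \<le> real (r ^ (2*r)) * real B ^ r * real modulus
      + 8 * real (2*r) * 2 ^ (2*r) * (2 ^ (2*r) * (26 * real r + 10)) ^ card P * sqrt (real modulus) * real B ^ (2*r)"
proof -
  define m S where "m = 2 * r" and "S = {1..B}"
  define E where "E = ({..<m} \<rightarrow>\<^sub>E S)"
  define U where "U = (\<lambda>i. {f \<in> E. \<forall>j<m. j \<noteq> i \<longrightarrow> f j \<noteq> f i})"
  define Z where "Z = {f \<in> E. \<forall>i<m. \<exists>j<m. j \<noteq> i \<and> f j = f i}"
  define T where "T = (\<lambda>f. \<bar>\<Sum>x<modulus. \<Prod>j<m. \<psi> (x + f j)\<bar>)"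
  define K where "K = 8 * (13 * real m + 10) ^ card P * sqrt (real (\<Prod>P))"
  have finE: "finite E" by (auto simp: E_def S_def intro!: finite_PiE)
  have T0: "T f \<ge> 0" for f by (simp add: T_def)
  have "(\<Sum>b\<in>S. \<psi> (x + b)) ^ m = (\<Sum>f\<in>E. \<Prod>j<m. \<psi> (x + f j))" for x
  proof -
    have "(\<Sum>b\<in>S. \<psi> (x + b)) ^ m = (\<Prod>j<m. \<Sum>b\<in>S. \<psi> (x + b))" by simp
    also have "\<dots> = (\<Sum>f\<in>E. \<Prod>j<m. \<psi> (x + f j))"
      unfolding E_def by (subst prod_sum_PiE) (auto simp: S_def)
    finally show ?thesis .
  qed
  then have "(\<Sum>x<modulus. (\<Sum>b\<in>S. \<psi> (x + b)) ^ m) = (\<Sum>f\<in>E. \<Sum>x<modulus. \<Prod>j<m. \<psi> (x + f j))"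
    by (simp add: sum.swap[of _ E])
  also have "\<dots> \<le> (\<Sum>f\<in>E. T f)" by (intro sum_mono) (simp add: T_def)
  also have "\<dots> \<le> (\<Sum>f\<in>Z \<union> (\<Union>i<m. U i). T f)"
    using T0 finE by (intro sum_mono2) (auto simp: Z_def U_def)
  also have "\<dots> \<le> (\<Sum>f\<in>Z. T f) + (\<Sum>f\<in>(\<Union>i<m. U i). T f)"
    using sum_Un[of Z "\<Union>i<m. U i" T] finE T0
    by (auto simp: Z_def U_def intro!: sum_nonneg)
  also have "\<dots> \<le> real (r ^ (2*r)) * real B ^ r * real modulus
      + (\<Sum>i<m. K * (real B * (2 * 2 ^ card P * real B) ^ (m - 1)))"
  proof (rule add_mono)
    have "T f \<le> real modulus" for f
    proof -
      have "\<bar>\<Prod>j<m. \<psi> (x + f j)\<bar> \<le> 1" for x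
      proof -
        have "(\<Prod>j<m. \<bar>\<psi> (x + f j)\<bar>) \<le> (\<Prod>j<m. 1)" using abs_\<psi>_le_1 by (intro prod_mono) auto
        then show ?thesis by (simp add: abs_prod)
      qed
      then have "T f \<le> (\<Sum>x<modulus. 1)" unfolding T_def by (intro order.trans[OF sum_abs] sum_mono)
      then show ?thesis by simp
    qed
    then have "(\<Sum>f\<in>Z. T f) \<le> (\<Sum>f\<in>Z. real modulus)" by (rule sum_mono)
    also have "\<dots> = real (card Z) * real modulus" by simp
    also have "\<dots> \<le> real (card S ^ r * r ^ (2*r)) * real modulus"
      using card_tuples_few_values[OF r, of S]
      by (intro mult_right_mono of_nat_mono) (auto simp: Z_def E_def m_def S_def)
    finally show "(\<Sum>f\<in>Z. T f) \<le> real (r ^ (2*r)) * real B ^ r * real modulus"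
      by (simp add: S_def mult.commute)
    have "(\<Sum>f\<in>(\<Union>i<m. U i). T f) \<le> (\<Sum>i<m. \<Sum>f\<in>U i. T f)"
      using finE T0 by (intro sum_UN_le) (auto simp: U_def)
    also have "\<dots> \<le> (\<Sum>i<m. K * (real B * (2 * 2 ^ card P * real B) ^ (m - 1)))"
    proof (rule sum_mono)
      fix i assume "i \<in> {..<m}"
      then have i: "i < m" by simp
      have "(\<Sum>f\<in>U i. T f) \<le> (\<Sum>f\<in>U i. K * (\<Prod>j\<in>{..<m}-{i}. gcd_weight P (nat \<bar>int (f i) - int (f j)\<bar>)))"
        unfolding T_def K_def by (intro sum_mono complete_sum_unique_le i)
      also have "\<dots> = K * (\<Sum>f\<in>U i. \<Prod>j\<in>{..<m}-{i}. gcd_weight P (nat \<bar>int (f i) - int (f j)\<bar>))"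
        by (simp add: sum_distrib_left)
      also have "\<dots> \<le> K * (real B * (2 * 2 ^ card P * real B) ^ (m - 1))"
        unfolding U_def E_def S_def by (intro mult_left_mono sum_unique_tuples_le i) (auto simp: K_def intro!: mult_nonneg_nonneg prod_nonneg)
      finally show "(\<Sum>f\<in>U i. T f) \<le> K * (real B * (2 * 2 ^ card P * real B) ^ (m - 1))" .
    qed
    finally show "(\<Sum>f\<in>(\<Union>i<m. U i). T f) \<le> (\<Sum>i<m. K * (real B * (2 * 2 ^ card P * real B) ^ (m - 1)))" .
  qed
  also have "(\<Sum>i<m. K * (real B * (2 * 2 ^ card P * real B) ^ (m - 1)))
      = real m * K * (real B * (2 * 2 ^ card P * real B) ^ (m - 1))" by simp
  also have "\<dots> \<le> 8 * real (2*r) * 2 ^ (2*r) * (2 ^ (2*r) * (26 * real r + 10)) ^ card P * sqrt (real modulus) * real B ^ (2*r)"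
  proof -
    have m1: "m = Suc (m - 1)" using r by (simp add: m_def)
    have Bm: "real B * real B ^ (m - 1) = real B ^ m"
      using power_Suc[of "real B" "m - 1"] m1 by simp
    have "(2 * 2 ^ card P * real B) ^ (m - 1) = 2 ^ (m - 1) * (2 ^ card P) ^ (m - 1) * real B ^ (m - 1)"
      by (simp only: power_mult_distrib)
    also have "\<dots> \<le> 2 ^ m * (2 ^ m) ^ card P * real B ^ (m - 1)"
    proof (intro mult_right_mono mult_mono)
      have "((2::real) ^ card P) ^ (m - 1) = (2 ^ (m - 1)) ^ card P" by (simp add: mult.commute flip: power_mult)
      also have "\<dots> \<le> (2 ^ m) ^ card P" by (intro power_mono power_increasing) auto
      finally show "((2::real) ^ card P) ^ (m - 1) \<le> (2 ^ m) ^ card P" .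
    qed auto
    finally have "real B * (2 * 2 ^ card P * real B) ^ (m - 1) \<le> real B * (2 ^ m * (2 ^ m) ^ card P * real B ^ (m - 1))"
      by (intro mult_left_mono) auto
    also have "\<dots> = 2 ^ m * (2 ^ m) ^ card P * (real B * real B ^ (m - 1))" by (simp only: mult_ac)
    finally have 1: "real B * (2 * 2 ^ card P * real B) ^ (m - 1) \<le> 2 ^ m * (2 ^ m) ^ card P * real B ^ m"
      by (simp only: Bm)
    have "K \<le> 8 * (13 * real m + 10) ^ card P * sqrt (real modulus)"
      unfolding K_def modulus_def by (intro mult_left_mono real_sqrt_le_mono of_nat_mono) auto
    then have "real m * K * (real B * (2 * 2 ^ card P * real B) ^ (m - 1))
        \<le> real m * (8 * (13 * real m + 10) ^ card P * sqrt (real modulus)) * (2 ^ m * (2 ^ m) ^ card P * real B ^ m)"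
      by (intro mult_mono mult_left_mono 1) auto
    also have "\<dots> = 8 * real m * 2 ^ m * (2 ^ m * (13 * real m + 10)) ^ card P * sqrt (real modulus) * real B ^ m"
      by (simp only: power_mult_distrib mult_ac)
    finally show ?thesis by (simp add: m_def)
  qed
  finally show ?thesis by (simp add: m_def S_def)
qed

end

section \<open>Burgess' bound\<close>

text \<open>Iterated Cauchy-Schwarz doubles the exponent at each step. This is why the moment
  parameter is later taken to be a power of two.\<close>

lemma weighted_power_mean:
  fixes v T :: "'a \<Rightarrow> real"
  assumes "\<And>x. x \<in> X \<Longrightarrow> v x \<ge> 0" "\<And>x. x \<in> X \<Longrightarrow> T x \<ge> 0"
  shows "(\<Sum>x\<in>X. v x * T x) ^ (2 ^ s) \<le> (\<Sum>x\<in>X. v x) ^ (2 ^ s - 1) * (\<Sum>x\<in>X. v x * T x ^ (2 ^ s))"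
proof (induction s)
  case (Suc s)
  define k :: nat where "k = 2 ^ s"
  define V where "V = (\<Sum>x\<in>X. v x)"
  have k: "k \<ge> 1" by (simp add: k_def)
  have V0: "V \<ge> 0" using assms by (simp add: V_def sum_nonneg)
  have 0: "(\<Sum>x\<in>X. v x * T x) ^ k \<ge> 0" using assms by (intro zero_le_power sum_nonneg mult_nonneg_nonneg) auto
  have cs: "(\<Sum>x\<in>X. v x * T x ^ k)\<^sup>2 \<le> V * (\<Sum>x\<in>X. v x * T x ^ (2 * k))"
  proof -
    have "(\<Sum>x\<in>X. v x * T x ^ k) = (\<Sum>x\<in>X. sqrt (v x) * (sqrt (v x) * T x ^ k))"
    proof (intro sum.cong refl)
      fix x assume "x \<in> X"
      then have "sqrt (v x) * sqrt (v x) = v x" using assms by simp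
      then show "v x * T x ^ k = sqrt (v x) * (sqrt (v x) * T x ^ k)" by (metis mult.assoc)
    qed
    also have "\<dots>\<^sup>2 \<le> (\<Sum>x\<in>X. (sqrt (v x))\<^sup>2) * (\<Sum>x\<in>X. (sqrt (v x) * T x ^ k)\<^sup>2)"
      by (rule Cauchy_Schwarz_ineq_sum)
    also have "(\<Sum>x\<in>X. (sqrt (v x))\<^sup>2) = V" using assms by (simp add: V_def)
    also have "(\<Sum>x\<in>X. (sqrt (v x) * T x ^ k)\<^sup>2) = (\<Sum>x\<in>X. v x * T x ^ (2 * k))"
    proof (intro sum.cong refl)
      fix x assume "x \<in> X"
      then show "(sqrt (v x) * T x ^ k)\<^sup>2 = v x * T x ^ (2 * k)"
        using assms by (simp add: power_mult_distrib mult.commute[of 2] flip: power_mult)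
    qed
    finally show ?thesis .
  qed
  have "(\<Sum>x\<in>X. v x * T x) ^ (2 * k) = ((\<Sum>x\<in>X. v x * T x) ^ k)\<^sup>2"
    by (simp add: mult.commute[of 2] flip: power_mult)
  also have "\<dots> \<le> (V ^ (k - 1) * (\<Sum>x\<in>X. v x * T x ^ k))\<^sup>2"
    using Suc 0 unfolding k_def V_def by (intro power_mono)
  also have "\<dots> = V ^ (2 * (k - 1)) * (\<Sum>x\<in>X. v x * T x ^ k)\<^sup>2"
    by (simp add: power_mult_distrib mult.commute[of 2] flip: power_mult)
  also have "\<dots> \<le> V ^ (2 * (k - 1)) * (V * (\<Sum>x\<in>X. v x * T x ^ (2 * k)))"
    using V0 cs by (intro mult_left_mono) auto
  also have "\<dots> = V ^ Suc (2 * (k - 1)) * (\<Sum>x\<in>X. v x * T x ^ (2 * k))" by simp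
  also have "Suc (2 * (k - 1)) = 2 * k - 1" using k by simp
  finally show ?case by (simp add: k_def V_def)
qed simp

text \<open>The power mean inequality with exponent \<open>r\<close> is squared, and one more
  Cauchy-Schwarz separates \<open>v\<close> from \<open>T ^ r\<close>.\<close>

lemma weighted_holder:
  fixes v T :: "'a \<Rightarrow> real"
  assumes v: "\<And>x. x \<in> X \<Longrightarrow> v x \<ge> 0" and T: "\<And>x. x \<in> X \<Longrightarrow> T x \<ge> 0" and r: "r = 2 ^ s"
  shows "(\<Sum>x\<in>X. v x * T x) ^ (2 * r)
    \<le> (\<Sum>x\<in>X. v x) ^ (2 * r - 2) * (\<Sum>x\<in>X. (v x)\<^sup>2) * (\<Sum>x\<in>X. T x ^ (2 * r))"
proof -
  define V where "V = (\<Sum>x\<in>X. v x)"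
  have V0: "V \<ge> 0" using v by (simp add: V_def sum_nonneg)
  have 0: "(\<Sum>x\<in>X. v x * T x) ^ r \<ge> 0" using assms by (intro zero_le_power sum_nonneg mult_nonneg_nonneg) auto
  have "(\<Sum>x\<in>X. v x * T x) ^ (2 * r) = ((\<Sum>x\<in>X. v x * T x) ^ r)\<^sup>2"
    by (simp add: mult.commute[of 2] flip: power_mult)
  also have "\<dots> \<le> (V ^ (r - 1) * (\<Sum>x\<in>X. v x * T x ^ r))\<^sup>2"
    using weighted_power_mean[OF v T] 0 unfolding V_def r by (intro power_mono)
  also have "\<dots> = V ^ (2 * (r - 1)) * (\<Sum>x\<in>X. v x * T x ^ r)\<^sup>2"
    by (simp add: power_mult_distrib mult.commute[of 2] flip: power_mult)
  also have "\<dots> \<le> V ^ (2 * (r - 1)) * ((\<Sum>x\<in>X. (v x)\<^sup>2) * (\<Sum>x\<in>X. (T x ^ r)\<^sup>2))"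
    using V0 by (intro mult_left_mono Cauchy_Schwarz_ineq_sum) auto
  also have "\<dots> = V ^ (2 * r - 2) * (\<Sum>x\<in>X. (v x)\<^sup>2) * (\<Sum>x\<in>X. T x ^ (2 * r))"
  proof -
    have "2 * (r - 1) = 2 * r - 2" by simp
    then show ?thesis by (simp only: mult.assoc power_mult[symmetric] mult.commute[of r 2])
  qed
  finally show ?thesis by (simp add: V_def)
qed

section \<open>Counting congruences and shifting by products\<close>

lemma card_residue_class_le:
  fixes q M u :: nat
  assumes "q > 0"
  shows "card {v \<in> {1..M}. [v = u] (mod q)} \<le> M div q + 1"
proof -
  have "inj_on (\<lambda>v. v div q) {v \<in> {1..M}. [v = u] (mod q)}"
  proof (rule inj_onI)
    fix x y assume xy: "x \<in> {v \<in> {1..M}. [v = u] (mod q)}" "y \<in> {v \<in> {1..M}. [v = u] (mod q)}" "x div q = y div q"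
    then have "x mod q = y mod q" by (simp add: cong_def)
    then show "x = y" using xy(3) by (metis div_mult_mod_eq)
  qed
  then have "card {v \<in> {1..M}. [v = u] (mod q)} \<le> card {0..M div q}"
    by (rule card_inj_on_le) (auto intro: div_le_mono)
  then show ?thesis by simp
qed

text \<open>The product \<open>v = a * n\<close> is at most \<open>A * z\<close> and lies in one
  residue class, which allows at most \<open>A * z / q + 1\<close> values; \<open>a\<close> is then
  one of at most \<open>L\<close> divisors of \<open>v\<close> in \<open>S\<close>.\<close>

lemma card_products_in_residue_class_le:
  fixes A z q u :: nat and L :: real
  assumes q: "q > 0" and S: "finite S" "\<And>a. a \<in> S \<Longrightarrow> 0 < a \<and> a \<le> A"
    and L: "\<And>v. v \<in> {1..A*z} \<Longrightarrow> real (card {a \<in> S. a dvd v}) \<le> L" and L0: "L \<ge> 0"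
  shows "real (card {(a, n) \<in> S \<times> {1..z}. [a * n = u] (mod q)}) \<le> (real (A*z) / real q + 1) * L"
proof -
  define V where "V = {v \<in> {1..A*z}. [v = u] (mod q)}"
  have "card {(a, n) \<in> S \<times> {1..z}. [a * n = u] (mod q)} \<le> card (SIGMA v:V. {a \<in> S. a dvd v})"
  proof (rule card_inj_on_le)
    show "inj_on (\<lambda>(a, n). (a * n, a)) {(a, n) \<in> S \<times> {1..z}. [a * n = u] (mod q)}"
      using S(2) by (auto simp: inj_on_def)
    show "(\<lambda>(a, n). (a * n, a)) ` {(a, n) \<in> S \<times> {1..z}. [a * n = u] (mod q)} \<subseteq> (SIGMA v:V. {a \<in> S. a dvd v})"
      using S(2) by (auto simp: V_def mult_le_mono Suc_le_eq)
    show "finite (SIGMA v:V. {a \<in> S. a dvd v})" using S(1) by (auto simp: V_def)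
  qed
  also have "\<dots> = (\<Sum>v\<in>V. card {a \<in> S. a dvd v})" using S(1) by (subst card_SigmaI) (auto simp: V_def)
  finally have "real (card {(a, n) \<in> S \<times> {1..z}. [a * n = u] (mod q)}) \<le> real (\<Sum>v\<in>V. card {a \<in> S. a dvd v})"
    by (rule of_nat_mono)
  also have "\<dots> \<le> (\<Sum>v\<in>V. L)" unfolding of_nat_sum by (intro sum_mono L) (simp add: V_def)
  also have "\<dots> = real (card V) * L" by simp
  also have "\<dots> \<le> (real (A*z) / real q + 1) * L"
  proof (rule mult_right_mono[OF _ L0])
    have "real (card V) \<le> real (A*z div q + 1)" unfolding V_def by (intro of_nat_mono card_residue_class_le q)
    then show "real (card V) \<le> real (A*z) / real q + 1" using real_div_bounds(2)[of "A*z" q] by simp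
  qed
  finally show ?thesis .
qed

lemma abs_sum_shift_le:
  fixes f :: "nat \<Rightarrow> real"
  assumes "\<And>n. \<bar>f n\<bar> \<le> 1"
  shows "\<bar>(\<Sum>n=1..z. f (n + c)) - (\<Sum>n=1..z. f n)\<bar> \<le> 2 * real c"
proof (induction c)
  case (Suc c)
  define a b where "a = (\<Sum>n=1..z. f (n + Suc c))" and "b = (\<Sum>n=1..z. f (n + c))"
  have "(\<Sum>n=1..z. f (n + Suc c)) + f (1 + c) = (\<Sum>n=1..z. f (n + c)) + f (Suc z + c)"
    by (induction z) auto
  then have "a + f (1 + c) = b + f (Suc z + c)" unfolding a_def b_def .
  then have "\<bar>a - b\<bar> \<le> 2"
    using assms[of "1 + c"] assms[of "Suc z + c"] by linarith
  moreover have "\<bar>b - (\<Sum>n=1..z. f n)\<bar> \<le> 2 * real c" using Suc by (simp only: b_def)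
  ultimately have "\<bar>a - (\<Sum>n=1..z. f n)\<bar> \<le> 2 * real (Suc c)" by simp
  then show ?case by (simp only: a_def)
qed simp

context quadratic_symbol
begin

lemma modulus_pos: "modulus > 0"
  using prod_P_pos by (simp add: modulus_def)

text \<open>With \<open>ia a\<close> the inverse of \<open>a\<close>,
  \<open>\<psi> (n + a * b) = \<psi> a * \<psi> (ia a * n + b)\<close>. Averaging over
  \<open>a\<close> and \<open>b\<close> turns the sum into \<open>W\<close>, in which a short sum
  starting at \<open>x\<close> is weighted by the number \<open>v x\<close> of pairs
  \<open>(a, n)\<close> with \<open>ia a * n\<close> congruent to \<open>x\<close>. Hoelder's
  inequality isolates the complete moment; the term \<open>2 * A * B\<close> is the error made by
  shifting the range of \<open>n\<close>.\<close>

lemma burgess_core: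
  fixes A B z s r :: nat and L :: real
  assumes S: "finite S" "\<And>a. a \<in> S \<Longrightarrow> 0 < a \<and> a \<le> A \<and> coprime a modulus"
    and L: "\<And>v. v \<in> {1..A*z} \<Longrightarrow> real (card {a \<in> S. a dvd v}) \<le> L" and L0: "L \<ge> 0" and r: "r = 2 ^ s"
  obtains W where "W \<ge> 0"
    "real (card S) * real B * \<bar>\<Sum>n=1..z. \<psi> n\<bar> \<le> W + real (card S) * real B * (2 * real A * real B)"
    "W ^ (2*r) \<le> (real (card S) * real z) ^ (2*r-2)
       * (real (card S) * real z * ((real (A*z) / real modulus + 1) * L))
       * (\<Sum>x<modulus. (\<Sum>b=1..B. \<psi> (x + b)) ^ (2*r))"
proof -
  define q where "q = modulus"
  define R where "R = S \<times> {1..z}"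
  have q: "q > 0" using modulus_pos by (simp add: q_def)
  have finR: "finite R" using S by (simp add: R_def)
  have "\<exists>a'. [a * a' = 1] (mod q)" if "a \<in> S" for a
    using S(2)[OF that] cong_solve_coprime_nat[of a q] by (auto simp: q_def)
  then obtain ia where ia: "\<And>a. a \<in> S \<Longrightarrow> [a * ia a = 1] (mod q)" by metis
  define y where "y = (\<lambda>(a, n). ia a * n mod q)"
  define T where "T = (\<lambda>x. \<bar>\<Sum>b=1..B. \<psi> (x + b)\<bar>)"
  define v where "v = (\<lambda>x. real (card {p \<in> R. y p = x}))"
  have yq: "y p < q" for p using q by (simp add: y_def split: prod.split)
  have per: "\<psi> (x + q) = \<psi> x" for x by (simp add: q_def \<psi>_periodic)
  have shift: "\<psi> (n + a * b) = \<psi> a * \<psi> (y (a, n) + b)" if a: "a \<in> S" for a n b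
  proof -
    have "[a * (y (a, n) + b) = a * (ia a * n + b)] (mod q)"
      by (intro cong_mult cong_add cong_refl) (simp add: y_def)
    also have "a * (ia a * n + b) = (a * ia a) * n + a * b" by (simp add: algebra_simps)
    also have "[(a * ia a) * n + a * b = 1 * n + a * b] (mod q)"
      by (intro cong_mult cong_add cong_refl ia a)
    finally have "[1 * n + a * b = a * (y (a, n) + b)] (mod q)" by (rule cong_sym)
    then have "[n + a * b = a * (y (a, n) + b)] (mod q)" by (simp only: mult_1)
    then have "\<psi> (n + a * b) = \<psi> (a * (y (a, n) + b))"
      by (rule periodic_cong[of \<psi> q, OF per])
    then show ?thesis by (simp add: \<psi>_mult)
  qed
  define W where "W = (\<Sum>x<q. v x * T x)"
  have T0: "T x \<ge> 0" and v0: "v x \<ge> 0" for x by (auto simp: T_def v_def)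
  have group: "(\<Sum>x<q. v x * H x) = (\<Sum>p\<in>R. H (y p))" for H :: "nat \<Rightarrow> real"
  proof -
    have "(\<Sum>x<q. v x * H x) = (\<Sum>x<q. \<Sum>p\<in>{p \<in> R. y p = x}. H (y p))"
      by (intro sum.cong) (auto simp: v_def)
    also have "\<dots> = (\<Sum>p\<in>R. H (y p))" using finR yq by (intro sum.group) auto
    finally show ?thesis .
  qed
  have part1: "real (card S) * real B * \<bar>\<Sum>n=1..z. \<psi> n\<bar> \<le> W + real (card S) * real B * (2 * real A * real B)"
  proof -
    have inner: "real B * \<bar>\<Sum>n=1..z. \<psi> n\<bar> \<le> (\<Sum>n=1..z. T (y (a, n))) + real B * (2 * real A * real B)"
      if a: "a \<in> S" for a
    proof -
      define \<sigma> :: real where "\<sigma> = sgn (\<Sum>n=1..z. \<psi> n)"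
      have \<sigma>1: "\<bar>\<sigma>\<bar> \<le> 1" by (simp add: \<sigma>_def sgn_if)
      have "real B * \<bar>\<Sum>n=1..z. \<psi> n\<bar> = (\<Sum>b=1..B. \<sigma> * (\<Sum>n=1..z. \<psi> n))"
        by (simp add: \<sigma>_def abs_sgn mult.commute)
      also have "\<dots> \<le> (\<Sum>b=1..B. \<sigma> * (\<Sum>n=1..z. \<psi> (n + a * b)) + 2 * real A * real B)"
      proof (rule sum_mono)
        fix b assume b: "b \<in> {1..B}"
        have "a * b \<le> A * B" using S(2)[OF a] b by (intro mult_le_mono) auto
        then have "real (a * b) \<le> real A * real B" by (simp flip: of_nat_mult)
        then have "\<bar>(\<Sum>n=1..z. \<psi> n) - (\<Sum>n=1..z. \<psi> (n + a * b))\<bar> \<le> 2 * real A * real B"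
          using abs_sum_shift_le[of \<psi> "a * b" z, OF abs_\<psi>_le_1] by linarith
        then have "\<bar>\<sigma> * ((\<Sum>n=1..z. \<psi> n) - (\<Sum>n=1..z. \<psi> (n + a * b)))\<bar> \<le> 1 * (2 * real A * real B)"
          unfolding abs_mult using \<sigma>1 by (intro mult_mono) auto
        then show "\<sigma> * (\<Sum>n=1..z. \<psi> n) \<le> \<sigma> * (\<Sum>n=1..z. \<psi> (n + a * b)) + 2 * real A * real B"
          unfolding right_diff_distrib by linarith
      qed
      also have "\<dots> = \<sigma> * (\<Sum>b=1..B. \<Sum>n=1..z. \<psi> (n + a * b)) + real B * (2 * real A * real B)"
        by (simp add: sum.distrib sum_distrib_left)
      also have "(\<Sum>b=1..B. \<Sum>n=1..z. \<psi> (n + a * b)) = (\<Sum>n=1..z. \<Sum>b=1..B. \<psi> (n + a * b))"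
        by (rule sum.swap)
      also have "\<sigma> * (\<Sum>n=1..z. \<Sum>b=1..B. \<psi> (n + a * b)) \<le> 1 * (\<Sum>n=1..z. T (y (a, n)))"
      proof -
        have "\<bar>\<Sum>n=1..z. \<Sum>b=1..B. \<psi> (n + a * b)\<bar> \<le> (\<Sum>n=1..z. T (y (a, n)))"
        proof (rule order.trans[OF sum_abs sum_mono])
          fix n assume "n \<in> {1..z}"
          have "(\<Sum>b=1..B. \<psi> (n + a * b)) = \<psi> a * (\<Sum>b=1..B. \<psi> (y (a, n) + b))"
            by (simp add: shift[OF a] sum_distrib_left)
          then show "\<bar>\<Sum>b=1..B. \<psi> (n + a * b)\<bar> \<le> T (y (a, n))"
            using mult_right_mono[OF abs_\<psi>_le_1[of a], of "T (y (a, n))"] T0 by (simp add: abs_mult T_def)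
        qed
        then have "\<bar>\<sigma>\<bar> * \<bar>\<Sum>n=1..z. \<Sum>b=1..B. \<psi> (n + a * b)\<bar> \<le> 1 * (\<Sum>n=1..z. T (y (a, n)))"
          using \<sigma>1 by (intro mult_mono) auto
        then show ?thesis by (simp only: abs_mult[symmetric] abs_le_iff)
      qed
      finally show ?thesis by simp
    qed
    have "real (card S) * real B * \<bar>\<Sum>n=1..z. \<psi> n\<bar> = (\<Sum>a\<in>S. real B * \<bar>\<Sum>n=1..z. \<psi> n\<bar>)" by simp
    also have "\<dots> \<le> (\<Sum>a\<in>S. (\<Sum>n=1..z. T (y (a, n))) + real B * (2 * real A * real B))"
      by (intro sum_mono inner)
    also have "\<dots> = (\<Sum>p\<in>R. T (y p)) + real (card S) * real B * (2 * real A * real B)"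
      by (simp add: sum.distrib R_def sum.cartesian_product)
    finally show ?thesis by (simp only: W_def group)
  qed
  have sumv: "(\<Sum>x<q. v x) = real (card S) * real z"
    using group[of "\<lambda>_. 1"] by (simp add: R_def card_cartesian_product)
  \<comment> \<open>The second moment of \<open>v\<close> counts solutions of
    \<open>a * n' = a' * n\<close> modulo \<open>q\<close>. For each fixed pair
    \<open>(a', n)\<close> the remaining pairs are products in one residue class.\<close>
  have sumv2: "(\<Sum>x<q. (v x)\<^sup>2) \<le> real (card S) * real z * ((real (A*z) / real q + 1) * L)"
  proof -
    have "(\<Sum>x<q. (v x)\<^sup>2) = (\<Sum>p\<in>R. v (y p))" by (simp add: power2_eq_square group)
    also have "\<dots> = (\<Sum>p\<in>R. \<Sum>p'\<in>R. if y p' = y p then 1 else 0)"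
      unfolding v_def using finR by (simp add: sum.If_cases Int_def)
    also have "\<dots> \<le> (\<Sum>p\<in>R. \<Sum>p'\<in>R. if [fst p * snd p' = fst p' * snd p] (mod q) then 1 else 0)"
    proof (intro sum_mono)
      fix p p' assume R: "p \<in> R" "p' \<in> R"
      define a n a' n' where "a = fst p" and "n = snd p" and "a' = fst p'" and "n' = snd p'"
      have pp: "p = (a, n)" "p' = (a', n')" by (simp_all add: a_def n_def a'_def n'_def)
      have "(if y (a', n') = y (a, n) then 1 else 0 :: real) \<le> (if [a * n' = a' * n] (mod q) then 1 else 0)"
      proof (cases "y (a', n') = y (a, n)")
        case True
        then have e: "[ia a' * n' = ia a * n] (mod q)" by (simp add: y_def cong_def)
        have "[(a * n') * (a' * ia a') = (a * n') * 1] (mod q)"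
          using R by (intro cong_mult cong_refl ia) (simp add: R_def pp)
        then have 1: "[a * a' * (ia a' * n') = a * n'] (mod q)" by (simp add: mult_ac)
        have 2: "[a * a' * (ia a' * n') = a * a' * (ia a * n)] (mod q)"
          by (intro cong_mult cong_refl e)
        have "[(a' * n) * (a * ia a) = (a' * n) * 1] (mod q)"
          using R by (intro cong_mult cong_refl ia) (simp add: R_def pp)
        then have 3: "[a * a' * (ia a * n) = a' * n] (mod q)" by (simp add: mult_ac)
        have "[a * n' = a' * n] (mod q)"
          using cong_trans[OF cong_sym[OF 1] cong_trans[OF 2 3]] .
        then show ?thesis by simp
      qed simp
      then show "(if y p' = y p then 1 else 0 :: real) \<le> (if [fst p * snd p' = fst p' * snd p] (mod q) then 1 else 0)"
        unfolding pp by simp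
    qed
    also have "\<dots> = (\<Sum>a\<in>S. \<Sum>n\<in>{1..z}. \<Sum>a'\<in>S. \<Sum>n'\<in>{1..z}. if [a * n' = a' * n] (mod q) then 1 else 0)"
      by (simp only: R_def sum.cartesian_product' fst_conv snd_conv)
    also have "\<dots> = (\<Sum>a\<in>S. \<Sum>a'\<in>S. \<Sum>n\<in>{1..z}. \<Sum>n'\<in>{1..z}. if [a * n' = a' * n] (mod q) then 1 else 0)"
      by (intro sum.cong refl sum.swap)
    also have "\<dots> = (\<Sum>a'\<in>S. \<Sum>a\<in>S. \<Sum>n\<in>{1..z}. \<Sum>n'\<in>{1..z}. if [a * n' = a' * n] (mod q) then 1 else 0)"
      by (rule sum.swap)
    also have "\<dots> = (\<Sum>a'\<in>S. \<Sum>n\<in>{1..z}. \<Sum>a\<in>S. \<Sum>n'\<in>{1..z}. if [a * n' = a' * n] (mod q) then 1 else 0)"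
      by (intro sum.cong refl sum.swap)
    also have "\<dots> \<le> (\<Sum>a'\<in>S. \<Sum>n\<in>{1..z}. (real (A*z) / real q + 1) * L)"
    proof (intro sum_mono)
      fix a' n
      have "(\<Sum>a\<in>S. \<Sum>n'\<in>{1..z}. if [a * n' = a' * n] (mod q) then 1 else 0)
        = (\<Sum>(a, n')\<in>R. if [a * n' = a' * n] (mod q) then 1 else 0 :: real)"
        by (simp add: R_def sum.cartesian_product)
      also have "\<dots> = real (card {(a, n') \<in> R. [a * n' = a' * n] (mod q)})"
        using finR by (simp add: case_prod_beta sum.If_cases Int_def) (auto intro!: arg_cong[of _ _ card])
      also have "\<dots> \<le> (real (A*z) / real q + 1) * L"
        unfolding R_def using S L L0 q by (intro card_products_in_residue_class_le) auto
      finally show "(\<Sum>a\<in>S. \<Sum>n'\<in>{1..z}. if [a * n' = a' * n] (mod q) then 1 else 0) \<le> (real (A*z) / real q + 1) * L" .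
    qed
    also have "\<dots> = real (card S) * real z * ((real (A*z) / real q + 1) * L)" by simp
    finally show ?thesis .
  qed
  have "W ^ (2*r) \<le> (\<Sum>x<q. v x) ^ (2 * r - 2) * (\<Sum>x<q. (v x)\<^sup>2) * (\<Sum>x<q. T x ^ (2 * r))"
    unfolding W_def by (rule weighted_holder[OF v0 T0 r])
  also have "\<dots> \<le> (\<Sum>x<q. v x) ^ (2 * r - 2) * (real (card S) * real z * ((real (A*z) / real q + 1) * L)) * (\<Sum>x<q. T x ^ (2 * r))"
    using sumv2 v0 T0 by (intro mult_right_mono mult_left_mono zero_le_power sum_nonneg) auto
  also have "(\<Sum>x<q. T x ^ (2 * r)) = (\<Sum>x<q. (\<Sum>b=1..B. \<psi> (x + b)) ^ (2 * r))"
    by (simp add: T_def power_mult)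
  finally have part2: "W ^ (2*r) \<le> (real (card S) * real z) ^ (2*r-2)
       * (real (card S) * real z * ((real (A*z) / real q + 1) * L))
       * (\<Sum>x<q. (\<Sum>b=1..B. \<psi> (x + b)) ^ (2*r))"
    by (simp only: sumv)
  have "W \<ge> 0" unfolding W_def using v0 T0 by (intro sum_nonneg mult_nonneg_nonneg) auto
  from that[OF this part1 part2[unfolded q_def]] show thesis .
qed

end

text \<open>A prime \<open>p\<close> with \<open>p powr \<eta> \<ge> K\<close> pays for its own
  factor \<open>K\<close>. The fewer than \<open>Y\<close> smaller primes cost at most
  \<open>K ^ Y\<close>.\<close>

lemma power_card_primes_le:
  fixes K \<eta> :: real
  assumes "K \<ge> 1" "\<eta> > 0"
  obtains C where "C \<ge> 1"
    "\<And>P. finite P \<Longrightarrow> (\<And>p. p \<in> P \<Longrightarrow> prime p) \<Longrightarrow> K ^ card P \<le> C * real (\<Prod>P) powr \<eta>"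
proof -
  define Y where "Y = nat \<lceil>K powr (1 / \<eta>)\<rceil>"
  show ?thesis
  proof (rule that[of "K ^ Y"])
    show "K ^ Y \<ge> 1" using assms by simp
    fix P :: "nat set" assume fin: "finite P" and P: "\<And>p. p \<in> P \<Longrightarrow> prime p"
    have "K ^ card P = (\<Prod>p\<in>P. K)" by simp
    also have "\<dots> \<le> (\<Prod>p\<in>P. (if p < Y then K else 1) * real p powr \<eta>)"
    proof (rule prod_mono)
      fix p assume p: "p \<in> P"
      have p1: "real p \<ge> 1" using P[OF p] prime_gt_0_nat by (simp add: Suc_le_eq)
      have pe: "real p powr \<eta> \<ge> 1" using p1 assms by (simp add: ge_one_powr_ge_zero)
      show "0 \<le> K \<and> K \<le> (if p < Y then K else 1) * real p powr \<eta>"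
      proof (cases "p < Y")
        case True
        then show ?thesis using assms pe mult_left_mono[OF pe, of K] by simp
      next
        case False
        then have "K powr (1 / \<eta>) \<le> real p" unfolding Y_def by linarith
        then have "(K powr (1 / \<eta>)) powr \<eta> \<le> real p powr \<eta>" using assms by (intro powr_mono2) auto
        then show ?thesis using False assms by (simp add: powr_powr)
      qed
    qed
    also have "\<dots> = (\<Prod>p\<in>P. if p < Y then K else 1) * (\<Prod>p\<in>P. real p powr \<eta>)" by (rule prod.distrib)
    also have "(\<Prod>p\<in>P. real p powr \<eta>) = real (\<Prod>P) powr \<eta>"
      using fin by (induction P rule: finite_induct) (auto simp: powr_mult)
    also have "(\<Prod>p\<in>P. if p < Y then K else 1) * real (\<Prod>P) powr \<eta> \<le> K ^ Y * real (\<Prod>P) powr \<eta>"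
    proof (rule mult_right_mono)
      have "(\<Prod>p\<in>P. if p < Y then K else 1) = K ^ card {p \<in> P. p < Y}"
        using fin by (simp flip: prod.inter_filter)
      also have "\<dots> \<le> K ^ Y"
        using assms card_mono[of "{..<Y}" "{p \<in> P. p < Y}"] by (intro power_increasing) auto
      finally show "(\<Prod>p\<in>P. if p < Y then K else 1) \<le> K ^ Y" .
    qed simp
    finally show "K ^ card P \<le> K ^ Y * real (\<Prod>P) powr \<eta>" .
  qed
qed

context quadratic_symbol
begin

text \<open>All small losses are measured by \<open>\<eta> = \<delta> / 16\<close>. They leave the
  exponent \<open>3 * \<eta> - \<delta> \<le> - \<delta> / 2\<close> in the bound for the power
  \<open>2 * r\<close> of \<open>W\<close>, and the root gives the saving
  \<open>\<delta> / (4 * r)\<close>.\<close>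

lemma burgess_large:
  fixes r s z :: nat and \<delta> \<eta> C1 C2 c1 c2 c4 :: real
  defines "c1 \<equiv> real (r ^ (2*r))" and "c2 \<equiv> 8 * real (2*r) * 2 ^ (2*r)" and "\<eta> \<equiv> \<delta> / 16"
  defines "c4 \<equiv> 8 / \<eta> * C2 * (c1 + c2 * C1)"
  assumes \<delta>: "0 < \<delta>" "\<delta> < 1/4" and r: "r = 2 ^ s" "2 / \<delta> \<le> real r"
    and C1: "C1 \<ge> 1" "(2 ^ (2*r) * (26 * real r + 10)) ^ card P \<le> C1 * real (\<Prod>P) powr \<eta>"
    and C2: "C2 \<ge> 1" "\<And>D. finite D \<Longrightarrow> (\<And>p. p \<in> D \<Longrightarrow> prime p) \<Longrightarrow> 2 ^ card D \<le> C2 * real (\<Prod>D) powr (\<eta>/2)"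
    and q: "real modulus \<ge> exp (56 / \<eta>)" "real modulus \<ge> (4 * C2 / \<eta>) ^ 16"
    and z: "real modulus powr (1/4 + \<delta>) \<le> real z" "z \<le> modulus"
  shows "\<bar>\<Sum>n=1..z. \<psi> n\<bar> \<le> (c4 + 4) * real z * real modulus powr (- (\<delta> / (4 * real r)))"
proof -
  define q where "q = real modulus"
  have \<eta>: "0 < \<eta>" "\<eta> < 1/64" using \<delta> by (auto simp: \<eta>_def)
  have r1: "r \<ge> 1" by (simp add: r)
  have r\<delta>: "1 / (2 * real r) \<le> \<delta> / 4" using r(2) \<delta> r1 by (simp add: field_simps)
  have q1: "q > 1"
  proof -
    have "exp (56 / \<eta>) > 1" using \<eta> by simp
    then show ?thesis unfolding q_def using q(1) by linarith
  qed
  have qpos: "q > 0" using q1 by simp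
  have qmono: "q powr a \<le> q powr b" if "a \<le> b" for a b using that q1 by simp
  have prodP: "real (\<Prod>P) \<le> q" "real (\<Prod>P) \<ge> 0" by (auto simp: q_def modulus_def prod_nonneg)
  have prodPe: "real (\<Prod>P) powr e \<le> q powr e" if "e \<ge> 0" for e
    using prodP that by (intro powr_mono2) auto
  have zq: "real z \<le> q" using z by (simp add: q_def)
  have zl: "q powr (1/4 + \<delta>) \<le> real z" using z by (simp add: q_def)
  have zpos: "real z > 0" using zl qpos by (smt (verit) powr_gt_zero)
  \<comment> \<open>The length of the multipliers is chosen so that
    \<open>Ar * Br = z * q powr (- \<delta> / 4)\<close>, which makes the shift error
    negligible.\<close>
  define Ar where "Ar = real z * q powr (- (1 / (2 * real r) + \<delta>/4))"
  define A where "A = nat \<lfloor>Ar\<rfloor>"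
  \<comment> \<open>With \<open>B ^ r\<close> of size \<open>sqrt q\<close> the two terms of the
    moment bound balance.\<close>
  define Br where "Br = q powr (1 / (2 * real r))"
  define B where "B = nat \<lceil>Br\<rceil>"
  have "q powr (1/4) \<le> q powr ((1/4 + \<delta>) + (- (1 / (2 * real r) + \<delta>/4)))"
    using r\<delta> \<delta> by (intro qmono) simp
  also have "\<dots> = q powr (1/4 + \<delta>) * q powr (- (1 / (2 * real r) + \<delta>/4))" by (rule powr_add)
  also have "\<dots> \<le> Ar" unfolding Ar_def using zl by (intro mult_right_mono) auto
  finally have Ar_ge: "q powr (1/4) \<le> Ar" .
  have "q powr (1/4) > q powr 0" using q1 by (intro powr_less_mono) auto
  then have "1 < q powr (1/4)" using qpos by simp
  then have Ar1: "Ar > 1" using Ar_ge by linarith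
  have Arz: "Ar \<le> real z"
  proof -
    have "0 \<le> 1 / (2 * real r)" by simp
    then have "q powr (- (1 / (2 * real r) + \<delta>/4)) \<le> q powr 0" using \<delta> by (intro qmono) linarith
    then have "q powr (- (1 / (2 * real r) + \<delta>/4)) \<le> 1" using qpos by simp
    then show ?thesis unfolding Ar_def using zpos by (intro mult_left_le) auto
  qed
  have ArA: "real A \<le> Ar" using Ar1 by (simp add: A_def)
  have Br1: "Br \<ge> 1" using q1 by (simp add: Br_def ge_one_powr_ge_zero)
  have B: "Br \<le> real B" "real B \<le> 2 * Br" "B > 0" 
  proof -
    have "real B = real_of_int \<lceil>Br\<rceil>" using Br1 by (simp add: B_def)
    then show "Br \<le> real B" "real B \<le> 2 * Br" using Br1 by linarith+
    then show "B > 0" using Br1 by linarith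
  qed
  define S where "S = primes_between (Ar powr (1 - \<eta>)) Ar - insert 2 P"
  define Q where "Q = real (card S)"
  have finS: "finite S" by (simp add: S_def)
  have Sa: "0 < a \<and> a \<le> A \<and> coprime a modulus" if a: "a \<in> S" for a
  proof -
    have pa: "prime a" "real a \<le> Ar" "a \<noteq> 2" "a \<notin> P" using a by (auto simp: S_def primes_between_def)
    have "coprime a (2 ^ 3)" using pa primes_coprime[of a 2] two_is_prime_nat by (simp only: coprime_power_right_iff) simp
    then have "coprime a 8" by simp
    moreover have "coprime a (\<Prod>P)" using pa prime_P by (intro prod_coprime_right) (metis primes_coprime)
    ultimately have "coprime a modulus" by (simp add: modulus_def)
    moreover have "a \<le> A" using pa by (simp add: A_def le_nat_floor)
    ultimately show ?thesis using pa prime_gt_0_nat by simp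
  qed
  have Sprime: "prime a" if "a \<in> S" for a using that by (simp add: S_def primes_between_def)
  \<comment> \<open>The first lower bound on the modulus gives
    \<open>ln Ar \<ge> 14 / \<eta>\<close>, as \<open>Ar \<ge> q powr (1/4)\<close>; the second
    ensures that removing 2 and the primes of \<open>P\<close>, at most
    \<open>C2 * q powr (1/16)\<close> in number, costs at most half of the primes.\<close>
  have Q_ge: "\<eta> / 4 * (Ar * q powr (- \<eta>)) \<le> Q"
  proof -
    have "ln q \<ge> 56 / \<eta>" using q(1) qpos by (simp add: q_def ln_ge_iff)
    then have "1/4 * ln q \<ge> 14 / \<eta>" by simp
    also have "1/4 * ln q = ln (q powr (1/4))" by (simp add: ln_powr)
    finally have "ln Ar \<ge> 14 / \<eta>" 
    proof (rule order.trans)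
      show "ln (q powr (1/4)) \<le> ln Ar" using Ar_ge qpos by (intro ln_mono) auto
    qed
    then have a1: "\<eta> / 2 * Ar powr (1 - \<eta>) \<le> real (card (primes_between (Ar powr (1 - \<eta>)) Ar))"
      using \<eta> Ar1 by (intro card_primes_between_ge) auto
    have "card (primes_between (Ar powr (1 - \<eta>)) Ar) \<le> card S + card (insert 2 P)"
      using diff_card_le_card_Diff[of "insert 2 P" "primes_between (Ar powr (1 - \<eta>)) Ar", OF finite.insertI[OF finite_P]]
      unfolding S_def by linarith
    then have "real (card (primes_between (Ar powr (1 - \<eta>)) Ar)) \<le> real (card S + card (insert 2 P))"
      by (rule of_nat_mono)
    then have a2: "real (card (primes_between (Ar powr (1 - \<eta>)) Ar)) \<le> Q + real (card (insert 2 P))"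
      by (simp only: of_nat_add Q_def)
    have a3: "real (card (insert 2 P)) \<le> 1 + real (card P)"
      by (simp add: card_insert_if finite_P)
    have a4: "1 + real (card P) \<le> 2 ^ card P"
    proof -
      have "Suc (card P) \<le> 2 ^ card P" using less_exp[of "card P"] by (simp add: Suc_le_eq)
      then have "real (Suc (card P)) \<le> real (2 ^ card P)" by (rule of_nat_mono)
      then show ?thesis by simp
    qed
    have a5: "2 ^ card P \<le> C2 * q powr (1/16)"
    proof -
      have "2 ^ card P \<le> C2 * real (\<Prod>P) powr (\<eta>/2)" using finite_P prime_P by (rule C2(2))
      also have "\<dots> \<le> C2 * q powr (\<eta>/2)" using C2(1) \<eta> by (intro mult_left_mono prodPe) auto
      also have "\<dots> \<le> C2 * q powr (1/16)" using C2(1) \<eta> by (intro mult_left_mono qmono) auto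
      finally show ?thesis .
    qed
    have a6: "C2 * q powr (1/16) \<le> \<eta> / 4 * Ar powr (1 - \<eta>)"
    proof -
      define x where "x = 4 * C2 / \<eta>"
      have x: "x > 0" using C2(1) \<eta> by (simp add: x_def)
      have "x = x powr (16 * (1/16))" using x by simp
      also have "\<dots> = (x powr 16) powr (1/16)" by (rule powr_powr[symmetric])
      also have "x powr 16 = x ^ 16" using x by (simp add: powr_numeral)
      finally have "x = (x ^ 16) powr (1/16)" .
      also have "(x ^ 16) powr (1/16) \<le> q powr (1/16)" using q(2) x by (intro powr_mono2) (auto simp: q_def x_def)
      finally have "C2 \<le> \<eta> / 4 * q powr (1/16)" using \<eta> by (simp add: x_def field_simps)
      then have "C2 * q powr (1/16) \<le> \<eta> / 4 * q powr (1/16) * q powr (1/16)" by (intro mult_right_mono) auto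
      also have "\<dots> = \<eta> / 4 * q powr (1/8)" by (simp flip: powr_add)
      also have "\<dots> \<le> \<eta> / 4 * (q powr (1/4)) powr (1 - \<eta>)"
        using \<eta> by (simp add: powr_powr mult_left_mono qmono)
      also have "\<dots> \<le> \<eta> / 4 * Ar powr (1 - \<eta>)"
        using \<eta> Ar_ge by (intro mult_left_mono powr_mono2) auto
      finally show ?thesis .
    qed
    have "\<eta> / 2 * Ar powr (1 - \<eta>) = \<eta> / 4 * Ar powr (1 - \<eta>) + \<eta> / 4 * Ar powr (1 - \<eta>)" by simp
    then have "\<eta> / 4 * Ar powr (1 - \<eta>) \<le> Q" using a1 a2 a3 a4 a5 a6 by linarith
    moreover have "Ar * q powr (- \<eta>) \<le> Ar powr (1 - \<eta>)"
    proof -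
      have "Ar powr (1 - \<eta>) = Ar * Ar powr (- \<eta>)" using Ar1 by (simp add: powr_diff powr_minus divide_inverse)
      moreover have "q powr (- \<eta>) \<le> Ar powr (- \<eta>)"
        using Ar1 Arz zq \<eta> by (intro powr_mono2') auto
      ultimately show ?thesis using Ar1 by simp
    qed
    then have "\<eta> / 4 * (Ar * q powr (- \<eta>)) \<le> \<eta> / 4 * Ar powr (1 - \<eta>)"
      using \<eta> by (intro mult_left_mono) auto
    ultimately show ?thesis by linarith
  qed
  have Qpos: "Q > 0"
    using Q_ge \<eta> Ar1 qpos by (smt (verit) mult_pos_pos powr_gt_zero divide_pos_pos)
  \<comment> \<open>The primes of \<open>S\<close> dividing \<open>v\<close> have product at most
    \<open>v \<le> q powr 2\<close>, so \<open>C2\<close> bounds their number. This is the gain from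
    using prime multipliers.\<close>
  define L where "L = C2 * q powr \<eta>"
  have L0: "L \<ge> 0" using C2 by (simp add: L_def)
  have Az: "real (A * z) \<le> Ar * real z" using ArA by (simp add: mult_right_mono)
  have L: "real (card {a \<in> S. a dvd v}) \<le> L" if v: "v \<in> {1..A*z}" for v
  proof -
    define D where "D = {a \<in> S. a dvd v}"
    have finD: "finite D" using finS by (simp add: D_def)
    have "\<Prod>D dvd v" using Sprime by (intro prod_primes_dvd_if_all_dvd finD) (auto simp: D_def)
    then have "\<Prod>D \<le> v" using v by (intro dvd_imp_le) auto
    then have "real (\<Prod>D) \<le> real v" by (rule of_nat_mono)
    also have "real v \<le> real (A * z)" using v by (intro of_nat_mono) simp
    also have "\<dots> \<le> Ar * real z" by (rule Az)
    also have "\<dots> \<le> q * q" using Arz zq Ar1 zpos by (intro mult_mono) auto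
    also have "\<dots> = q powr 2" using qpos by (simp add: power2_eq_square)
    finally have Dq: "real (\<Prod>D) \<le> q powr 2" .
    have "real (card D) \<le> real (2 ^ card D)" by (intro of_nat_mono less_imp_le less_exp)
    also have "\<dots> = 2 ^ card D" by simp
    also have "\<dots> \<le> C2 * real (\<Prod>D) powr (\<eta>/2)" by (intro C2(2) finD) (auto simp: D_def Sprime)
    also have "\<dots> \<le> C2 * (q powr 2) powr (\<eta>/2)"
      using Dq \<eta> C2(1) by (intro mult_left_mono powr_mono2) (auto intro: prod_nonneg)
    also have "\<dots> = L" by (simp add: L_def powr_powr)
    finally show ?thesis by (simp add: D_def)
  qed
  obtain W where W: "W \<ge> 0"
    "Q * real B * \<bar>\<Sum>n=1..z. \<psi> n\<bar> \<le> W + Q * real B * (2 * real A * real B)"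
    "W ^ (2*r) \<le> (Q * real z) ^ (2*r-2) * (Q * real z * ((real (A*z) / q + 1) * L))
       * (\<Sum>x<modulus. (\<Sum>b=1..B. \<psi> (x + b)) ^ (2*r))"
    unfolding Q_def q_def by (rule burgess_core[OF finS Sa L L0 r(1), where B = B])
  define M where "M = (\<Sum>x<modulus. (\<Sum>b=1..B. \<psi> (x + b)) ^ (2*r))"
  define c3 where "c3 = c1 + c2 * C1"
  have c12: "c1 \<ge> 1" "c2 \<ge> 0"
  proof -
    have "1 \<le> r ^ (2*r)" using r1 by simp
    then show "c1 \<ge> 1" unfolding c1_def by (metis of_nat_1 of_nat_mono)
  qed (simp add: c2_def)
  have M_le: "M \<le> real B ^ (2*r) * (c3 * q powr (1/2 + \<eta>))"
  proof -
    have m1: "M \<le> c1 * real B ^ r * q + c2 * (2 ^ (2*r) * (26 * real r + 10)) ^ card P * sqrt q * real B ^ (2*r)"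
      unfolding M_def c1_def c2_def q_def using r1 by (intro moment_bound) simp
    have m2: "c1 * real B ^ r * q \<le> c1 * real B ^ (2*r) * q powr (1/2)"
    proof -
      have "q powr (1/2) = Br ^ r" using r1 qpos by (simp add: Br_def powr_powr flip: powr_realpow)
      also have "\<dots> \<le> real B ^ r" using B Br1 by (intro power_mono) auto
      finally have "q powr (1/2) * q powr (1/2) \<le> real B ^ r * q powr (1/2)" by (intro mult_right_mono) auto
      then have "q \<le> real B ^ r * q powr (1/2)" using qpos by (simp flip: powr_add)
      then have "(c1 * real B ^ r) * q \<le> (c1 * real B ^ r) * (real B ^ r * q powr (1/2))"
        using c12 by (intro mult_left_mono) auto
      also have "\<dots> = c1 * real B ^ (2*r) * q powr (1/2)" by (simp add: mult_2 power_add)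
      finally show ?thesis .
    qed
    have m3: "c1 * real B ^ (2*r) * q powr (1/2) \<le> c1 * real B ^ (2*r) * q powr (1/2 + \<eta>)"
      using c12 \<eta> by (intro mult_left_mono qmono) auto
    have m4: "c2 * (2 ^ (2*r) * (26 * real r + 10)) ^ card P * sqrt q * real B ^ (2*r)
        \<le> c2 * (C1 * q powr \<eta>) * q powr (1/2) * real B ^ (2*r)"
    proof -
      have t: "(2 ^ (2*r) * (26 * real r + 10)) ^ card P \<le> C1 * q powr \<eta>"
        using C1 prodPe[of \<eta>] \<eta> mult_left_mono[of "real (\<Prod>P) powr \<eta>" "q powr \<eta>" C1] by linarith
      have sq: "sqrt q = q powr (1/2)" using qpos by (simp add: powr_half_sqrt)
      show ?thesis unfolding sq using t c12 by (intro mult_right_mono mult_left_mono) auto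
    qed
    have m5: "c2 * (C1 * q powr \<eta>) * q powr (1/2) * real B ^ (2*r) = c2 * C1 * q powr (1/2 + \<eta>) * real B ^ (2*r)"
      by (simp add: powr_add)
    have "M \<le> c1 * real B ^ (2*r) * q powr (1/2 + \<eta>) + c2 * C1 * q powr (1/2 + \<eta>) * real B ^ (2*r)"
      using m1 m2 m3 m4 m5 by linarith
    then show ?thesis by (simp add: c3_def algebra_simps)
  qed
  have c3: "c3 \<ge> 1" using c12 C1 by (simp add: c3_def add_increasing2)
  have c4: "c4 \<ge> 1"
  proof -
    define e where "e = 8 / \<eta>"
    have "e \<ge> 1" using \<eta> by (simp add: e_def field_simps)
    then have "1 \<le> e * C2" using mult_mono[of 1 e 1 C2] C2(1) by linarith
    then have "1 \<le> e * C2 * c3" using mult_mono[of 1 "e * C2" 1 c3] c3 by linarith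
    then show ?thesis by (simp only: c4_def c3_def e_def)
  qed
  have Arzq: "q powr (1/2 + \<delta>) \<le> Ar * real z"
  proof -
    have "q powr (1/2 + \<delta>) \<le> q powr ((1/4 + \<delta>) + (1/4 + \<delta>) + (- (1 / (2 * real r) + \<delta>/4)))"
      using r\<delta> \<delta> by (intro qmono) simp
    also have "\<dots> = q powr (1/4 + \<delta>) * q powr (1/4 + \<delta>) * q powr (- (1 / (2 * real r) + \<delta>/4))"
      by (simp only: powr_add)
    also have "\<dots> \<le> real z * real z * q powr (- (1 / (2 * real r) + \<delta>/4))"
      using zl by (intro mult_right_mono mult_mono) auto
    finally show ?thesis by (simp add: Ar_def mult_ac)
  qed
  \<comment> \<open>Since \<open>Ar * z \<ge> q powr (1/2 + \<delta>)\<close>, both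
    \<open>A * z / q\<close> and 1 are at most \<open>Ar * z / q powr (1/2 + \<delta>)\<close>. This
    is where \<open>z \<ge> q powr (1/4 + \<delta>)\<close> is decisive.\<close>
  have key: "real (A*z) / q + 1 \<le> Q * real z * (8 / \<eta> * q powr (\<eta> - 1/2 - \<delta>))"
  proof -
    have qd: "q powr (1/2 + \<delta>) \<le> q" using qmono[of "1/2 + \<delta>" 1] \<delta> q1 by simp
    have "Ar * real z * (8 / \<eta> * q powr (\<eta> - 1/2 - \<delta>)) * (\<eta> / 4 * q powr (- \<eta>))
        = 2 * (Ar * real z) * (q powr (\<eta> - 1/2 - \<delta>) * q powr (- \<eta>))"
      using \<eta> by (simp add: field_simps)
    also have "q powr (\<eta> - 1/2 - \<delta>) * q powr (- \<eta>) = q powr (- (1/2 + \<delta>))"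
      by (simp flip: powr_add)
    also have "\<dots> = 1 / q powr (1/2 + \<delta>)" by (simp only: powr_minus_divide)
    also have "2 * (Ar * real z) * (1 / q powr (1/2 + \<delta>)) = Ar * real z / q powr (1/2 + \<delta>) + Ar * real z / q powr (1/2 + \<delta>)"
      by simp
    also have "\<dots> \<ge> real (A*z) / q + 1"
    proof (rule add_mono)
      show "real (A*z) / q \<le> Ar * real z / q powr (1/2 + \<delta>)"
        using Az qd Ar1 zpos qpos by (intro frac_le) auto
      show "1 \<le> Ar * real z / q powr (1/2 + \<delta>)" using Arzq qpos by simp
    qed
    finally have "real (A*z) / q + 1 \<le> (\<eta> / 4 * (Ar * q powr (- \<eta>))) * real z * (8 / \<eta> * q powr (\<eta> - 1/2 - \<delta>))"
      by (simp only: mult_ac)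
    also have "\<dots> \<le> Q * real z * (8 / \<eta> * q powr (\<eta> - 1/2 - \<delta>))"
      using Q_ge \<eta> by (intro mult_right_mono) auto
    finally show ?thesis .
  qed
  define \<kappa>' where "\<kappa>' = \<delta> / (4 * real r)"
  have "W ^ (2*r) \<le> (Q * real z) ^ (2*r-2) * (Q * real z * ((real (A*z) / q + 1) * L)) * M"
    using W(3) by (simp only: M_def)
  also have "\<dots> \<le> (Q * real z) ^ (2*r-2) * (Q * real z * ((Q * real z * (8 / \<eta> * q powr (\<eta> - 1/2 - \<delta>))) * L))
      * (real B ^ (2*r) * (c3 * q powr (1/2 + \<eta>)))"
    using key M_le L0 Qpos zpos \<eta> q1
    by (intro mult_mono mult_left_mono mult_right_mono order.refl mult_nonneg_nonneg zero_le_power)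
       (auto simp: M_def intro!: sum_nonneg add_nonneg_nonneg)
  also have "\<dots> = ((Q * real z) ^ (2*r-2) * (Q * real z) * (Q * real z)) * real B ^ (2*r)
      * (8 / \<eta> * C2 * c3) * (q powr (\<eta> - 1/2 - \<delta>) * q powr \<eta> * q powr (1/2 + \<eta>))"
    by (simp only: L_def mult_ac)
  also have "(Q * real z) ^ (2*r-2) * (Q * real z) * (Q * real z) = (Q * real z) ^ (2*r)"
  proof -
    have "2*r = Suc (Suc (2*r-2))" using r1 by simp
    then show ?thesis by (metis mult.commute power_Suc)
  qed
  also have "q powr (\<eta> - 1/2 - \<delta>) * q powr \<eta> * q powr (1/2 + \<eta>) = q powr (3*\<eta> - \<delta>)"
    by (simp flip: powr_add)
  also have "8 / \<eta> * C2 * c3 = c4" by (simp add: c4_def c3_def)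
  also have "(Q * real z) ^ (2*r) * real B ^ (2*r) * c4 * q powr (3*\<eta> - \<delta>)
      \<le> (Q * real z) ^ (2*r) * real B ^ (2*r) * c4 ^ (2*r) * (q powr (- \<kappa>')) ^ (2*r)"
  proof (intro mult_mono order.refl)
    \<comment> \<open>The constant is enlarged so that the right-hand side becomes a perfect power
      of exponent \<open>2 * r\<close> and the root can be taken.\<close>
    show "c4 \<le> c4 ^ (2*r)" using c4 r1 by (intro self_le_power) auto
    have "(q powr (- \<kappa>')) ^ (2*r) = q powr (- \<kappa>' * real (2*r))"
      using qpos by (simp add: powr_powr flip: powr_realpow)
    also have "- \<kappa>' * real (2*r) = - \<delta> / 2" using r1 by (simp add: \<kappa>'_def)
    finally show "q powr (3*\<eta> - \<delta>) \<le> (q powr (- \<kappa>')) ^ (2*r)"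
      using \<delta> by (simp add: qmono \<eta>_def)
  qed (use Qpos zpos c4 in auto)
  also have "\<dots> = (Q * real z * real B * c4 * q powr (- \<kappa>')) ^ (2*r)" by (simp only: power_mult_distrib)
  finally have "W \<le> Q * real z * real B * c4 * q powr (- \<kappa>')"
    by (rule iffD1[OF power_mono_iff, rotated 3]) (use W(1) Qpos zpos c4 r1 in auto)
  then have "Q * real B * \<bar>\<Sum>n=1..z. \<psi> n\<bar> \<le> Q * real B * (real z * c4 * q powr (- \<kappa>') + 2 * real A * real B)"
    using W(2) by (simp add: algebra_simps)
  then have f1: "\<bar>\<Sum>n=1..z. \<psi> n\<bar> \<le> real z * c4 * q powr (- \<kappa>') + 2 * real A * real B"
    using Qpos B(3) by (subst (asm) mult_le_cancel_left_pos) auto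
  have "2 * real A * real B \<le> 2 * Ar * (2 * Br)" using ArA B Ar1 by (intro mult_mono) auto
  also have "\<dots> = 4 * real z * (q powr (- (1 / (2 * real r) + \<delta>/4)) * q powr (1 / (2 * real r)))"
    by (simp add: Ar_def Br_def)
  also have "q powr (- (1 / (2 * real r) + \<delta>/4)) * q powr (1 / (2 * real r)) = q powr (- (\<delta>/4))"
    by (simp flip: powr_add)
  also have "4 * real z * q powr (- (\<delta>/4)) \<le> 4 * real z * q powr (- \<kappa>')"
  proof (intro mult_left_mono qmono)
    have "\<delta> / (4 * real r) \<le> \<delta> / 4" using \<delta> r1 by (intro divide_left_mono) auto
    then show "- (\<delta>/4) \<le> - \<kappa>'" by (simp add: \<kappa>'_def)
  qed (use zpos in auto)
  finally have "\<bar>\<Sum>n=1..z. \<psi> n\<bar> \<le> real z * c4 * q powr (- \<kappa>') + 4 * real z * q powr (- \<kappa>')"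
    using f1 by linarith
  then show ?thesis by (simp add: \<kappa>'_def q_def algebra_simps)
qed

end

section \<open>Extension to sums of every length\<close>

context quadratic_symbol
begin

text \<open>Multiplication by the unit \<open>n0\<close> permutes the residues and changes the sign
  of every value.\<close>

lemma complete_\<psi>_sum_eq_0:
  assumes n0: "coprime n0 modulus" "\<psi> n0 = -1"
  shows "(\<Sum>x<modulus. \<psi> x) = 0"
proof -
  define q where "q = modulus"
  have q: "q > 0" using modulus_pos by (simp add: q_def)
  define h where "h = (\<lambda>x. n0 * x mod q)"
  have inj: "inj_on h {..<q}"
  proof (rule inj_onI)
    fix x y assume xy: "x \<in> {..<q}" "y \<in> {..<q}" "h x = h y"
    then have "[n0 * x = n0 * y] (mod q)" by (simp add: h_def cong_def)
    then have "[x = y] (mod q)" using n0(1) cong_mult_lcancel_nat unfolding q_def by blast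
    then show "x = y" using xy by (simp add: cong_def)
  qed
  have "h ` {..<q} = {..<q}"
  proof (rule card_subset_eq)
    show "h ` {..<q} \<subseteq> {..<q}" using q by (auto simp: h_def)
    show "card (h ` {..<q}) = card {..<q}" using inj by (rule card_image)
  qed simp
  then have bij: "bij_betw h {..<q} {..<q}" using inj by (simp add: bij_betw_def)
  have per: "\<psi> (x + q) = \<psi> x" for x by (simp add: q_def \<psi>_periodic)
  have "(\<Sum>x<q. \<psi> x) = (\<Sum>x<q. \<psi> (h x))" by (rule sum.reindex_bij_betw[OF bij, symmetric])
  also have "\<dots> = (\<Sum>x<q. \<psi> n0 * \<psi> x)"
    unfolding h_def periodic_mod[of \<psi> q, OF per] by (simp add: \<psi>_mult)
  also have "\<dots> = - (\<Sum>x<q. \<psi> x)" by (simp add: n0(2) sum_negf)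
  finally show ?thesis by (simp add: q_def)
qed

lemma \<psi>_sum_mod:
  assumes n0: "coprime n0 modulus" "\<psi> n0 = -1"
  shows "(\<Sum>n=1..z mod modulus. \<psi> n) = (\<Sum>n=1..z. \<psi> n)"
proof (rule periodic_mod)
  fix x
  have "(\<Sum>n=1..x + modulus. \<psi> n) = (\<Sum>n=1..x. \<psi> n) + (\<Sum>n<modulus. \<psi> (n + (x + 1)))"
  proof -
    have "(\<Sum>n=1..x + k. \<psi> n) = (\<Sum>n=1..x. \<psi> n) + (\<Sum>n<k. \<psi> (n + (x + 1)))" for k
      by (induction k) (simp_all add: add.commute)
    then show ?thesis .
  qed
  also have "(\<Sum>n<modulus. \<psi> (n + (x + 1))) = (\<Sum>n<modulus. \<psi> n)"
    by (rule sum_periodic_shift[of \<psi> modulus, OF \<psi>_periodic])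
  also have "\<dots> = 0" by (rule complete_\<psi>_sum_eq_0[OF n0])
  finally show "(\<Sum>n=1..x + modulus. \<psi> n) = (\<Sum>n=1..x. \<psi> n)" by simp
qed

lemma abs_\<psi>_sum_le: "\<bar>\<Sum>n=1..z. \<psi> n\<bar> \<le> real z"
proof -
  have "\<bar>\<Sum>n=1..z. \<psi> n\<bar> \<le> (\<Sum>n=1..z. 1)"
    using abs_\<psi>_le_1 by (intro order.trans[OF sum_abs] sum_mono)
  then show ?thesis by simp
qed

end

text \<open>Long sums are reduced modulo the period to a length \<open>w\<close> below the modulus.
  If \<open>w < q powr (1/4 + \<delta>)\<close>, the trivial bound
  \<open>w = w powr \<theta> * w powr (1 - \<theta>)\<close> already has the required form; for
  longer \<open>w\<close> the saving \<open>q powr (- \<theta>)\<close> outweighs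
  \<open>w powr \<theta>\<close>. Small moduli go into \<open>C\<close>.\<close>

theorem burgess:
  fixes \<delta> :: real
  assumes \<delta>: "0 < \<delta>" "\<delta> < 1/4"
  obtains C \<theta> where "C \<ge> 1" "0 < \<theta>" "\<theta> < 1"
    "\<And>\<kappa> P n0 z. quadratic_symbol \<kappa> P \<Longrightarrow> coprime n0 (quadratic_symbol.modulus P) \<Longrightarrow>
      quadratic_symbol.\<psi> \<kappa> P n0 = -1 \<Longrightarrow>
      \<bar>\<Sum>n=1..z. quadratic_symbol.\<psi> \<kappa> P n\<bar>
        \<le> C * real (quadratic_symbol.modulus P) powr ((1/4 + \<delta>) * \<theta>) * real z powr (1 - \<theta>)"
proof -
  obtain s :: nat where s: "2 / \<delta> \<le> real (2 ^ s)"
  proof -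
    obtain s :: nat where "2 / \<delta> < 2 ^ s" using real_arch_pow[of 2 "2 / \<delta>"] by auto
    then show ?thesis by (intro that[of s]) simp
  qed
  define r where "r = (2::nat) ^ s"
  have r1: "r \<ge> 1" by (simp add: r_def)
  define \<eta> where "\<eta> = \<delta> / 16"
  have \<eta>: "\<eta> > 0" using \<delta> by (simp add: \<eta>_def)
  define K where "K = 2 ^ (2*r) * (26 * real r + 10)"
  have "1 * 1 \<le> K" unfolding K_def by (intro mult_mono) auto
  then have K: "K \<ge> 1" by simp
  obtain C1 where C1: "C1 \<ge> 1"
    "\<And>P. finite P \<Longrightarrow> (\<And>p. p \<in> P \<Longrightarrow> prime p) \<Longrightarrow> K ^ card P \<le> C1 * real (\<Prod>P) powr \<eta>"
    using power_card_primes_le[OF K \<eta>] by metis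
  have \<eta>2: "\<eta>/2 > 0" using \<eta> by simp
  obtain C2 where C2: "C2 \<ge> 1"
    "\<And>P. finite P \<Longrightarrow> (\<And>p. p \<in> P \<Longrightarrow> prime p) \<Longrightarrow> 2 ^ card P \<le> C2 * real (\<Prod>P) powr (\<eta>/2)"
    using power_card_primes_le[of 2, OF _ \<eta>2] by auto
  define c4 where "c4 = 8 / \<eta> * C2 * (real (r ^ (2*r)) + 8 * real (2*r) * 2 ^ (2*r) * C1)"
  have c4: "c4 \<ge> 0" using \<eta> C2 C1 by (simp add: c4_def)
  define q0 where "q0 = max (exp (56 / \<eta>)) ((4 * C2 / \<eta>) ^ 16)"
  define \<theta> where "\<theta> = \<delta> / (4 * real r)"
  have \<theta>: "0 < \<theta>" "\<theta> < 1"
  proof -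
    show "0 < \<theta>" using \<delta> r1 by (simp add: \<theta>_def)
    have "\<delta> / (4 * real r) \<le> \<delta> / 4" using \<delta> r1 by (intro divide_left_mono) auto
    then show "\<theta> < 1" using \<delta> by (simp add: \<theta>_def)
  qed
  define C where "C = max 1 (max q0 (c4 + 4))"
  show ?thesis
  proof (rule that[OF _ \<theta>, of C])
    show "C \<ge> 1" by (simp add: C_def)
    fix \<kappa> P n0 z
    assume qs: "quadratic_symbol \<kappa> P" and n0: "coprime n0 (quadratic_symbol.modulus P)" "quadratic_symbol.\<psi> \<kappa> P n0 = -1"
    interpret quadratic_symbol \<kappa> P by (rule qs)
    define q where "q = real modulus"
    have q1: "q \<ge> 1" using modulus_pos by (simp add: q_def Suc_le_eq)
    have C1': "C \<ge> 1" "C \<ge> q0" "C \<ge> c4 + 4" by (auto simp: C_def)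
    define w where "w = z mod modulus"
    have w: "w < modulus" "w \<le> z" using modulus_pos by (auto simp: w_def)
    have "\<bar>\<Sum>n=1..w. \<psi> n\<bar> \<le> C * q powr ((1/4 + \<delta>) * \<theta>) * real w powr (1 - \<theta>)"
    proof (cases "w = 0")
      case False
      then have w0: "real w > 0" by simp
      have wpow: "real w = real w powr \<theta> * real w powr (1 - \<theta>)" using w0 by (simp flip: powr_add)
      have split: "real w * b \<le> C * q powr ((1/4 + \<delta>) * \<theta>) * real w powr (1 - \<theta>)"
        if "real w powr \<theta> * b \<le> C * q powr ((1/4 + \<delta>) * \<theta>)" for b
      proof -
        have "real w * b = (real w powr \<theta> * b) * real w powr (1 - \<theta>)"
          by (subst wpow) (simp only: mult_ac)
        also have "\<dots> \<le> C * q powr ((1/4 + \<delta>) * \<theta>) * real w powr (1 - \<theta>)"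
          by (rule mult_right_mono[OF that]) simp
        finally show ?thesis .
      qed
      have qe: "q powr e \<ge> 1" if "e \<ge> 0" for e using q1 that by (simp add: ge_one_powr_ge_zero)
      have triv: "\<bar>\<Sum>n=1..w. \<psi> n\<bar> \<le> real w * 1" using abs_\<psi>_sum_le[of w] by simp
      consider "q < q0" | "real w < q powr (1/4 + \<delta>)" | "q \<ge> q0" "q powr (1/4 + \<delta>) \<le> real w" by linarith
      then show ?thesis
      proof cases
        case 1
        have "real w powr \<theta> \<le> q0 powr \<theta>" using 1 w \<theta> by (intro powr_mono2) (auto simp: q_def)
        also have "\<dots> \<le> q0 powr 1" using 1 q1 \<theta> by (intro powr_mono) auto
        also have "\<dots> = q0" using 1 q1 by simp
        also have "\<dots> \<le> C * 1" using C1' by simp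
        also have "\<dots> \<le> C * q powr ((1/4 + \<delta>) * \<theta>)"
          using C1' \<theta> \<delta> by (intro mult_left_mono qe) auto
        finally have "real w powr \<theta> * 1 \<le> C * q powr ((1/4 + \<delta>) * \<theta>)" by simp
        from order.trans[OF triv split[OF this]] show ?thesis .
      next
        case 2
        have "real w powr \<theta> \<le> (q powr (1/4 + \<delta>)) powr \<theta>" using 2 \<theta> by (intro powr_mono2) auto
        also have "\<dots> = 1 * q powr ((1/4 + \<delta>) * \<theta>)" by (simp add: powr_powr)
        also have "\<dots> \<le> C * q powr ((1/4 + \<delta>) * \<theta>)" using C1' by (intro mult_right_mono) auto
        finally have "real w powr \<theta> * 1 \<le> C * q powr ((1/4 + \<delta>) * \<theta>)" by simp
        from order.trans[OF triv split[OF this]] show ?thesis .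
      next
        case 3
        have qq: "real modulus \<ge> exp (56 / (\<delta> / 16))" "real modulus \<ge> (4 * C2 / (\<delta> / 16)) ^ 16"
          using 3(1) by (auto simp: q0_def q_def \<eta>_def)
        have "\<bar>\<Sum>n=1..w. \<psi> n\<bar> \<le> (c4 + 4) * real w * q powr (- \<theta>)"
          unfolding c4_def \<eta>_def q_def \<theta>_def
          by (rule burgess_large[OF \<delta> r_def _ C1(1) _ C2(1) _ qq])
             (use s C1(2)[OF finite_P prime_P] C2(2) 3(2) w in \<open>simp_all add: r_def K_def \<eta>_def q_def\<close>)
        then have b: "\<bar>\<Sum>n=1..w. \<psi> n\<bar> \<le> real w * ((c4 + 4) * q powr (- \<theta>))" by (simp only: mult_ac)
        have "real w powr \<theta> * ((c4 + 4) * q powr (- \<theta>)) \<le> q powr \<theta> * ((c4 + 4) * q powr (- \<theta>))"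
          using w \<theta> c4 by (intro mult_right_mono powr_mono2) (auto simp: q_def)
        also have "\<dots> = (c4 + 4) * (q powr \<theta> * q powr (- \<theta>))" by (simp only: mult_ac)
        also have "q powr \<theta> * q powr (- \<theta>) = 1" using q1 by (simp flip: powr_add)
        also have "(c4 + 4) * 1 \<le> C * q powr ((1/4 + \<delta>) * \<theta>)"
          using C1' c4 \<theta> \<delta> by (intro mult_mono qe) auto
        finally have "real w powr \<theta> * ((c4 + 4) * q powr (- \<theta>)) \<le> C * q powr ((1/4 + \<delta>) * \<theta>)" .
        from order.trans[OF b split[OF this]] show ?thesis .
      qed
    qed simp
    also have "\<dots> \<le> C * q powr ((1/4 + \<delta>) * \<theta>) * real z powr (1 - \<theta>)"
      using w \<theta> C1' by (intro mult_left_mono powr_mono2) auto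
    finally show "\<bar>\<Sum>n=1..z. \<psi> n\<bar> \<le> C * real modulus powr ((1/4 + \<delta>) * \<theta>) * real z powr (1 - \<theta>)"
      using \<psi>_sum_mod[OF n0, of z] by (simp add: w_def q_def)
  qed
qed

section \<open>Real characters as products of quadratic symbols\<close>

lemma coprime_if_no_common_prime:
  fixes a b :: nat
  assumes "\<And>p. prime p \<Longrightarrow> p dvd a \<Longrightarrow> p dvd b \<Longrightarrow> False"
  shows "coprime a b"
proof (rule ccontr)
  assume "\<not> coprime a b"
  then have "gcd a b \<noteq> 1" using coprime_iff_gcd_eq_1 by blast
  then obtain p where "prime p" "p dvd gcd a b" using prime_factor_nat by blast
  then show False using assms[of p] by simp
qed

lemma dvd_power_if_prime_divisors:
  fixes m d :: nat
  assumes "m > 0" "\<And>p. prime p \<Longrightarrow> p dvd m \<Longrightarrow> p dvd d"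
  shows "\<exists>k. m dvd d ^ k"
  using assms
proof (induction m rule: less_induct)
  case (less m)
  show ?case
  proof (cases "m = 1")
    case False
    then obtain p where p: "prime p" "p dvd m" using prime_factor_nat by blast
    then obtain m' where m': "m = p * m'" by (elim dvdE)
    have "m' < m" "m' > 0" using less.prems(1) p prime_gt_1_nat[of p] by (auto simp: m')
    then obtain k where "m' dvd d ^ k" using less m' by (metis dvd_mult)
    then have "m dvd d ^ Suc k" using less.prems(2)[OF p] by (simp add: m' mult_dvd_mono)
    then show ?thesis by blast
  qed (auto intro: exI[of _ 0])
qed

text \<open>In \<open>y ^ n - 1 = (y - 1) * (\<Sum>i<n. y ^ i)\<close> the second factor is
  congruent to \<open>n\<close> modulo \<open>n\<close>, hence divisible by \<open>n\<close>, so
  each further power gains one factor \<open>d = n\<close>.\<close>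

lemma power_dvd_power_minus_1:
  fixes x d :: int and a n :: nat
  assumes n: "d = int n" and "d dvd x - 1"
  shows "d ^ Suc a dvd x ^ (n ^ a) - 1"
proof (induction a)
  case (Suc a)
  define y where "y = x ^ (n ^ a)"
  have y: "d ^ Suc a dvd y - 1" using Suc by (simp add: y_def)
  then have dy: "d dvd y - 1" by (metis dvd_mult_left power_Suc)
  have "d dvd y ^ i - 1" for i
    using dy by (metis dvd_mult2 power_diff_1_eq dvd_trans dvd_triv_left)
  then have "d dvd (\<Sum>i<n. y ^ i - 1) + int n"
    unfolding n by (intro dvd_add dvd_sum) auto
  then have "d dvd (\<Sum>i<n. y ^ i)" by (simp add: sum_subtractf)
  then have "d ^ Suc a * d dvd (y - 1) * (\<Sum>i<n. y ^ i)" using y by (intro mult_dvd_mono)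
  also have "(y - 1) * (\<Sum>i<n. y ^ i) = y ^ n - 1" by (rule power_diff_1_eq[symmetric])
  finally show ?case by (simp add: y_def mult.commute flip: power_mult)
qed (use assms in simp)

text \<open>Lifting from the root 1 modulo 8. If the quotient \<open>t\<close> is odd, adding
  \<open>2 ^ (k + 2)\<close> to the odd number \<open>y\<close> changes the square by an odd
  multiple of \<open>2 ^ (k + 3)\<close>, up to a multiple of \<open>2 ^ (k + 4)\<close>, and so
  repairs the parity.\<close>

lemma square_root_mod_power_2:
  fixes n :: int
  assumes "8 dvd n - 1"
  shows "\<exists>y. 2 ^ (k + 3) dvd y\<^sup>2 - n"
proof (induction k)
  case 0
  have "8 dvd 1\<^sup>2 - n" using assms by (metis dvd_diff_commute power_one)
  then show ?case by (intro exI[of _ 1]) simp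
next
  case (Suc k)
  then obtain y t where t: "y\<^sup>2 - n = 2 ^ (k + 3) * t" by (auto elim!: dvdE)
  have oddn: "odd n"
  proof -
    have "2 dvd n - 1" using assms by (rule dvd_trans[rotated]) simp
    then show ?thesis by presburger
  qed
  have "even (2 ^ (k + 3) * t)" by simp
  then have "even (y\<^sup>2 - n)" by (simp only: t)
  then have oddy: "odd y" using oddn by simp
  show ?case
  proof (cases "even t")
    case True
    then obtain t' where "t = 2 * t'" by (elim evenE)
    then have "y\<^sup>2 - n = 2 ^ (Suc k + 3) * t'" using t by (simp add: power_add)
    then show ?thesis by (metis dvd_triv_left)
  next
    case False
    define u where "u = (2::int) ^ k"
    have "even (t + y + 2 * u)" using False oddy by simp
    then obtain t' where t': "t + y + 2 * u = 2 * t'" by (elim evenE)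
    have "(y + 4 * u)\<^sup>2 - n = (y\<^sup>2 - n) + 8 * u * y + 16 * u\<^sup>2"
      by (simp add: power2_eq_square algebra_simps)
    also have "\<dots> = 8 * u * (t + y + 2 * u)"
      using t by (simp add: u_def power_add power2_eq_square algebra_simps)
    also have "\<dots> = 2 ^ (Suc k + 3) * t'" unfolding t' by (simp add: u_def power_add)
    finally show ?thesis by (metis dvd_triv_left)
  qed
qed

locale real_character =
  fixes M :: nat and \<chi> :: "nat \<Rightarrow> real"
  assumes M_pos: "M > 0" and M8: "8 dvd M"
    and \<chi>_periodic: "\<And>n. \<chi> (n + M) = \<chi> n" and \<chi>_mult: "\<And>m n. \<chi> (m * n) = \<chi> m * \<chi> n"
    and \<chi>_values: "\<And>n. coprime n M \<Longrightarrow> \<chi> n = 1 \<or> \<chi> n = -1"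
begin

definition R :: "nat set" where "R = {p. prime p \<and> odd p \<and> p dvd M}"

text \<open>The expected period: the conductor of a real character divides 8 times the odd radical
  of the modulus.\<close>

definition Q :: nat where "Q = 8 * \<Prod>R"

lemma finite_R: "finite R"
  unfolding R_def using M_pos by (auto intro: finite_subset[of _ "{..M}"] dest: dvd_imp_le)

lemma odd_prod_R: "odd (\<Prod>R)"
proof -
  have "\<forall>p\<in>R. odd p" by (auto simp: R_def)
  then show ?thesis using even_prod_iff[OF finite_R, of "\<lambda>p. p"] by blast
qed

lemma prime_dvd_Q: assumes "prime p" "p dvd M" shows "p dvd Q"
proof (cases "odd p")
  case True
  then have "p \<in> R" using assms by (simp add: R_def)
  then show ?thesis unfolding Q_def using finite_R by (intro dvd_mult dvd_prodI)
next
  case False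
  then have "p = 2" using assms(1) primes_dvd_imp_eq two_is_prime_nat by blast
  then show ?thesis by (simp add: Q_def)
qed

lemma Q_dvd_M: "Q dvd M"
  unfolding Q_def
proof (rule divides_mult)
  show "\<Prod>R dvd M" by (rule prod_primes_dvd_if_all_dvd[OF finite_R]) (auto simp: R_def)
  have "coprime (2 ^ 3) (\<Prod>R)" using odd_prod_R by (simp only: coprime_power_left_iff) simp
  then show "coprime 8 (\<Prod>R)" by simp
qed (rule M8)

lemma coprime_M_iff_Q: "coprime n M \<longleftrightarrow> coprime n Q"
proof
  assume "coprime n M"
  from coprime_divisors[OF dvd_refl Q_dvd_M this] show "coprime n Q" .
next
  assume "coprime n Q"
  show "coprime n M"
  proof (rule coprime_if_no_common_prime)
    fix p assume p: "prime p" "p dvd n" "p dvd M"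
    then have "p dvd gcd n Q" using prime_dvd_Q[of p] by simp
    then show False using \<open>coprime n Q\<close> p(1) not_prime_unit coprime_common_divisor by (metis dvd_gcdD1 dvd_gcdD2)
  qed
qed

lemma \<chi>_1: "\<chi> 1 = 1"
proof -
  have "\<chi> 1 = \<chi> 1 * \<chi> 1" using \<chi>_mult[of 1 1] by simp
  then show ?thesis using \<chi>_values[of 1] by auto
qed

lemma \<chi>_power: "\<chi> (n ^ k) = \<chi> n ^ k"
  by (induction k) (auto simp: \<chi>_mult \<chi>_1[unfolded One_nat_def])

text \<open>Some odd power \<open>n ^ k\<close> is a square modulo \<open>M\<close>. Modulo the odd
  part it becomes 1 for \<open>k\<close> a high enough power of \<open>\<Prod>R\<close>, and modulo
  the power of 2 it is a square because it is 1 modulo 8. Then \<open>\<chi> n ^ k\<close> is the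
  square of a real number, and \<open>k\<close> odd forces \<open>\<chi> n = 1\<close>.\<close>

lemma \<chi>_eq_1:
  assumes n: "[n = 1] (mod Q)"
  shows "\<chi> n = 1"
proof -
  have "coprime n Q" using cong_imp_coprime[OF cong_sym[OF n]] by simp
  then have cop: "coprime n M" by (simp add: coprime_M_iff_Q)
  define e where "e = multiplicity 2 M"
  have e3: "e \<ge> 3"
  proof -
    have "2 ^ 3 dvd M" using M8 by simp
    then show ?thesis unfolding e_def using M_pos by (intro multiplicity_geI) auto
  qed
  obtain m where m: "M = 2 ^ e * m" unfolding e_def using multiplicity_dvd[of 2 M] by (rule dvdE)
  have m0: "m > 0" using M_pos m by simp
  have oddm: "odd m"
  proof -
    have "2 ^ Suc e dvd M \<longleftrightarrow> Suc e \<le> multiplicity 2 M"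
      using M_pos by (intro power_dvd_iff_le_multiplicity) auto
    then have "\<not> 2 ^ Suc e dvd M" by (simp add: e_def)
    then show ?thesis by (auto simp: m elim!: evenE)
  qed
  have "\<exists>k. m dvd (\<Prod>R) ^ k"
  proof (rule dvd_power_if_prime_divisors[OF m0])
    fix p assume p: "prime p" "p dvd m"
    then have "odd p" using oddm dvd_trans by blast
    moreover have "p dvd M" unfolding m using p(2) by (rule dvd_mult)
    ultimately have "p \<in> R" using p(1) by (simp add: R_def)
    then show "p dvd \<Prod>R" using finite_R by (intro dvd_prodI)
  qed
  then obtain a where "m dvd (\<Prod>R) ^ a" by blast
  then have ma: "m dvd (\<Prod>R) ^ Suc a" by simp
  define k where "k = (\<Prod>R) ^ a"
  have oddk: "odd k" using odd_prod_R by (simp add: k_def)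
  have n8: "[n = 1] (mod 8)" and nR: "[n = 1] (mod \<Prod>R)"
    using n unfolding Q_def by (auto intro: cong_dvd_modulus_nat)
  have "int (\<Prod>R) dvd int n - 1" using nR by (simp add: cong_iff_dvd_diff flip: cong_int_iff)
  then have "int (\<Prod>R) ^ Suc a dvd int n ^ k - 1" unfolding k_def by (intro power_dvd_power_minus_1) auto
  moreover have "int m dvd int (\<Prod>R) ^ Suc a" using ma by (metis int_dvd_int_iff of_nat_power)
  ultimately have "int m dvd int n ^ k - 1" using dvd_trans by blast
  then have "[int (n ^ k) = int 1] (mod int m)" by (simp add: cong_iff_dvd_diff)
  then have nkm: "[n ^ k = 1] (mod m)" by (simp only: cong_int_iff)
  have "[n ^ k = 1 ^ k] (mod 8)" using n8 by (rule cong_pow)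
  then have "[int (n ^ k) = int 1] (mod int 8)" by (simp only: cong_int_iff power_one)
  then have "8 dvd int (n ^ k) - 1" by (simp add: cong_iff_dvd_diff)
  from square_root_mod_power_2[OF this, of "e - 3"] obtain y where y: "2 ^ e dvd y\<^sup>2 - int (n ^ k)"
    using e3 by auto
  define y' where "y' = nat (y mod 2 ^ e)"
  have "int y' = y mod 2 ^ e" by (simp add: y'_def)
  then have "[int y' = y] (mod 2 ^ e)" by (simp add: cong_def)
  then have "[int y' ^ 2 = y ^ 2] (mod 2 ^ e)" by (rule cong_pow)
  also have "[y ^ 2 = int (n ^ k)] (mod 2 ^ e)" using y by (simp add: cong_iff_dvd_diff)
  finally have "[int (y' ^ 2) = int (n ^ k)] (mod int (2 ^ e))" by simp
  then have y'2: "[y' ^ 2 = n ^ k] (mod 2 ^ e)" by (simp only: cong_int_iff)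
  have cop2: "coprime (2 ^ e) m" using oddm by simp
  obtain x where x: "[x = y'] (mod 2 ^ e)" "[x = 1] (mod m)"
    using binary_chinese_remainder_nat[OF cop2, of y' 1] by blast
  have "[x ^ 2 = n ^ k] (mod 2 ^ e)" using cong_trans[OF cong_pow[OF x(1), of 2] y'2] .
  moreover have "[x ^ 2 = n ^ k] (mod m)"
  proof -
    have "[x ^ 2 = 1 ^ 2] (mod m)" using x(2) by (rule cong_pow)
    then have "[x ^ 2 = 1] (mod m)" by (simp only: power_one)
    from cong_trans[OF this cong_sym[OF nkm]] show ?thesis .
  qed
  ultimately have "[x ^ 2 = n ^ k] (mod M)" unfolding m using cop2 coprime_cong_mult_nat by blast
  then have "\<chi> (x ^ 2) = \<chi> (n ^ k)" by (rule periodic_cong[of \<chi> M, OF \<chi>_periodic])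
  then have "\<chi> n ^ k = (\<chi> x)\<^sup>2" by (simp only: \<chi>_power)
  then have "\<chi> n ^ k \<ge> 0" by simp
  then show ?thesis using \<chi>_values[OF cop] oddk by auto
qed

lemma \<chi>_cong:
  assumes "[n = n'] (mod Q)" "coprime n M"
  shows "\<chi> n = \<chi> n'"
proof -
  have "coprime n Q" using assms(2) coprime_M_iff_Q by simp
  then obtain i where i: "[n * i = 1] (mod Q)" using cong_solve_coprime_nat[of n Q] by auto
  have "[n' * i = n * i] (mod Q)" by (intro cong_mult cong_refl cong_sym[OF assms(1)])
  then have "[n' * i = 1] (mod Q)" using i cong_trans by blast
  then have "\<chi> n * \<chi> i = 1" "\<chi> n' * \<chi> i = 1" using \<chi>_eq_1 i by (simp_all only: \<chi>_mult[symmetric])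
  then have "\<chi> n * \<chi> i = \<chi> n' * \<chi> i" "\<chi> i \<noteq> 0" by auto
  then show ?thesis by simp
qed

text \<open>The character is split by the Chinese remainder theorem into components at 8 and at the
  odd primes. A nontrivial component at an odd prime must be the Legendre symbol; the trivial ones
  are dropped, which leaves \<open>P\<close>.\<close>

lemma eq_quadratic_symbol:
  obtains \<kappa> P where "quadratic_symbol \<kappa> P" "quadratic_symbol.modulus P dvd M"
    "\<And>n. coprime n M \<Longrightarrow> \<chi> n = quadratic_symbol.\<psi> \<kappa> P n"
proof -
  define D where "D = insert 8 R"
  have finD: "finite D" using finite_R by (simp add: D_def)
  have 8: "8 \<notin> R" by (simp add: R_def)
  have QD: "Q = \<Prod>D" using finite_R 8 by (simp add: Q_def D_def)
  have copD: "coprime d d'" if "d \<in> D" "d' \<in> D" "d \<noteq> d'" for d d'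
  proof -
    have c8: "coprime 8 p" if "p \<in> R" for p
    proof -
      have "odd p" using that by (simp add: R_def)
      then have "coprime (2 ^ 3) p" by (simp only: coprime_power_left_iff) simp
      then show ?thesis by simp
    qed
    have "coprime p p'" if "p \<in> R" "p' \<in> R" "p \<noteq> p'" for p p'
      using that by (intro primes_coprime) (auto simp: R_def)
    then show ?thesis using that c8 by (auto simp: D_def coprime_commute)
  qed
  define co where "co = (\<lambda>d. \<Prod>(D - {d}))"
  have co: "Q = d * co d" "coprime d (co d)" if "d \<in> D" for d
  proof -
    show "Q = d * co d" unfolding QD co_def using finD that by (intro prod.remove)
    show "coprime d (co d)" unfolding co_def using copD that by (intro prod_coprime_right) auto
  qed
  have dvd_co: "d' dvd co d" if "d' \<in> D" "d \<in> D" "d' \<noteq> d" for d d'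
    unfolding co_def using that finD by (intro dvd_prodI) auto
  have "\<exists>x. [x = n] (mod d) \<and> [x = 1] (mod co d)" if "d \<in> D" for d n
    using binary_chinese_remainder_nat[OF co(2)[OF that]] by blast
  then obtain c where c: "\<And>d n. d \<in> D \<Longrightarrow> [c d n = n] (mod d)" "\<And>d n. d \<in> D \<Longrightarrow> [c d n = 1] (mod co d)"
    by metis
  have c_cop: "coprime (c d n) M" if d: "d \<in> D" and n: "coprime n d" for d n
  proof -
    have "coprime (c d n) d" using cong_imp_coprime[OF cong_sym[OF c(1)[OF d]] n] .
    moreover have "coprime (c d n) (co d)" using cong_imp_coprime[OF cong_sym[OF c(2)[OF d]]] by simp
    ultimately have "coprime (c d n) (d * co d)" by simp
    then show ?thesis using co(1)[OF d] by (simp add: coprime_M_iff_Q)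
  qed
  \<comment> \<open>The component at \<open>d\<close> evaluates \<open>\<chi>\<close> at an integer
    that is \<open>n\<close> modulo \<open>d\<close> and 1 modulo the cofactor of \<open>d\<close>
    in \<open>Q\<close>.\<close>
  define loc where "loc = (\<lambda>d n. \<chi> (c d n))"
  have loc_cong: "loc d n = loc d n'" if d: "d \<in> D" and n: "coprime n d" "[n = n'] (mod d)" for d n n'
    unfolding loc_def
  proof (rule \<chi>_cong[OF _ c_cop[OF d n(1)]])
    have "[c d n = c d n'] (mod d)" using c(1)[OF d] n(2) by (meson cong_sym cong_trans)
    moreover have "[c d n = c d n'] (mod co d)" using c(2)[OF d] by (meson cong_sym cong_trans)
    ultimately show "[c d n = c d n'] (mod Q)"
      using co[OF d] coprime_cong_mult_nat by metis
  qed
  have loc_mult: "loc d (n * n') = loc d n * loc d n'" if d: "d \<in> D" and n: "coprime n d" "coprime n' d" for d n n'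
    unfolding loc_def \<chi>_mult[symmetric]
  proof (rule \<chi>_cong)
    have "[c d n * c d n' = n * n'] (mod d)" using c(1)[OF d] by (intro cong_mult)
    then have 1: "[c d (n * n') = c d n * c d n'] (mod d)" using c(1)[OF d] by (meson cong_sym cong_trans)
    have "[c d n * c d n' = 1 * 1] (mod co d)" using c(2)[OF d] by (intro cong_mult)
    then have "[c d n * c d n' = 1] (mod co d)" by simp
    then have "[c d (n * n') = c d n * c d n'] (mod co d)" using c(2)[OF d] by (meson cong_sym cong_trans)
    then show "[c d (n * n') = c d n * c d n'] (mod Q)"
      using 1 co[OF d] coprime_cong_mult_nat by metis
    show "coprime (c d (n * n')) M" using c_cop[OF d] n by simp
  qed
  have loc_values: "loc d n = 1 \<or> loc d n = -1" if "d \<in> D" "coprime n d" for d n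
    unfolding loc_def using \<chi>_values c_cop that by blast
  have \<chi>_loc: "\<chi> n = (\<Prod>d\<in>D. loc d n)" if n: "coprime n M" for n
  proof -
    have "[(\<Prod>d\<in>D. c d n) = n] (mod d)" if d: "d \<in> D" for d
    proof -
      have "(\<Prod>d\<in>D. c d n) = c d n * (\<Prod>d'\<in>D-{d}. c d' n)" using finD d by (intro prod.remove)
      moreover have "[c d n * (\<Prod>d'\<in>D-{d}. c d' n) = n * (\<Prod>d'\<in>D-{d}. 1)] (mod d)"
      proof (intro cong_mult cong_prod c d)
        fix d' assume "d' \<in> D - {d}"
        then show "[c d' n = 1] (mod d)"
          using c(2)[of d' n] dvd_co[of d d'] d by (auto intro: cong_dvd_modulus_nat)
      qed
      ultimately show ?thesis by simp
    qed
    then have "[(\<Prod>d\<in>D. c d n) = n] (mod \<Prod>D)"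
      using copD by (intro coprime_cong_prod_nat) auto
    then have "[n = (\<Prod>d\<in>D. c d n)] (mod Q)" by (simp add: QD cong_sym)
    then have "\<chi> n = \<chi> (\<Prod>d\<in>D. c d n)" using n by (rule \<chi>_cong)
    also have "\<dots> = (\<Prod>d\<in>D. loc d n)"
      using finD by (induction D rule: finite_induct) (use \<chi>_1 in \<open>simp_all add: \<chi>_mult loc_def\<close>)
    finally show ?thesis .
  qed
  \<comment> \<open>Quadratic residues have component 1 since their square roots have component 1 or
    -1. Hence \<open>n0\<close> is a nonresidue, and any nonresidue times \<open>n0\<close> is a
    residue, which determines all values.\<close>
  have loc_leg: "loc p n = real_of_int (Legendre (int n) (int p))"
    if p: "p \<in> R" and n: "coprime n p" and n0: "coprime n0 p" "loc p n0 = -1" for p n n0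
  proof -
    have pD: "p \<in> D" and pr: "prime p" "odd p" using p by (auto simp: D_def R_def)
    have nz: "Legendre (int n) (int p) = 1 \<or> Legendre (int n) (int p) = -1" if "coprime n p" for n
    proof -
      have "\<not> p dvd n" using that pr by (metis coprime_common_divisor_nat dvd_refl not_prime_1)
      then have "\<not> [int n = 0] (mod int p)" by (simp add: cong_0_iff)
      then show ?thesis by (simp add: Legendre_def)
    qed
    have sq: "loc p n = 1" if n: "coprime n p" and L: "Legendre (int n) (int p) = 1" for n
    proof -
      have "QuadRes (int p) (int n)" using L by (auto simp: Legendre_def split: if_splits)
      then obtain y where y: "[y\<^sup>2 = int n] (mod int p)" by (auto simp: QuadRes_def)
      have p0: "int p > 0" using pr prime_gt_0_nat by simp
      define y' where "y' = nat (y mod int p)"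
      have "int y' = y mod int p" using p0 by (simp add: y'_def)
      then have "[int y' = y] (mod int p)" by (simp add: cong_def)
      then have "[int y' ^ 2 = y ^ 2] (mod int p)" by (rule cong_pow)
      then have "[int (y' * y') = int n] (mod int p)" using y by (simp add: power2_eq_square) (meson cong_trans)
      then have yn: "[y' * y' = n] (mod p)" by (simp only: cong_int_iff)
      have cyy: "coprime (y' * y') p" by (rule cong_imp_coprime[OF cong_sym[OF yn] n])
      then have cy: "coprime y' p" by simp
      have "loc p n = loc p (y' * y')" using loc_cong[OF pD cyy yn] by simp
      also have "\<dots> = loc p y' * loc p y'" by (rule loc_mult[OF pD cy cy])
      finally show ?thesis using loc_values[OF pD cy] by auto
    qed
    have L0: "Legendre (int n0) (int p) = -1" using nz[OF n0(1)] sq[OF n0(1)] n0(2) by auto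
    show ?thesis
    proof (cases "Legendre (int n) (int p) = 1")
      case True
      then show ?thesis using sq[OF n] by simp
    next
      case False
      then have L: "Legendre (int n) (int p) = -1" using nz[OF n] by simp
      have "Legendre (int (n * n0)) (int p) = 1"
        using Legendre_mult[OF pr, of "int n" "int n0"] L L0 by simp
      then have "loc p (n * n0) = 1" using n n0 by (intro sq) auto
      then have "loc p n * loc p n0 = 1" using loc_mult[OF pD n n0(1)] by simp
      then show ?thesis using n0(2) L by simp
    qed
  qed
  define P where "P = {p \<in> R. \<exists>n0. coprime n0 p \<and> loc p n0 = -1}"
  \<comment> \<open>\<open>loc 8\<close> is controlled at odd arguments only; the value 0 at even
    ones makes \<open>\<kappa>\<close> multiplicative and periodic everywhere.\<close>
  define \<kappa> where "\<kappa> = (\<lambda>n. if odd n then loc 8 n else 0)"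
  have odd8: "coprime n 8 \<longleftrightarrow> odd n" for n :: nat
  proof -
    have "coprime n (2 ^ 3) \<longleftrightarrow> odd n" by (simp only: coprime_power_right_iff) simp
    then show ?thesis by simp
  qed
  have D8: "8 \<in> D" by (simp add: D_def)
  have qs: "quadratic_symbol \<kappa> P"
  proof
    show "finite P" using finite_R by (simp add: P_def)
    show "prime p" "odd p" if "p \<in> P" for p using that by (auto simp: P_def R_def)
    show "\<kappa> (x + 8) = \<kappa> x" for x
    proof (cases "odd x")
      case True
      have "loc 8 (x + 8) = loc 8 x"
        using True by (intro loc_cong D8) (auto simp: odd8 cong_def)
      then show ?thesis using True by (simp add: \<kappa>_def)
    qed (simp add: \<kappa>_def)
    show "\<kappa> (x * y) = \<kappa> x * \<kappa> y" for x y
      using loc_mult[OF D8, of x y] by (simp add: \<kappa>_def odd8)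
    show "\<kappa> x \<in> {-1, 0, 1}" for x
      using loc_values[OF D8, of x] by (auto simp: \<kappa>_def odd8)
  qed
  interpret quadratic_symbol \<kappa> P by (rule qs)
  show ?thesis
  proof (rule that[OF qs])
    have "\<Prod>P dvd \<Prod>R" by (rule prod_dvd_prod_subset[OF finite_R]) (auto simp: P_def)
    then have "8 * \<Prod>P dvd 8 * \<Prod>R" by (intro mult_dvd_mono dvd_refl)
    then show "modulus dvd M" using Q_dvd_M unfolding modulus_def Q_def by (rule dvd_trans)
    fix n assume n: "coprime n M"
    have nd: "coprime n d" if "d \<in> D" for d
    proof -
      have "d dvd Q" using co(1)[OF that] by simp
      from coprime_divisors[OF dvd_refl dvd_trans[OF this Q_dvd_M] n] show ?thesis .
    qed
    have "\<chi> n = loc 8 n * (\<Prod>p\<in>R. loc p n)"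
      using \<chi>_loc[OF n] finite_R 8 by (simp add: D_def)
    also have "loc 8 n = \<kappa> n" using nd[OF D8] by (simp add: \<kappa>_def odd8)
    also have "(\<Prod>p\<in>R. loc p n) = (\<Prod>p\<in>P. loc p n)"
    proof (rule prod.mono_neutral_right[OF finite_R])
      show "\<forall>p\<in>R - P. loc p n = 1"
      proof
        fix p assume p: "p \<in> R - P"
        then have pD: "p \<in> D" by (simp add: D_def)
        show "loc p n = 1" using loc_values[OF pD nd[OF pD]] nd[OF pD] p by (auto simp: P_def)
      qed
    qed (auto simp: P_def)
    also have "\<dots> = (\<Prod>p\<in>P. real_of_int (Legendre (int n) (int p)))"
    proof (intro prod.cong refl)
      fix p assume "p \<in> P"
      then obtain n0 where p: "p \<in> R" "coprime n0 p" "loc p n0 = -1" by (auto simp: P_def)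
      have "coprime n p" using p(1) by (intro nd) (simp add: D_def)
      then show "loc p n = real_of_int (Legendre (int n) (int p))" using loc_leg[OF p(1) _ p(2,3)] by blast
    qed
    finally show "\<chi> n = \<psi> n" by (simp add: \<psi>_def)
  qed
qed

end

section \<open>Vinogradov's argument\<close>

text \<open>For completely multiplicative \<open>f\<close> this is the completely multiplicative
  function with the value at \<open>p\<close> reset to 1 and all other prime values kept.\<close>

definition strip :: "nat \<Rightarrow> (nat \<Rightarrow> real) \<Rightarrow> nat \<Rightarrow> real" where
  "strip p f n = f (n div p ^ multiplicity p n)"

lemma strip_prime_mult:
  assumes "prime p" "m > 0"
  shows "strip p f (p * m) = strip p f m"
proof -
  have "multiplicity p (p * m) = Suc (multiplicity p m)"
    using assms by (intro multiplicity_times_same) auto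
  then show ?thesis using assms prime_gt_0_nat[of p] by (simp add: strip_def)
qed

lemma strip_not_dvd: "\<not> p dvd n \<Longrightarrow> strip p f n = f n"
  by (simp add: strip_def not_dvd_imp_multiplicity_0)

lemma strip_mult:
  assumes p: "prime p" and f: "\<And>m n. m > 0 \<Longrightarrow> n > 0 \<Longrightarrow> f (m * n) = f m * f n" and mn: "m > 0" "n > 0"
  shows "strip p f (m * n) = strip p f m * strip p f n"
proof -
  define a b where "a = multiplicity p m" and "b = multiplicity p n"
  obtain m' where m': "m = p ^ a * m'" unfolding a_def using multiplicity_dvd[of p m] by (rule dvdE)
  obtain n' where n': "n = p ^ b * n'" unfolding b_def using multiplicity_dvd[of p n] by (rule dvdE)
  have p0: "p > 0" using p prime_gt_0_nat by blast
  have "multiplicity p (m * n) = a + b"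
    using p mn by (simp add: a_def b_def prime_elem_multiplicity_mult_distrib)
  moreover have "m * n = p ^ (a + b) * (m' * n')" by (simp add: m' n' power_add)
  ultimately have "strip p f (m * n) = f (m' * n')" using p0 by (simp add: strip_def)
  moreover have "strip p f m = f m'" "strip p f n = f n'"
  proof -
    have "m div p ^ a = m'" using p0 by (subst m') simp
    then show "strip p f m = f m'" by (simp add: strip_def a_def)
    have "n div p ^ b = n'" using p0 by (subst n') simp
    then show "strip p f n = f n'" by (simp add: strip_def b_def)
  qed
  moreover have "m' > 0" "n' > 0" using mn m' n' by auto
  ultimately show ?thesis using f by simp
qed

lemma sum_multiples:
  fixes G :: "nat \<Rightarrow> real"
  assumes "p > 0"
  shows "(\<Sum>n\<in>{n\<in>{1..z}. p dvd n}. G n) = (\<Sum>m=1..z div p. G (p * m))"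
  by (rule sum.reindex_bij_witness[of _ "\<lambda>m. p * m" "\<lambda>n. n div p"])
     (use assms in \<open>auto simp: less_eq_div_iff_mult_less_eq mult.commute elim!: dvdE\<close>)

text \<open>Terms not divisible by \<open>p\<close> agree, so with \<open>w = z div p\<close> the
  stripped sum to \<open>z\<close> is the original sum to \<open>z\<close>, minus \<open>e\<close>
  times the original sum to \<open>w\<close>, plus the stripped sum to \<open>w\<close>. As
  \<open>w \<le> z / 2\<close>, the recursion contracts by \<open>t = 2 powr (- \<beta>)\<close>,
  and \<open>K = 2 / (1 - t)\<close> satisfies \<open>1 + (1 + K) * t \<le> K\<close>.\<close>

lemma sum_strip_le:
  fixes f :: "nat \<Rightarrow> real" and H \<beta> e :: real
  assumes p: "prime p" and \<beta>: "\<beta> > 0" and H: "\<And>z. \<bar>\<Sum>n=1..z. f n\<bar> \<le> H * real z powr \<beta>"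
    and f: "\<And>m. m > 0 \<Longrightarrow> f (p * m) = e * f m" and e: "\<bar>e\<bar> \<le> 1" and H0: "H \<ge> 0"
  shows "\<bar>\<Sum>n=1..z. strip p f n\<bar> \<le> 2 / (1 - 2 powr (- \<beta>)) * H * real z powr \<beta>"
proof (induction z rule: less_induct)
  case (less z)
  define t where "t = (2::real) powr (- \<beta>)"
  have t: "0 < t" "t < 1" using \<beta> by (auto simp: t_def powr_less_one)
  define K where "K = 2 / (1 - t)"
  have p2: "p \<ge> 2" using p prime_ge_2_nat by blast
  show ?case
  proof (cases "z = 0")
    case False
    define w where "w = z div p"
    have wz: "w < z" using False p2 by (simp add: w_def)
    have split: "(\<Sum>n=1..z. G n) = (\<Sum>n\<in>{n\<in>{1..z}. \<not> p dvd n}. G n) + (\<Sum>m=1..w. G (p * m))" for G :: "nat \<Rightarrow> real"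
    proof -
      have "{1..z} = {n\<in>{1..z}. \<not> p dvd n} \<union> {n\<in>{1..z}. p dvd n}" by auto
      then have "(\<Sum>n=1..z. G n) = (\<Sum>n\<in>{n\<in>{1..z}. \<not> p dvd n} \<union> {n\<in>{1..z}. p dvd n}. G n)" by (rule arg_cong)
      also have "\<dots> = (\<Sum>n\<in>{n\<in>{1..z}. \<not> p dvd n}. G n) + (\<Sum>n\<in>{n\<in>{1..z}. p dvd n}. G n)"
        by (rule sum.union_disjoint) auto
      also have "(\<Sum>n\<in>{n\<in>{1..z}. p dvd n}. G n) = (\<Sum>m=1..w. G (p * m))"
        unfolding w_def using p2 by (intro sum_multiples) simp
      finally show ?thesis .
    qed
    have 1: "(\<Sum>n\<in>{n\<in>{1..z}. \<not> p dvd n}. strip p f n) = (\<Sum>n\<in>{n\<in>{1..z}. \<not> p dvd n}. f n)"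
      by (intro sum.cong refl) (simp add: strip_not_dvd)
    have 2: "(\<Sum>m=1..w. strip p f (p * m)) = (\<Sum>m=1..w. strip p f m)"
      by (rule sum.cong[OF refl], rule strip_prime_mult[OF p]) simp
    have 3: "(\<Sum>m=1..w. f (p * m)) = e * (\<Sum>m=1..w. f m)"
      unfolding sum_distrib_left by (rule sum.cong[OF refl], rule f) simp
    define X Y U V where "X = (\<Sum>n=1..z. strip p f n)" and "Y = (\<Sum>n=1..z. f n)"
      and "U = (\<Sum>m=1..w. f m)" and "V = (\<Sum>m=1..w. strip p f m)"
    have "X = Y - e * U + V"
      using split[of "strip p f"] split[of f] unfolding 1 2 3 X_def Y_def U_def V_def by linarith
    moreover have "\<bar>Y\<bar> \<le> H * real z powr \<beta>" unfolding Y_def by (rule H)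
    moreover have "\<bar>e * U\<bar> \<le> 1 * (H * real w powr \<beta>)"
      unfolding abs_mult U_def by (intro mult_mono e H) auto
    moreover have "\<bar>V\<bar> \<le> K * H * real w powr \<beta>"
      using less.IH[OF wz] unfolding K_def t_def V_def .
    moreover have "(1 + K) * H * real w powr \<beta> = 1 * (H * real w powr \<beta>) + K * H * real w powr \<beta>"
      by (simp add: algebra_simps)
    ultimately have A: "\<bar>X\<bar> \<le> H * real z powr \<beta> + (1 + K) * H * real w powr \<beta>"
      by linarith
    have "real w powr \<beta> \<le> (real z / 2) powr \<beta>"
    proof (rule powr_mono2)
      have "real w \<le> real z / real p" unfolding w_def by (rule real_div_bounds)
      also have "\<dots> \<le> real z / 2" using p2 by (intro divide_left_mono) auto
      finally show "real w \<le> real z / 2" .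
    qed (use \<beta> in auto)
    also have "\<dots> = real z powr \<beta> * t" unfolding t_def powr_minus_divide by (subst powr_divide) auto
    finally have "(1 + K) * H * real w powr \<beta> \<le> (1 + K) * H * (real z powr \<beta> * t)"
      using t H0 by (intro mult_left_mono) (auto simp: K_def)
    then have "\<bar>X\<bar> \<le> (1 + (1 + K) * t) * H * real z powr \<beta>"
      using A by (simp add: algebra_simps)
    also have "\<dots> \<le> K * H * real z powr \<beta>"
    proof (intro mult_right_mono)
      have "K * (1 - t) = 2" using nonzero_eq_divide_eq[of "1 - t" K 2] t K_def by simp
      then show "1 + (1 + K) * t \<le> K" using t by (simp add: algebra_simps)
    qed (use H0 in auto)
    finally show ?thesis by (simp only: K_def t_def X_def)
  qed simp
qed

text \<open>The primes of \<open>R\<close> are stripped one at a time; each costs a constant factor in the bound for the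
  partial sums.\<close>

lemma set_one_on_primes:
  fixes f :: "nat \<Rightarrow> real" and H \<beta> :: real
  assumes \<beta>: "\<beta> > 0" and H: "\<And>z. \<bar>\<Sum>n=1..z. f n\<bar> \<le> H * real z powr \<beta>" and H0: "H \<ge> 0"
    and mult: "\<And>m n. m > 0 \<Longrightarrow> n > 0 \<Longrightarrow> f (m * n) = f m * f n" and f1: "f 1 = 1"
    and bound: "\<And>n. \<bar>f n\<bar> \<le> 1" and R: "finite R" "\<And>p. p \<in> R \<Longrightarrow> prime p"
  obtains g where "\<And>z. \<bar>\<Sum>n=1..z. g n\<bar> \<le> (2 / (1 - 2 powr (- \<beta>))) ^ card R * H * real z powr \<beta>"
    "\<And>m n. m > 0 \<Longrightarrow> n > 0 \<Longrightarrow> g (m * n) = g m * g n" "g 1 = 1" "\<And>n. \<bar>g n\<bar> \<le> 1"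
    "\<And>p. p \<in> R \<Longrightarrow> g p = 1" "\<And>p. prime p \<Longrightarrow> p \<notin> R \<Longrightarrow> g p = f p"
proof -
  define K where "K = 2 / (1 - (2::real) powr (- \<beta>))"
  have K: "K \<ge> 0" using \<beta> powr_less_one[of 2 "-\<beta>"] by (simp add: K_def)
  define good where "good = (\<lambda>R g. (\<forall>z. \<bar>\<Sum>n=1..z. g n\<bar> \<le> K ^ card R * H * real z powr \<beta>)
    \<and> (\<forall>m n. m > 0 \<longrightarrow> n > 0 \<longrightarrow> g (m * n) = g m * g n) \<and> g 1 = 1 \<and> (\<forall>n. \<bar>g n\<bar> \<le> 1)
    \<and> (\<forall>p\<in>R. g p = 1) \<and> (\<forall>p. prime p \<longrightarrow> p \<notin> R \<longrightarrow> g p = f p))"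
  have "\<exists>g. good R g"
    using R
  proof (induction R)
    case empty
    show ?case using H mult f1 bound unfolding good_def by (intro exI[of _ f]) auto
  next
    case (insert p R)
    then obtain g where "good R g" by auto
    then have g: "\<And>z. \<bar>\<Sum>n=1..z. g n\<bar> \<le> K ^ card R * H * real z powr \<beta>"
      "\<And>m n. m > 0 \<Longrightarrow> n > 0 \<Longrightarrow> g (m * n) = g m * g n" "g 1 = 1" "\<And>n. \<bar>g n\<bar> \<le> 1"
      "\<And>p. p \<in> R \<Longrightarrow> g p = 1" "\<And>p. prime p \<Longrightarrow> p \<notin> R \<Longrightarrow> g p = f p"
      unfolding good_def by blast+
    have p: "prime p" using insert.prems by simp
    have other: "strip p g r = g r" if "prime r" "r \<noteq> p" for r
      using that p primes_dvd_imp_eq[of p r] by (intro strip_not_dvd) auto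
    have self: "strip p g p = 1"
    proof -
      have "strip p g (p * 1) = strip p g 1" using p by (intro strip_prime_mult) auto
      also have "\<dots> = g 1" using p by (intro strip_not_dvd) (auto simp: not_prime_unit)
      finally show ?thesis using g(3) by simp
    qed
    show ?case
      unfolding good_def
    proof (intro exI[of _ "strip p g"] conjI allI impI ballI)
      fix z
      have "\<bar>\<Sum>n=1..z. strip p g n\<bar> \<le> 2 / (1 - 2 powr (- \<beta>)) * (K ^ card R * H) * real z powr \<beta>"
        using g p prime_gt_0_nat K H0 by (intro sum_strip_le[where e = "g p"] \<beta>) auto
      then show "\<bar>\<Sum>n=1..z. strip p g n\<bar> \<le> K ^ card (insert p R) * H * real z powr \<beta>"
        using insert.hyps by (simp add: K_def mult_ac)
    next
      fix m n :: nat assume "m > 0" "n > 0"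
      then show "strip p g (m * n) = strip p g m * strip p g n" using g(2) p by (intro strip_mult) auto
    next
      show "strip p g 1 = 1" using p g(3) strip_not_dvd[of p 1 g] prime_gt_1_nat[OF p] by auto
    next
      fix n show "\<bar>strip p g n\<bar> \<le> 1" using g(4) by (simp add: strip_def)
    next
      fix r assume r: "r \<in> insert p R"
      then show "strip p g r = 1" using self other[of r] insert.prems(1)[OF r] g(5) by (cases "r = p") auto
    next
      fix r assume "prime r" "r \<notin> insert p R"
      then show "strip p g r = f r" using other[of r] g(6)[of r] by auto
    qed
  qed
  then obtain g where "good R g" by blast
  then show ?thesis by (intro that[of g]) (simp_all add: good_def K_def)
qed

lemma completely_multiplicative_eq_1:
  fixes f :: "nat \<Rightarrow> real"
  assumes mult: "\<And>m n. m > 0 \<Longrightarrow> n > 0 \<Longrightarrow> f (m * n) = f m * f n" and f1: "f 1 = 1" and "n > 0"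
    and "\<And>p. prime p \<Longrightarrow> p dvd n \<Longrightarrow> f p = 1"
  shows "f n = 1"
  using assms(3,4)
proof (induction n rule: less_induct)
  case (less n)
  show ?case
  proof (cases "n = 1")
    case False
    then obtain p where p: "prime p" "p dvd n" using prime_factor_nat by blast
    then obtain m where m: "n = p * m" by (elim dvdE)
    have mn: "m < n" "m > 0" using less.prems(1) p prime_gt_1_nat[of p] by (auto simp: m)
    have "f m = 1"
    proof (rule less.IH[OF mn])
      fix r assume "prime r" "r dvd m"
      then show "f r = 1" using less.prems(2)[of r] unfolding m by simp
    qed
    moreover have "f n = f p * f m" unfolding m using mn p prime_gt_0_nat by (intro mult) auto
    ultimately show ?thesis using less.prems(2)[OF p] by simp
  qed (use f1 in simp)
qed

text \<open>Vinogradov's argument: an integer at which \<open>f\<close> is not \<open>1\<close> has a prime divisor above \<open>y\<close>.\<close>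

lemma vinogradov_sum_ge:
  fixes f :: "nat \<Rightarrow> real" and y :: real and x :: nat
  assumes mult: "\<And>m n. m > 0 \<Longrightarrow> n > 0 \<Longrightarrow> f (m * n) = f m * f n" and f1: "f 1 = 1"
    and small: "\<And>p. prime p \<Longrightarrow> real p \<le> y \<Longrightarrow> f p = 1"
    and bound: "\<And>n. n > 0 \<Longrightarrow> f n \<ge> -1"
  shows "(\<Sum>n=1..x. f n) \<ge> real x - 2 * real x * (\<Sum>p\<in>primes_between y (real x). 1 / real p)"
proof -
  define PB where "PB = primes_between y (real x)"
  have "1 - f n \<le> 2 * (\<Sum>p\<in>PB. if p dvd n then 1 else 0)" if n: "n \<in> {1..x}" for n
  proof (cases "\<exists>p\<in>PB. p dvd n")
    case True
    then obtain p where p: "p \<in> PB" "p dvd n" by blast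
    have "1 = (if p dvd n then 1 else 0 :: real)" using p by simp
    also have "\<dots> \<le> (\<Sum>p\<in>PB. if p dvd n then 1 else 0)"
      using p by (intro member_le_sum[where f = "\<lambda>p. if p dvd n then 1 else 0 :: real"]) (auto simp: PB_def)
    finally show ?thesis using bound[of n] n by simp
  next
    case False
    have "f n = 1"
    proof (rule completely_multiplicative_eq_1[OF mult f1])
      fix p assume p: "prime p" "p dvd n"
      then have "p \<le> x" using n dvd_imp_le[of p n] by simp
      then show "f p = 1" using False p by (intro small) (auto simp: PB_def primes_between_def not_less)
    qed (use n in auto)
    then show ?thesis by (simp add: sum_nonneg)
  qed
  then have "(\<Sum>n=1..x. 1 - f n) \<le> (\<Sum>n=1..x. 2 * (\<Sum>p\<in>PB. if p dvd n then 1 else 0))"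
    by (rule sum_mono)
  also have "\<dots> = 2 * (\<Sum>p\<in>PB. \<Sum>n=1..x. if p dvd n then 1 else 0)"
    unfolding sum_distrib_left[symmetric] by (subst sum.swap) simp
  also have "\<dots> \<le> 2 * (\<Sum>p\<in>PB. real x * (1 / real p))"
  proof (intro mult_left_mono sum_mono)
    fix p assume "p \<in> PB"
    then have p: "p > 0" using prime_gt_0_nat by (auto simp: PB_def primes_between_def)
    have "(\<Sum>n=1..x. if p dvd n then 1 else 0 :: real) = real (\<Sum>n=1..x. if p dvd n then 1 else 0)"
      unfolding of_nat_sum by (intro sum.cong) auto
    also have "\<dots> = real (x div p)" by (simp only: sum_if_eq_card finite_atLeastAtMost card_multiples[OF p])
    also have "\<dots> \<le> real x * (1 / real p)" using real_div_bounds(2)[of x p] by simp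
    finally show "(\<Sum>n=1..x. if p dvd n then 1 else 0 :: real) \<le> real x * (1 / real p)" .
  qed simp
  finally have "(\<Sum>n=1..x. 1 - f n) \<le> 2 * real x * (\<Sum>p\<in>PB. 1 / real p)"
    by (simp add: sum_distrib_left mult.assoc)
  then show ?thesis by (simp add: sum_subtractf PB_def)
qed

text \<open>Lengths \<open>y = M powr (\<alpha> + \<epsilon>)\<close> and
  \<open>w = M powr (1/4 + \<epsilon>)\<close> are related by \<open>w = y powr u\<close>. Adding
  the same \<open>\<epsilon>\<close> to both exponents pushes their ratio strictly below
  \<open>(1/4) / \<alpha> = sqrt (exp 1)\<close>, so \<open>ln u < 1/2\<close>.\<close>

lemma burgess_vinogradov:
  fixes \<epsilon> :: real
  defines "\<alpha> \<equiv> 1 / (4 * sqrt (exp 1))"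
  assumes \<epsilon>: "0 < \<epsilon>" "\<epsilon> < 1/4"
  shows "\<exists>M0. \<forall>M \<chi> n0. real_character M \<chi> \<longrightarrow> coprime n0 M \<longrightarrow> \<chi> n0 = -1 \<longrightarrow> M0 \<le> real M \<longrightarrow>
    (\<exists>p. prime p \<and> coprime p M \<and> \<chi> p = -1 \<and> real p \<le> real M powr (\<alpha> + \<epsilon>))"
proof -
  define s where "s = sqrt (exp (1::real))"
  have s: "s > 1" by (simp add: s_def)
  have \<alpha>: "0 < \<alpha>" "\<alpha> < 1/4" "s * \<alpha> = 1/4" using s by (simp_all add: \<alpha>_def s_def[symmetric] field_simps)
  define u where "u = (1/4 + \<epsilon>) / (\<alpha> + \<epsilon>)"
  have u1: "u \<ge> 1" using \<alpha> \<epsilon> by (simp add: u_def field_simps)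
  have "u < s"
  proof -
    have "1 * \<epsilon> < s * \<epsilon>" using s \<epsilon> by (intro mult_strict_right_mono)
    then have "1/4 + \<epsilon> < s * (\<alpha> + \<epsilon>)" using \<alpha>(3) by (simp add: distrib_left)
    then show ?thesis using \<alpha> \<epsilon> by (simp add: u_def divide_less_eq)
  qed
  then have "ln u < ln s" using u1 by simp
  also have "ln s = 1/2" by (simp add: s_def ln_sqrt)
  finally have lnu: "ln u < 1/2" .
  \<comment> \<open>A quarter of the margin \<open>1 - 2 * ln u\<close>: the error in Mertens'
    theorem uses up \<open>2 * \<rho>\<close>, so the sum is at least \<open>2 * \<rho> * x\<close>,
    against an upper bound \<open>\<rho> * x\<close>.\<close>
  define \<rho> where "\<rho> = (1 - 2 * ln u) / 4"
  have \<rho>: "\<rho> > 0" using lnu by (simp add: \<rho>_def)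
  obtain Y where Y: "Y > 1" "\<And>y. y \<ge> Y \<Longrightarrow> (\<Sum>p\<in>primes_between y (y powr u). 1 / real p) \<le> ln u + \<rho>"
    by (rule mertens_second_upper[OF u1 \<rho>], rule that; blast)
  define \<delta> where "\<delta> = \<epsilon> / 2"
  have \<delta>: "0 < \<delta>" "\<delta> < 1/4" using \<epsilon> by (auto simp: \<delta>_def)
  obtain C \<theta> where C: "C \<ge> 1" and \<theta>: "0 < \<theta>" "\<theta> < 1"
    and burg: "\<And>\<kappa> P n0 z. quadratic_symbol \<kappa> P \<Longrightarrow> coprime n0 (quadratic_symbol.modulus P) \<Longrightarrow>
      quadratic_symbol.\<psi> \<kappa> P n0 = -1 \<Longrightarrow>
      \<bar>\<Sum>n=1..z. quadratic_symbol.\<psi> \<kappa> P n\<bar>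
        \<le> C * real (quadratic_symbol.modulus P) powr ((1/4 + \<delta>) * \<theta>) * real z powr (1 - \<theta>)"
    by (rule burgess[OF \<delta>], rule that; blast)
  define \<beta> where "\<beta> = 1 - \<theta>"
  have \<beta>: "\<beta> > 0" using \<theta> by (simp add: \<beta>_def)
  define K where "K = 2 / (1 - (2::real) powr (- \<beta>))"
  have t: "0 < (2::real) powr (- \<beta>)" "(2::real) powr (- \<beta>) < 1" using \<beta> by (auto simp: powr_less_one)
  have "1 \<le> 2 / (1 - x)" if "0 < x" "x < 1" for x :: real using that by (simp add: field_simps)
  from this[OF t] have K: "K \<ge> 1" by (simp only: K_def)
  \<comment> \<open>Burgess' bound with \<open>\<delta> = \<epsilon> / 2\<close> saves
    \<open>M powr (\<epsilon> * \<theta> / 2)\<close> at length \<open>w\<close>. Half of this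
    exponent pays for resetting the primes of \<open>M\<close>, and the other half remains.\<close>
  define \<eta> where "\<eta> = \<epsilon> * \<theta> / 4"
  have \<eta>: "\<eta> > 0" using \<epsilon> \<theta> by (simp add: \<eta>_def)
  obtain C3 where C3: "C3 \<ge> 1"
    "\<And>P. finite P \<Longrightarrow> (\<And>p. p \<in> P \<Longrightarrow> prime p) \<Longrightarrow> K ^ card P \<le> C3 * real (\<Prod>P) powr \<eta>"
    by (rule power_card_primes_le[OF K \<eta>], rule that; blast)
  define C5 where "C5 = 2 * C * C3"
  have C5: "C5 > 0" using C C3 by (simp add: C5_def)
  define M0 where "M0 = max 1 (max (Y powr (1 / (\<alpha> + \<epsilon>))) ((2 * C5 / \<rho>) powr (1 / \<eta>)))"
  show ?thesis
  proof (intro exI[of _ M0] allI impI, rule ccontr)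
    fix M \<chi> n0
    assume rc: "real_character M \<chi>" and n0: "coprime n0 M" "\<chi> n0 = -1" and M: "M0 \<le> real M"
    assume contra: "\<not> (\<exists>p. prime p \<and> coprime p M \<and> \<chi> p = -1 \<and> real p \<le> real M powr (\<alpha> + \<epsilon>))"
    interpret real_character M \<chi> by (rule rc)
    obtain \<kappa> P where qs: "quadratic_symbol \<kappa> P" and mod: "quadratic_symbol.modulus P dvd M"
      and \<chi>\<psi>: "\<And>n. coprime n M \<Longrightarrow> \<chi> n = quadratic_symbol.\<psi> \<kappa> P n"
      by (rule eq_quadratic_symbol, rule that; blast)
    interpret quadratic_symbol \<kappa> P by (rule qs)
    have M1: "real M \<ge> 1" using M_pos by (simp add: Suc_le_eq)
    have modM: "real modulus \<le> real M" using mod M_pos by (simp add: dvd_imp_le)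
    define H where "H = C * real M powr ((1/4 + \<delta>) * \<theta>)"
    have psi_sum: "\<bar>\<Sum>n=1..z. \<psi> n\<bar> \<le> H * real z powr \<beta>" for z
    proof -
      have "coprime n0 modulus" using coprime_divisors[OF dvd_refl mod n0(1)] .
      moreover have "\<psi> n0 = -1" using \<chi>\<psi>[OF n0(1)] n0(2) by simp
      ultimately have "\<bar>\<Sum>n=1..z. \<psi> n\<bar> \<le> C * real modulus powr ((1/4 + \<delta>) * \<theta>) * real z powr \<beta>"
        unfolding \<beta>_def by (rule burg[OF qs])
      also have "\<dots> \<le> H * real z powr \<beta>"
        unfolding H_def using modM \<delta> \<theta> C by (intro mult_right_mono mult_left_mono powr_mono2) auto
      finally show ?thesis .
    qed
    have H0: "H \<ge> 0" using C by (simp add: H_def)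
    have \<psi>1: "\<psi> 1 = 1" using \<chi>\<psi>[of 1] \<chi>_1 by simp
    have \<psi>_mult': "\<psi> (m * n) = \<psi> m * \<psi> n" if "m > 0" "n > 0" for m n by (rule \<psi>_mult)
    define R' where "R' = {p. prime p \<and> p dvd M}"
    have R': "finite R'" "\<And>p. p \<in> R' \<Longrightarrow> prime p"
      unfolding R'_def using M_pos by (auto intro: finite_subset[of _ "{..M}"] dest: dvd_imp_le)
    obtain g where g: "\<And>z. \<bar>\<Sum>n=1..z. g n\<bar> \<le> K ^ card R' * H * real z powr \<beta>"
      "\<And>m n. m > 0 \<Longrightarrow> n > 0 \<Longrightarrow> g (m * n) = g m * g n" "g 1 = 1" "\<And>n. \<bar>g n\<bar> \<le> 1"
      "\<And>p. p \<in> R' \<Longrightarrow> g p = 1" "\<And>p. prime p \<Longrightarrow> p \<notin> R' \<Longrightarrow> g p = \<psi> p"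
    proof (rule set_one_on_primes[OF \<beta> psi_sum H0 \<psi>_mult' \<psi>1 abs_\<psi>_le_1 R', folded K_def])
      fix g assume A: "\<And>z. \<bar>\<Sum>n=1..z. g n\<bar> \<le> K ^ card R' * H * real z powr \<beta>"
        "\<And>m n. m > 0 \<Longrightarrow> n > 0 \<Longrightarrow> g (m * n) = g m * g n" "g 1 = 1" "\<And>n. \<bar>g n\<bar> \<le> 1"
        "\<And>p. p \<in> R' \<Longrightarrow> g p = 1" "\<And>p. prime p \<Longrightarrow> p \<notin> R' \<Longrightarrow> g p = \<psi> p"
      show thesis by (rule that[OF A])
    qed
    define y where "y = real M powr (\<alpha> + \<epsilon>)"
    define w where "w = real M powr (1/4 + \<epsilon>)"
    define x where "x = nat \<lfloor>w\<rfloor>"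
    have w1: "w \<ge> 1" using M1 \<epsilon> by (simp add: w_def ge_one_powr_ge_zero)
    have x: "real x \<le> w" "w \<le> 2 * real x" "real x > 0"
    proof -
      have "real x = real_of_int \<lfloor>w\<rfloor>" using w1 by (simp add: x_def)
      moreover have "1 \<le> x" using le_nat_floor[of 1 w] w1 by (simp add: x_def)
      then have "1 \<le> real x" by simp
      ultimately show "real x \<le> w" "w \<le> 2 * real x" "real x > 0" by linarith+
    qed
    have gsmall: "g p = 1" if p: "prime p" "real p \<le> y" for p
    proof (cases "p dvd M")
      case True
      then show ?thesis using p g(5) by (simp add: R'_def)
    next
      case False
      then have cop: "coprime p M" using p by (intro prime_imp_coprime)
      then have "\<chi> p \<noteq> -1" using contra p by (auto simp: y_def)
      then have "\<chi> p = 1" using \<chi>_values[OF cop] by blast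
      then show ?thesis using g(6)[OF p(1)] False \<chi>\<psi>[OF cop] by (simp add: R'_def)
    qed
    have "(\<Sum>n=1..x. g n) \<ge> real x - 2 * real x * (\<Sum>p\<in>primes_between y (real x). 1 / real p)"
    proof (rule vinogradov_sum_ge[OF g(2,3) gsmall])
      show "g n \<ge> -1" for n using g(4)[of n] by linarith
    qed
    moreover have "(\<Sum>p\<in>primes_between y (real x). 1 / real p) \<le> ln u + \<rho>"
    proof -
      have "(Y powr (1 / (\<alpha> + \<epsilon>))) powr (\<alpha> + \<epsilon>) \<le> real M powr (\<alpha> + \<epsilon>)"
        using M \<alpha> \<epsilon> by (intro powr_mono2) (auto simp: M0_def)
      then have yY: "Y \<le> y" using \<alpha> \<epsilon> Y(1) by (simp add: powr_powr y_def)
      have "y powr u = w" using \<alpha> \<epsilon> by (simp add: y_def w_def u_def powr_powr)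
      then have "primes_between y (real x) \<subseteq> primes_between y (y powr u)"
        using x by (auto simp: primes_between_def)
      then have "(\<Sum>p\<in>primes_between y (real x). 1 / real p) \<le> (\<Sum>p\<in>primes_between y (y powr u). 1 / real p)"
        by (intro sum_mono2) auto
      then show ?thesis using Y(2)[OF yY] by linarith
    qed
    then have "2 * real x * (\<Sum>p\<in>primes_between y (real x). 1 / real p) \<le> 2 * real x * (ln u + \<rho>)"
      using x by (intro mult_left_mono) auto
    moreover have "real x - 2 * real x * (ln u + \<rho>) = 2 * \<rho> * real x"
    proof -
      have "ln u = 1/2 - 2 * \<rho>" unfolding \<rho>_def by (simp add: field_simps)
      then show ?thesis by (simp only:) (simp add: algebra_simps)
    qed
    ultimately have lower: "(\<Sum>n=1..x. g n) \<ge> 2 * \<rho> * real x" by linarith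
    have "(\<Sum>n=1..x. g n) \<le> K ^ card R' * H * real x powr \<beta>" using g(1)[of x] by linarith
    also have "\<dots> \<le> (C3 * real M powr \<eta>) * H * (real x * (2 * real M powr (- ((1/4 + \<epsilon>) * \<theta>))))"
    proof (intro mult_mono mult_right_mono)
      have "K ^ card R' \<le> C3 * real (\<Prod>R') powr \<eta>" by (rule C3(2)[OF R'])
      also have "\<dots> \<le> C3 * real M powr \<eta>"
      proof (intro mult_left_mono powr_mono2 of_nat_mono)
        have "\<Prod>R' dvd M" by (rule prod_primes_dvd_if_all_dvd[OF R'(1)]) (auto simp: R'_def)
        then show "\<Prod>R' \<le> M" using M_pos by (rule dvd_imp_le)
      qed (use \<eta> C3(1) in \<open>auto intro: prod_nonneg\<close>)
      finally show "K ^ card R' \<le> C3 * real M powr \<eta>" .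
      have "real x powr \<beta> = real x * real x powr (- \<theta>)"
        using x by (simp add: \<beta>_def powr_diff powr_minus divide_inverse)
      also have "real x powr (- \<theta>) \<le> (w / 2) powr (- \<theta>)"
        using x w1 \<theta> by (intro powr_mono2') auto
      also have "(w / 2) powr (- \<theta>) = 2 powr \<theta> * w powr (- \<theta>)"
        using w1 by (simp add: powr_divide powr_minus field_simps)
      also have "\<dots> \<le> 2 * w powr (- \<theta>)"
        using powr_mono[of \<theta> 1 2] \<theta> by (intro mult_right_mono) auto
      also have "w powr (- \<theta>) = real M powr (- ((1/4 + \<epsilon>) * \<theta>))" by (simp add: w_def powr_powr)
      finally show "real x powr \<beta> \<le> real x * (2 * real M powr (- ((1/4 + \<epsilon>) * \<theta>)))"
        using x by simp
    qed (use C3 H0 K x in auto)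
    also have "\<dots> = C5 * real x * (real M powr \<eta> * real M powr ((1/4 + \<delta>) * \<theta>) * real M powr (- ((1/4 + \<epsilon>) * \<theta>)))"
      by (simp add: H_def C5_def mult_ac)
    also have "real M powr \<eta> * real M powr ((1/4 + \<delta>) * \<theta>) * real M powr (- ((1/4 + \<epsilon>) * \<theta>))
        = real M powr (\<eta> + (1/4 + \<delta>) * \<theta> + (- ((1/4 + \<epsilon>) * \<theta>)))"
      by (simp only: powr_add)
    also have "\<eta> + (1/4 + \<delta>) * \<theta> + (- ((1/4 + \<epsilon>) * \<theta>)) = - \<eta>"
      by (simp add: \<eta>_def \<delta>_def field_simps)
    also have "C5 * real x * real M powr (- \<eta>) \<le> \<rho> * real x"
    proof -
      have "((2 * C5 / \<rho>) powr (1 / \<eta>)) powr \<eta> \<le> real M powr \<eta>"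
        using M \<eta> by (intro powr_mono2) (auto simp: M0_def)
      then have "2 * C5 / \<rho> \<le> real M powr \<eta>" using \<eta> C5 \<rho> by (simp add: powr_powr)
      then have "C5 \<le> \<rho> * real M powr \<eta>" using \<rho> C5 by (simp add: field_simps)
      then have "C5 * real M powr (- \<eta>) \<le> \<rho> * real M powr \<eta> * real M powr (- \<eta>)" by (intro mult_right_mono) auto
      also have "\<dots> = \<rho>" using M1 by (simp add: mult.assoc flip: powr_add)
      finally have "C5 * real M powr (- \<eta>) * real x \<le> \<rho> * real x" using x by (intro mult_right_mono) auto
      then show ?thesis by (simp only: mult_ac)
    qed
    finally have "2 * \<rho> * real x \<le> \<rho> * real x" using lower by linarith
    then show False using \<rho> x by simp
  qed
qed

section \<open>From quadratic characters to the first sign change\<close>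

lemma quadratic_character_values:
  assumes "quadratic_character N \<chi>" "coprime n N"
  shows "\<chi> n = 1 \<or> \<chi> n = -1"
proof -
  have dc: "dirichlet_character N \<chi>" and real: "\<chi> n \<in> \<real>"
    using assms(1) by (auto simp: quadratic_character_def)
  have mult: "\<chi> (a * b) = \<chi> a * \<chi> b" and per: "\<chi> (a + N) = \<chi> a" for a b
    using dc by (auto simp: dirichlet_character_def)
  have N: "N > 0" using dc by (simp add: dirichlet_character_def)
  have pow: "\<chi> (n ^ k) = \<chi> n ^ k" for k
    by (induction k) (auto simp: mult dirichlet_character_1[OF dc, unfolded One_nat_def])
  have "[n ^ totient N = 1] (mod N)" using assms(2) by (rule euler_theorem)
  then have "\<chi> (n ^ totient N) = \<chi> 1" by (rule periodic_cong[of \<chi> N, OF per])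
  then have "\<chi> n ^ totient N = 1" by (simp only: pow dirichlet_character_1[OF dc])
  then have "norm (\<chi> n) ^ totient N = 1" by (metis norm_one norm_power)
  then have "norm (\<chi> n) = 1"
    using N by (metis norm_ge_zero power_eq_imp_eq_base power_one totient_gt_0_iff zero_le_one)
  moreover obtain r where "\<chi> n = complex_of_real r" using real by (auto elim: Reals_cases)
  ultimately show ?thesis by (auto simp: abs_if split: if_splits)
qed

text \<open>In \<open>n1 + a * \<Prod>T\<close> every prime divisor of \<open>M\<close> divides
  exactly one of the two summands, by the choice of \<open>T\<close>.\<close>

lemma coprime_shift_exists:
  fixes n1 a M :: nat
  assumes "coprime n1 a" "M > 0" "a dvd M"
  obtains n0 where "[n0 = n1] (mod a)" "coprime n0 M"
proof -
  define T where "T = {p. prime p \<and> p dvd M \<and> \<not> p dvd a \<and> \<not> p dvd n1}"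
  have finT: "finite T" unfolding T_def using assms(2) by (auto intro: finite_subset[of _ "{..M}"] dest: dvd_imp_le)
  show ?thesis
  proof (rule that[of "n1 + a * \<Prod>T"])
    show "[n1 + a * \<Prod>T = n1] (mod a)" by (simp add: cong_def)
    show "coprime (n1 + a * \<Prod>T) M"
    proof (rule coprime_if_no_common_prime)
      fix p assume p: "prime p" "p dvd n1 + a * \<Prod>T" "p dvd M"
      consider "p dvd a" | "\<not> p dvd a" "p dvd n1" | "\<not> p dvd a" "\<not> p dvd n1" by blast
      then show False
      proof cases
        case 1
        then have "p dvd n1" using p(2) by (simp add: dvd_add_left_iff)
        then show False using 1 assms(1) p(1) by (meson coprime_common_divisor not_prime_unit)
      next
        case 2
        then have "p dvd a * \<Prod>T" using p(2) by (simp add: dvd_add_right_iff)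
        then have "p dvd \<Prod>T" using 2 p(1) by (simp add: prime_dvd_mult_iff)
        then obtain r where "r \<in> T" "p dvd r" using prime_dvd_prod_iff[OF finT p(1), of "\<lambda>p. p"] by auto
        then have "p = r" using p(1) by (auto simp: T_def intro: primes_dvd_imp_eq)
        then show False using 2 \<open>r \<in> T\<close> by (simp add: T_def)
      next
        case 3
        then have "p \<in> T" using p by (simp add: T_def)
        then have "p dvd a * \<Prod>T" using finT by (intro dvd_mult dvd_prodI)
        then have "p dvd n1" using p(2) by (simp add: dvd_add_left_iff)
        then show False using 3 by simp
      qed
    qed
  qed
qed

text \<open>The factor \<open>N1\<close> makes arguments prime to \<open>M\<close> prime to both
  original moduli, and the factor 8 meets the requirement at 2. A value different from 1 is moved to
  an argument prime to \<open>M\<close> and then reduced modulo \<open>M\<close>; the bound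
  \<open>n0 \<le> M\<close> settles small moduli.\<close>

lemma real_character_of_quadratic:
  assumes N1: "N1 > 0" and \<chi>: "quadratic_character N \<chi>"
  defines "M \<equiv> 8 * (N1 * N)"
  defines "\<chi>' \<equiv> (\<lambda>n. if coprime n M then Re (\<chi> n) else 0)"
  obtains n0 where "real_character M \<chi>'" "coprime n0 M" "\<chi>' n0 = -1" "n0 \<le> M"
proof -
  have dc: "dirichlet_character N \<chi>" using \<chi> by (simp add: quadratic_character_def)
  have N: "N > 0" and per: "\<And>n. \<chi> (n + N) = \<chi> n" and mult: "\<And>m n. \<chi> (m * n) = \<chi> m * \<chi> n"
    and zero: "\<And>n. \<chi> n \<noteq> 0 \<longleftrightarrow> coprime n N"
    using dc unfolding dirichlet_character_def by blast+
  have MN: "N dvd M" and M: "M > 0" using N N1 by (auto simp: M_def)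
  have im: "Im (\<chi> n) = 0" for n
    using \<chi> complex_is_Real_iff by (auto simp: quadratic_character_def)
  have perM: "\<chi> (n + M) = \<chi> n" for n
    using MN by (intro periodic_cong[of \<chi> N, OF per]) (auto simp: cong_def elim!: dvdE)
  have vals: "\<chi>' n = 1 \<or> \<chi>' n = -1" if n: "coprime n M" for n
    using quadratic_character_values[OF \<chi> coprime_divisors[OF dvd_refl MN n]] n by (auto simp: \<chi>'_def)
  have rc: "real_character M \<chi>'"
  proof
    show "M > 0" "8 dvd M" using M by (auto simp: M_def)
    show "\<chi>' (n + M) = \<chi>' n" for n
    proof -
      have "[n + M = n] (mod M)" by (simp add: cong_def)
      then have "coprime (n + M) M \<longleftrightarrow> coprime n M" by (meson cong_imp_coprime cong_sym)
      then show ?thesis by (simp only: \<chi>'_def perM)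
    qed
    show "\<chi>' (m * n) = \<chi>' m * \<chi>' n" for m n by (simp add: \<chi>'_def mult im)
  qed (rule vals)
  obtain n1 where "\<chi> n1 \<noteq> principal_character N n1" using \<chi> by (auto simp: quadratic_character_def)
  then have n1: "coprime n1 N" "\<chi> n1 \<noteq> 1"
    using zero[of n1] by (auto simp: principal_character_def split: if_splits)
  obtain n2 where n2: "[n2 = n1] (mod N)" "coprime n2 M"
    by (rule coprime_shift_exists[OF n1(1) M MN])
  have "\<chi> n2 = \<chi> n1" by (rule periodic_cong[of \<chi> N, OF per n2(1)])
  then have "\<chi> n2 = -1" using quadratic_character_values[OF \<chi> n1(1)] n1(2) by auto
  then have 2: "\<chi>' n2 = -1" using n2 by (simp add: \<chi>'_def)
  show ?thesis
  proof (rule that[OF rc])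
    have "[n2 = n2 mod M] (mod M)" by (simp add: cong_def)
    then show "coprime (n2 mod M) M" using n2(2) by (rule cong_imp_coprime)
    show "\<chi>' (n2 mod M) = -1"
      using 2 periodic_mod[of \<chi>' M n2] real_character.\<chi>_periodic[OF rc] by simp
    show "n2 mod M \<le> M" using M by (simp add: less_imp_le)
  qed
qed

lemma sigma_chi_prime:
  assumes p: "prime p" and dc: "dirichlet_character N1 \<chi>1" "dirichlet_character N2 \<chi>2"
  shows "sigma_chi \<chi>1 \<chi>2 w p = \<chi>1 p + \<chi>2 p * of_nat p ^ w"
proof -
  have "{d. d dvd p} = {1, p}" using p by (auto simp: prime_nat_iff)
  moreover have "p \<noteq> 1" using p by auto
  ultimately show ?thesis
    using dc[THEN dirichlet_character_1] p prime_gt_0_nat[OF p] by (simp add: sigma_chi_def)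
qed

lemma is_negative_at_prime:
  assumes "quadratic_character N1 \<chi>1" "quadratic_character N2 \<chi>2" "k \<ge> 2"
    and p: "prime p" "coprime p (N1 * N2)" "\<chi>2 p = -1"
  shows "is_negative_at N1 N2 k \<chi>1 \<chi>2 p"
proof -
  have dc: "dirichlet_character N1 \<chi>1" "dirichlet_character N2 \<chi>2"
    using assms(1,2) by (auto simp: quadratic_character_def)
  have "\<chi>1 p = 1 \<or> \<chi>1 p = -1" using assms(1) p(2) by (intro quadratic_character_values) auto
  then have re: "Re (\<chi>1 p) \<le> 1" "Im (\<chi>1 p) = 0" by auto
  have eq: "sigma_chi \<chi>1 \<chi>2 (k - 1) p = \<chi>1 p - of_nat (p ^ (k - 1))"
    using sigma_chi_prime[OF p(1) dc] p(3) by simp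
  have "2 ^ 1 \<le> p ^ 1" using prime_ge_2_nat[OF p(1)] by simp
  also have "\<dots> \<le> p ^ (k - 1)" using assms(3) p(1) prime_gt_0_nat by (intro power_increasing) (auto simp: Suc_le_eq)
  finally have "2 \<le> real (p ^ (k - 1))" by (metis of_nat_le_iff of_nat_numeral power_one_right)
  then have "sigma_chi \<chi>1 \<chi>2 (k - 1) p < 0"
    unfolding eq less_complex_def using re by (simp del: of_nat_power)
  then show ?thesis using p prime_gt_0_nat by (simp add: is_negative_at_def)
qed

theorem theorem4p1:
  fixes \<epsilon> :: real
  assumes "\<epsilon> > 0"
  shows "\<exists>C::real. \<forall>(N1::nat) (N2::nat) (k::nat) (\<chi>1::nat \<Rightarrow> complex) (\<chi>2::nat \<Rightarrow> complex).
           N1 > 0 \<longrightarrow> N2 > 0 \<longrightarrow> k \<ge> 2 \<longrightarrow>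
           quadratic_character N1 \<chi>1 \<longrightarrow> quadratic_character N2 \<chi>2 \<longrightarrow>
             (\<exists>n. is_negative_at N1 N2 k \<chi>1 \<chi>2 n) \<and>
             real (first_sign_change N1 N2 k \<chi>1 \<chi>2)
               \<le> C * real (N1 * N2) powr (1 / (4 * sqrt (exp 1)) + \<epsilon>)"
proof -
  define \<alpha> :: real where "\<alpha> = 1 / (4 * sqrt (exp 1))"
  define s where "s = sqrt (exp (1::real))"
  have s: "s > 1" by (simp add: s_def)
  have \<alpha>: "0 < \<alpha>" "\<alpha> \<le> 1/4" using s by (simp_all add: \<alpha>_def s_def[symmetric] field_simps)
  define \<epsilon>' where "\<epsilon>' = min \<epsilon> (1/8)"
  have \<epsilon>': "0 < \<epsilon>'" "\<epsilon>' < 1/4" "\<epsilon>' \<le> \<epsilon>" using assms by (auto simp: \<epsilon>'_def)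
  obtain M0 where M0: "\<forall>M \<chi> n0. real_character M \<chi> \<longrightarrow> coprime n0 M \<longrightarrow> \<chi> n0 = -1 \<longrightarrow> M0 \<le> real M \<longrightarrow>
    (\<exists>p. prime p \<and> coprime p M \<and> \<chi> p = -1 \<and> real p \<le> real M powr (\<alpha> + \<epsilon>'))"
    using burgess_vinogradov[OF \<epsilon>'(1,2), folded \<alpha>_def] by (rule exE)
  \<comment> \<open>The 8 absorbs the factor 8 of \<open>M\<close> raised to an exponent below 1;
    \<open>M0\<close> covers the moduli below the asymptotic range.\<close>
  define C where "C = max 8 M0"
  show ?thesis
  proof (intro exI[of _ C] allI impI)
    fix N1 N2 k :: nat and \<chi>1 \<chi>2 :: "nat \<Rightarrow> complex"
    assume N: "N1 > 0" "N2 > 0" and k: "k \<ge> 2"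
      and q1: "quadratic_character N1 \<chi>1" and q2: "quadratic_character N2 \<chi>2"
    define M where "M = 8 * (N1 * N2)"
    define \<chi> where "\<chi> = (\<lambda>n. if coprime n M then Re (\<chi>2 n) else 0)"
    obtain n0 where rc: "real_character M \<chi>" and n0: "coprime n0 M" "\<chi> n0 = -1" "n0 \<le> M"
      unfolding M_def \<chi>_def by (rule real_character_of_quadratic[OF N(1) q2])
    interpret real_character M \<chi> by (rule rc)
    have N12: "real (N1 * N2) \<ge> 1" using N by (simp add: Suc_le_eq flip: of_nat_mult)
    have "\<exists>p. prime p \<and> coprime p M \<and> \<chi> p = -1 \<and> real p \<le> C * real (N1 * N2) powr (\<alpha> + \<epsilon>')"
    proof (cases "M0 \<le> real M")
      case True
      obtain p where p: "prime p" "coprime p M" "\<chi> p = -1" "real p \<le> real M powr (\<alpha> + \<epsilon>')"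
        using M0[rule_format, OF rc n0(1,2) True] by blast
      have "real M powr (\<alpha> + \<epsilon>') = 8 powr (\<alpha> + \<epsilon>') * real (N1 * N2) powr (\<alpha> + \<epsilon>')"
        by (simp add: M_def powr_mult)
      also have "\<dots> \<le> C * real (N1 * N2) powr (\<alpha> + \<epsilon>')"
      proof (rule mult_right_mono)
        have "(8::real) powr (\<alpha> + \<epsilon>') \<le> 8 powr 1" using \<alpha> \<epsilon>' by (intro powr_mono) auto
        then show "8 powr (\<alpha> + \<epsilon>') \<le> C" by (simp add: C_def)
      qed simp
      finally show ?thesis using p by (meson order.trans)
    next
      case False
      \<comment> \<open>For \<open>M < M0\<close> size is no concern: by multiplicativity some prime
        factor of \<open>n0\<close> has value -1, and it is at most
        \<open>n0 \<le> M\<close>.\<close>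
      have "\<exists>p. prime p \<and> p dvd n0 \<and> \<chi> p \<noteq> 1"
      proof (rule ccontr)
        assume A: "\<not> ?thesis"
        have "n0 > 0"
        proof (rule ccontr)
          assume "\<not> n0 > 0"
          then have "M = 1" using n0(1) by simp
          then show False by (simp add: M_def)
        qed
        have "\<chi> n0 = 1"
        proof (rule completely_multiplicative_eq_1[OF \<chi>_mult \<chi>_1 \<open>n0 > 0\<close>])
          fix p assume "prime p" "p dvd n0"
          then show "\<chi> p = 1" using A by blast
        qed
        then show False using n0(2) by simp
      qed
      then obtain p where p: "prime p" "p dvd n0" "\<chi> p \<noteq> 1" by blast
      have cop: "coprime p M" using coprime_divisors[OF p(2) dvd_refl n0(1)] .
      have "n0 \<noteq> 0"
      proof
        assume "n0 = 0"
        then have "M = 1" using n0(1) by simp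
        then show False by (simp add: M_def)
      qed
      then have "p \<le> M" using dvd_imp_le[OF p(2)] n0(3) by simp
      then have "real p \<le> C * 1" using False by (simp add: C_def)
      also have "\<dots> \<le> C * real (N1 * N2) powr (\<alpha> + \<epsilon>')"
        using N12 \<alpha> \<epsilon>' by (intro mult_left_mono ge_one_powr_ge_zero) (auto simp: C_def)
      finally show ?thesis using p cop \<chi>_values[OF cop] by blast
    qed
    then obtain p where p: "prime p" "coprime p M" "\<chi> p = -1"
      "real p \<le> C * real (N1 * N2) powr (\<alpha> + \<epsilon>')" by blast
    have cop: "coprime p (N1 * N2)" using p(2) by (simp add: M_def)
    have "\<chi>2 p = 1 \<or> \<chi>2 p = -1" using q2 cop by (intro quadratic_character_values) auto
    then have "\<chi>2 p = -1" using p(2,3) by (auto simp: \<chi>_def)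
    then have neg: "is_negative_at N1 N2 k \<chi>1 \<chi>2 p"
      using is_negative_at_prime[OF q1 q2 k p(1) cop] by blast
    then have "first_sign_change N1 N2 k \<chi>1 \<chi>2 \<le> p" unfolding first_sign_change_def by (rule Least_le)
    then have "real (first_sign_change N1 N2 k \<chi>1 \<chi>2) \<le> C * real (N1 * N2) powr (\<alpha> + \<epsilon>')"
      using p(4) by linarith
    also have "\<dots> \<le> C * real (N1 * N2) powr (\<alpha> + \<epsilon>)"
      using N12 \<epsilon>' by (intro mult_left_mono powr_mono) (auto simp: C_def)
    finally show "(\<exists>n. is_negative_at N1 N2 k \<chi>1 \<chi>2 n) \<and>
        real (first_sign_change N1 N2 k \<chi>1 \<chi>2) \<le> C * real (N1 * N2) powr (1 / (4 * sqrt (exp 1)) + \<epsilon>)"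
      using neg unfolding \<alpha>_def by blast
  qed
qed

end
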